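(* Let $M$ be a $3$-dimensional regular Sasaki manifold with Boothby-Wang fibering $\pi:M\to\bar M$, and let $S_{\bar\gamma}$ be the Hopf cylinder over a unit-speed curve $\bar\gamma$ in $\bar M$, with mean curvature vector field $\mathbb H$. Then $\Delta^{\perp}\mathbb H=0$ if and only if $\bar\gamma$ is one of the following: 1. a geodesic; 2. a Riemannian circle; 3. a Riemannian clothoid (Cornu spiral), i.e. a curve in $\bar M$ whose curvature is a linear function of the arclength.
   Context: Conventions. A contact Riemannian $3$-manifold is $(M,\eta,\xi,\varphi,g)$ with $\eta$ a contact form, $\xi$ its Reeb vector field ($\eta(\xi)=1$, $d\eta(\xi,\cdot)=0$), $\varphi$ an endomorphism field and $g$ a Riemannian metric such that $\varphi^2=-I+\eta\otimes\xi$, $g(\varphi X,\varphi Y)=g(X,Y)-\eta(X)\eta(Y)$, $g(\xi,\cdot)=\eta$, $d\eta(X,Y)=2g(X,\varphi Y)$, where $d\eta(X,Y)=X\eta(Y)-Y\eta(X)-\eta([X,Y])$. It is a Sasaki manifold if $(\nabla_X\varphi)Y=g(X,Y)\xi-\eta(Y)X$; then $\xi$ is Killing and $\nabla_X\xi=-\varphi X$. It is regular if $\xi$ generates a one-parameter group $K$ of isometries acting simply transitively on each orbit, with orbit space $\bar M=M/K$ a smooth surface; $\bar M$ carries the metric making $\pi:M\to\bar M$ (the Boothby-Wang fibering) a Riemannian submersion and the complex structure $J\bar X=\pi_*(\varphi\bar X^* )$, where $\bar X^*$ is the horizontal lift (orthogonal to $\xi$). For a unit-speed curve $\bar\gamma$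 in $\bar M$ put $\bar{\mathbf p}_1=\bar\gamma'$, $\bar{\mathbf p}_2=J\bar{\mathbf p}_1$ and define the signed curvature $\bar\kappa$ by $\bar\nabla_{\bar\gamma'}\bar\gamma'=\bar\kappa\,\bar{\mathbf p}_2$. A Riemannian circle in $\bar M$ is a curve with constant curvature. "Linear function of the arclength $s$" means $\bar\kappa(s)=as+b$ with $a,b\in\mathbf R$. The Hopf cylinder is $S=S_{\bar\gamma}=\pi^{-1}(\bar\gamma)$ with induced metric (if $\bar\gamma$ is not injective, the immersed surface given by the pullback of $\pi$ along $\bar\gamma$). With $\mathbf t=(\bar{\mathbf p}_1)^*$ and unit normal $\mathbf n=(\bar{\mathbf p}_2)^*=\varphi\mathbf t$, $(\mathbf t,\xi)$ is an orthonormal frame of $S$, $S$ is flat with $\mathbf t,\xi$ parallel on $S$, the mean curvature is $H=(\bar\kappa\circ\pi)/2$, and $\mathbb H=H\mathbf n$. The normal Laplacian is $\Delta^\perp=-(\nabla^\perp_{\mathbf t}\nabla^\perp_{\mathbf t}+\nabla^\perp_\xi\nabla^\perp_\xi)$, $\nabla^\perp$ being the normal connection of $S$ in $M$. *)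

theory Defs
  imports "HOL-Analysis.Analysis"
begin

section \<open>Smooth manifolds\<close>

text \<open>Smoothness on an open subset of a Euclidean space: all iterated directional
  derivatives exist and are (Frechet) differentiable.\<close>

primrec Ck_on :: "nat \<Rightarrow> ('a::euclidean_space \<Rightarrow> 'b::real_normed_vector) \<Rightarrow> 'a set \<Rightarrow> bool" where
  "Ck_on 0 f U \<longleftrightarrow> continuous_on U f"
| "Ck_on (Suc k) f U \<longleftrightarrow> (\<forall>x\<in>U. f differentiable (at x)) \<and>
     (\<forall>v. Ck_on k (\<lambda>x. frechet_derivative f (at x) v) U)"

definition smooth_on :: "('a::euclidean_space \<Rightarrow> 'b::real_normed_vector) \<Rightarrow> 'a set \<Rightarrow> bool" where
  "smooth_on f U \<longleftrightarrow> (\<forall>k. Ck_on k f U)"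

text \<open>A chart is a pair of a domain and a coordinate map, whose values outside the domain
  are irrelevant. The underlying space of a manifold is a whole type, Hausdorff and second
  countable.\<close>

type_synonym ('m, 'e) chart = "'m set \<times> ('m \<Rightarrow> 'e)"

locale smooth_manifold =
  fixes A :: "('m::{t2_space,second_countable_topology}, 'e::euclidean_space) chart set"
  assumes cover: "(\<Union>(U, x)\<in>A. U) = UNIV"
    and chart: "(U, x) \<in> A \<Longrightarrow> open U \<and> open (x ` U) \<and> homeomorphism U (x ` U) x (inv_into U x)"
    and compatible: "(U, x) \<in> A \<Longrightarrow> (V, y) \<in> A \<Longrightarrow> smooth_on (y \<circ> inv_into U x) (x ` (U \<inter> V))"

definition smooth_fun :: "('m::topological_space, 'e::euclidean_space) chart set \<Rightarrow> 'm set \<Rightarrow> ('m \<Rightarrow> real) \<Rightarrow> bool" where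
  "smooth_fun A W f \<longleftrightarrow> open W \<and> (\<forall>(U, x)\<in>A. smooth_on (f \<circ> inv_into U x) (x ` (U \<inter> W)))"

definition smooth_at :: "('m::topological_space, 'e::euclidean_space) chart set \<Rightarrow> 'm \<Rightarrow> ('m \<Rightarrow> real) \<Rightarrow> bool" where
  "smooth_at A p f \<longleftrightarrow> (\<exists>W. p \<in> W \<and> smooth_fun A W f)"

definition smooth_map :: "('n::topological_space, 'd::euclidean_space) chart set \<Rightarrow>
    ('m::topological_space, 'e::euclidean_space) chart set \<Rightarrow> 'n set \<Rightarrow> ('n \<Rightarrow> 'm) \<Rightarrow> bool" where
  "smooth_map A B W F \<longleftrightarrow> open W \<and> continuous_on W F \<and>
     (\<forall>(U, x)\<in>A. \<forall>(V, y)\<in>B. smooth_on (y \<circ> F \<circ> inv_into U x) (x ` (U \<inter> W \<inter> F -` V)))"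

definition line :: "(real, real) chart set" where
  "line = {(UNIV, \<lambda>t. t)}"

text \<open>A tangent vector at \<open>p\<close> is the operator \<open>f \<mapsto> (f \<circ> c)'(0)\<close> of a smooth curve \<open>c\<close>
  through \<open>p\<close>, acting on the functions that are smooth near \<open>p\<close>. It is set to \<open>0\<close> on all
  other functions, so that equality of tangent vectors is equality in HOL.\<close>

type_synonym 'm tvec = "('m \<Rightarrow> real) \<Rightarrow> real"

definition velocity :: "('m::topological_space, 'e::euclidean_space) chart set \<Rightarrow> (real \<Rightarrow> 'm) \<Rightarrow> real \<Rightarrow> 'm tvec" where
  "velocity A c t = (\<lambda>f. if smooth_at A (c t) f then deriv (\<lambda>s. f (c s)) t else 0)"

definition tangent_space :: "('m::topological_space, 'e::euclidean_space) chart set \<Rightarrow> 'm \<Rightarrow> 'm tvec set" where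
  "tangent_space A p = {velocity A c 0 | c. c 0 = p \<and> (\<exists>e>0. smooth_map line A {-e<..<e} c)}"

definition tcomb :: "real \<Rightarrow> 'm tvec \<Rightarrow> real \<Rightarrow> 'm tvec \<Rightarrow> 'm tvec" where
  "tcomb a v b w = (\<lambda>f. a * v f + b * w f)"

abbreviation tzero :: "'m tvec" where
  "tzero \<equiv> (\<lambda>f. 0)"

text \<open>The differential \<open>F\<^sub>*v\<close> of \<open>F\<close> at \<open>q\<close>; only the atlas of the target occurs.\<close>

definition push :: "('m::topological_space, 'e::euclidean_space) chart set \<Rightarrow> ('n \<Rightarrow> 'm) \<Rightarrow> 'n \<Rightarrow> 'n tvec \<Rightarrow> 'm tvec" where
  "push B F q v = (\<lambda>f. if smooth_at B (F q) f then v (f \<circ> F) else 0)"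

text \<open>Smooth vector fields on an open set \<open>W\<close>, and near a point.\<close>

definition vfield :: "('m::topological_space, 'e::euclidean_space) chart set \<Rightarrow> 'm set \<Rightarrow> ('m \<Rightarrow> 'm tvec) \<Rightarrow> bool" where
  "vfield A W X \<longleftrightarrow> open W \<and> (\<forall>p\<in>W. X p \<in> tangent_space A p) \<and>
     (\<forall>W' f. W' \<subseteq> W \<and> smooth_fun A W' f \<longrightarrow> smooth_fun A W' (\<lambda>p. X p f))"

definition vfield_at :: "('m::topological_space, 'e::euclidean_space) chart set \<Rightarrow> 'm \<Rightarrow> ('m \<Rightarrow> 'm tvec) \<Rightarrow> bool" where
  "vfield_at A p X \<longleftrightarrow> (\<exists>W. p \<in> W \<and> vfield A W X)"

definition bracket :: "('m::topological_space, 'e::euclidean_space) chart set \<Rightarrow>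
    ('m \<Rightarrow> 'm tvec) \<Rightarrow> ('m \<Rightarrow> 'm tvec) \<Rightarrow> 'm \<Rightarrow> 'm tvec" where
  "bracket A X Y p = (\<lambda>f. if smooth_at A p f
     then X p (\<lambda>q. Y q f) - Y p (\<lambda>q. X q f) else 0)"

definition one_form :: "('m::topological_space, 'e::euclidean_space) chart set \<Rightarrow> ('m \<Rightarrow> 'm tvec \<Rightarrow> real) \<Rightarrow> bool" where
  "one_form A \<eta> \<longleftrightarrow>
     (\<forall>p. \<forall>v\<in>tangent_space A p. \<forall>w\<in>tangent_space A p. \<forall>a b.
        \<eta> p (tcomb a v b w) = a * \<eta> p v + b * \<eta> p w) \<and>
     (\<forall>W X. vfield A W X \<longrightarrow> smooth_fun A W (\<lambda>p. \<eta> p (X p)))"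

definition endo_field :: "('m::topological_space, 'e::euclidean_space) chart set \<Rightarrow> ('m \<Rightarrow> 'm tvec \<Rightarrow> 'm tvec) \<Rightarrow> bool" where
  "endo_field A \<phi> \<longleftrightarrow>
     (\<forall>p. \<forall>v\<in>tangent_space A p. \<phi> p v \<in> tangent_space A p) \<and>
     (\<forall>p. \<forall>v\<in>tangent_space A p. \<forall>w\<in>tangent_space A p. \<forall>a b.
        \<phi> p (tcomb a v b w) = tcomb a (\<phi> p v) b (\<phi> p w)) \<and>
     (\<forall>W X. vfield A W X \<longrightarrow> vfield A W (\<lambda>p. \<phi> p (X p)))"

text \<open>The exterior derivative in the normalisation
  \<open>d\<eta>(X,Y) = X \<eta>(Y) - Y \<eta>(X) - \<eta>([X,Y])\<close>.\<close>

definition ext_deriv :: "('m::topological_space, 'e::euclidean_space) chart set \<Rightarrow> ('m \<Rightarrow> 'm tvec \<Rightarrow> real) \<Rightarrow>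
    ('m \<Rightarrow> 'm tvec) \<Rightarrow> ('m \<Rightarrow> 'm tvec) \<Rightarrow> 'm \<Rightarrow> real" where
  "ext_deriv A \<eta> X Y p =
     X p (\<lambda>q. \<eta> q (Y q)) - Y p (\<lambda>q. \<eta> q (X q)) - \<eta> p (bracket A X Y p)"


section \<open>Riemannian manifolds\<close>

text \<open>\<open>D p v Y\<close> is the Levi-Civita derivative of the field \<open>Y\<close>, smooth near \<open>p\<close>, in the direction
  \<open>v\<close>. It is carried as a parameter because it is uniquely determined (on tangent vectors and
  smooth local fields) by the assumptions below. Locality in \<open>Y\<close> follows from the Leibniz rule
  applied to the indicator function of a neighbourhood of \<open>p\<close>, which is smooth near \<open>p\<close>.\<close>

locale riemannian_manifold = smooth_manifold A
  for A :: "('m::{t2_space,second_countable_topology}, 'e::euclidean_space) chart set" +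
  fixes g :: "'m \<Rightarrow> 'm tvec \<Rightarrow> 'm tvec \<Rightarrow> real"
    and D :: "'m \<Rightarrow> 'm tvec \<Rightarrow> ('m \<Rightarrow> 'm tvec) \<Rightarrow> 'm tvec"
  assumes metric_linear: "\<lbrakk>u \<in> tangent_space A p; v \<in> tangent_space A p; w \<in> tangent_space A p\<rbrakk> \<Longrightarrow>
        g p (tcomb a u b v) w = a * g p u w + b * g p v w"
    and metric_sym: "\<lbrakk>v \<in> tangent_space A p; w \<in> tangent_space A p\<rbrakk> \<Longrightarrow> g p v w = g p w v"
    and metric_pos: "\<lbrakk>v \<in> tangent_space A p; v \<noteq> tzero\<rbrakk> \<Longrightarrow> g p v v > 0"
    and metric_smooth: "\<lbrakk>vfield A W X; vfield A W Y\<rbrakk> \<Longrightarrow> smooth_fun A W (\<lambda>p. g p (X p) (Y p))"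
    and conn_smooth: "\<lbrakk>vfield A W X; vfield A W Y\<rbrakk> \<Longrightarrow> vfield A W (\<lambda>p. D p (X p) Y)"
    and conn_linear: "\<lbrakk>v \<in> tangent_space A p; w \<in> tangent_space A p; vfield_at A p Y\<rbrakk> \<Longrightarrow>
        D p (tcomb a v b w) Y = tcomb a (D p v Y) b (D p w Y)"
    and conn_add: "\<lbrakk>v \<in> tangent_space A p; vfield_at A p Y; vfield_at A p Z\<rbrakk> \<Longrightarrow>
        D p v (\<lambda>q. tcomb 1 (Y q) 1 (Z q)) = tcomb 1 (D p v Y) 1 (D p v Z)"
    and conn_leibniz: "\<lbrakk>v \<in> tangent_space A p; smooth_at A p f; vfield_at A p Y\<rbrakk> \<Longrightarrow>
        D p v (\<lambda>q h. f q * Y q h) = tcomb (v f) (Y p) (f p) (D p v Y)"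
    and conn_torsion_free: "\<lbrakk>vfield_at A p X; vfield_at A p Y\<rbrakk> \<Longrightarrow>
        tcomb 1 (D p (X p) Y) (-1) (D p (Y p) X) = bracket A X Y p"
    and conn_metric: "\<lbrakk>v \<in> tangent_space A p; vfield_at A p Y; vfield_at A p Z\<rbrakk> \<Longrightarrow>
        v (\<lambda>q. g q (Y q) (Z q)) = g p (D p v Y) (Z p) + g p (Y p) (D p v Z)"

text \<open>The connection induced by \<open>D\<close> on the pullback bundle \<open>F\<^sup>*TM\<close> of a map \<open>F : N \<rightarrow> M\<close>, in the
  direction of \<open>v \<in> T\<^sub>qN\<close>. A smooth section \<open>V\<close> of that bundle is near \<open>q\<close> of the form
  \<open>\<Sum>i. f\<^sub>i (X\<^sub>i \<circ> F)\<close>, and then \<open>\<nabla>\<^sub>v V = \<Sum>i. v(f\<^sub>i) X\<^sub>i + f\<^sub>i D\<^bsub>F\<^sub>*v\<^esub> X\<^sub>i\<close>, independently of the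
  representation. For \<open>N = line\<close> this is the covariant derivative along a curve.\<close>

definition cov_along :: "('n::topological_space, 'd::euclidean_space) chart set \<Rightarrow>
    ('m::topological_space, 'e::euclidean_space) chart set \<Rightarrow>
    ('m \<Rightarrow> 'm tvec \<Rightarrow> ('m \<Rightarrow> 'm tvec) \<Rightarrow> 'm tvec) \<Rightarrow>
    ('n \<Rightarrow> 'm) \<Rightarrow> 'n \<Rightarrow> 'n tvec \<Rightarrow> ('n \<Rightarrow> 'm tvec) \<Rightarrow> 'm tvec" where
  "cov_along A B D F q v V = (THE w. \<exists>(n::nat) f X.
     (\<forall>i<n. smooth_at A q (f i) \<and> vfield_at B (F q) (X i)) \<and>
     (\<forall>\<^sub>F r in nhds q. V r = (\<lambda>h. \<Sum>i<n. f i r * X i (F r) h)) \<and>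
     w = (\<lambda>h. \<Sum>i<n. v (f i) * X i (F q) h + f i q * D (F q) (push B F q v) (X i) h))"


section \<open>Submanifold geometry of an immersed surface\<close>

text \<open>Throughout, \<open>\<iota>\<close> is an immersion of the manifold with atlas \<open>S\<close> into the Riemannian manifold
  \<open>(A, g, D)\<close>.\<close>

definition tangent_image :: "('s::topological_space, 'd::euclidean_space) chart set \<Rightarrow>
    ('m::topological_space, 'e::euclidean_space) chart set \<Rightarrow> ('s \<Rightarrow> 'm) \<Rightarrow> 's \<Rightarrow> 'm tvec set" where
  "tangent_image S A \<iota> q = push A \<iota> q ` tangent_space S q"

definition normal_space :: "('s::topological_space, 'd::euclidean_space) chart set \<Rightarrow>
    ('m::topological_space, 'e::euclidean_space) chart set \<Rightarrow> ('m \<Rightarrow> 'm tvec \<Rightarrow> 'm tvec \<Rightarrow> real) \<Rightarrow>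
    ('s \<Rightarrow> 'm) \<Rightarrow> 's \<Rightarrow> 'm tvec set" where
  "normal_space S A g \<iota> q =
     {w \<in> tangent_space A (\<iota> q). \<forall>u\<in>tangent_image S A \<iota> q. g (\<iota> q) w u = 0}"

definition normal_part :: "('s::topological_space, 'd::euclidean_space) chart set \<Rightarrow>
    ('m::topological_space, 'e::euclidean_space) chart set \<Rightarrow> ('m \<Rightarrow> 'm tvec \<Rightarrow> 'm tvec \<Rightarrow> real) \<Rightarrow>
    ('s \<Rightarrow> 'm) \<Rightarrow> 's \<Rightarrow> 'm tvec \<Rightarrow> 'm tvec" where
  "normal_part S A g \<iota> q w = (THE n. n \<in> normal_space S A g \<iota> q \<and>
     tcomb 1 w (-1) n \<in> tangent_image S A \<iota> q)"

text \<open>\<open>(\<nabla>\<^sub>v V)\<^sup>\<bottom>\<close>. For a tangential section \<open>V = \<iota>\<^sub>*Y\<close> this is the second fundamental form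
  \<open>II(v, Y)\<close>, for a normal section \<open>V\<close> it is the normal connection \<open>\<nabla>\<^sup>\<bottom>\<^sub>v V\<close>.\<close>

definition normal_deriv :: "('s::topological_space, 'd::euclidean_space) chart set \<Rightarrow>
    ('m::topological_space, 'e::euclidean_space) chart set \<Rightarrow> ('m \<Rightarrow> 'm tvec \<Rightarrow> 'm tvec \<Rightarrow> real) \<Rightarrow>
    ('m \<Rightarrow> 'm tvec \<Rightarrow> ('m \<Rightarrow> 'm tvec) \<Rightarrow> 'm tvec) \<Rightarrow> ('s \<Rightarrow> 'm) \<Rightarrow>
    's \<Rightarrow> 's tvec \<Rightarrow> ('s \<Rightarrow> 'm tvec) \<Rightarrow> 'm tvec" where
  "normal_deriv S A g D \<iota> q v V = normal_part S A g \<iota> q (cov_along S A D \<iota> q v V)"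

definition second_fundamental_form where
  "second_fundamental_form S A g D \<iota> X Y q = normal_deriv S A g D \<iota> q (X q) (\<lambda>r. push A \<iota> r (Y r))"

text \<open>Half the trace of the second fundamental form of a surface, computed in a frame
  \<open>(E\<^sub>1, E\<^sub>2)\<close> that is orthonormal for the induced metric.\<close>

definition mean_curvature_vector where
  "mean_curvature_vector S A g D \<iota> E\<^sub>1 E\<^sub>2 q =
     tcomb (1/2) (second_fundamental_form S A g D \<iota> E\<^sub>1 E\<^sub>1 q)
           (1/2) (second_fundamental_form S A g D \<iota> E\<^sub>2 E\<^sub>2 q)"

text \<open>The normal Laplacian in a parallel orthonormal frame (so that no term
  \<open>\<nabla>\<^sup>\<bottom>\<close> in the direction of \<open>\<nabla>\<^bsub>E\<^sub>i\<^esub>E\<^sub>i\<close> occurs).\<close>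

definition normal_laplacian where
  "normal_laplacian S A g D \<iota> E\<^sub>1 E\<^sub>2 V q =
     tcomb (-1) (normal_deriv S A g D \<iota> q (E\<^sub>1 q) (\<lambda>r. normal_deriv S A g D \<iota> r (E\<^sub>1 r) V))
           (-1) (normal_deriv S A g D \<iota> q (E\<^sub>2 q) (\<lambda>r. normal_deriv S A g D \<iota> r (E\<^sub>2 r) V))"


section \<open>Regular Sasaki 3-manifolds and the Boothby-Wang fibering\<close>

locale contact_riemannian_3_manifold = riemannian_manifold A g D
  for A :: "('m::{t2_space,second_countable_topology}, real^3) chart set" and g D +
  fixes \<eta> :: "'m \<Rightarrow> 'm tvec \<Rightarrow> real"
    and \<xi> :: "'m \<Rightarrow> 'm tvec"
    and \<phi> :: "'m \<Rightarrow> 'm tvec \<Rightarrow> 'm tvec"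
  assumes one_form: "one_form A \<eta>"
    \<comment> \<open>\<open>\<eta> \<and> d\<eta>\<close> vanishes nowhere\<close>
    and contact: "\<exists>X Y Z. vfield_at A p X \<and> vfield_at A p Y \<and> vfield_at A p Z \<and>
        \<eta> p (X p) * ext_deriv A \<eta> Y Z p + \<eta> p (Y p) * ext_deriv A \<eta> Z X p +
        \<eta> p (Z p) * ext_deriv A \<eta> X Y p \<noteq> 0"
    and Reeb_field: "vfield A UNIV \<xi>"
    and Reeb_eta: "\<eta> p (\<xi> p) = 1"
    and Reeb_ext_deriv: "vfield_at A p X \<Longrightarrow> ext_deriv A \<eta> \<xi> X p = 0"
    and endo: "endo_field A \<phi>"
    and phi_phi: "v \<in> tangent_space A p \<Longrightarrow> \<phi> p (\<phi> p v) = tcomb (-1) v (\<eta> p v) (\<xi> p)"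
    and metric_phi: "\<lbrakk>v \<in> tangent_space A p; w \<in> tangent_space A p\<rbrakk> \<Longrightarrow>
        g p (\<phi> p v) (\<phi> p w) = g p v w - \<eta> p v * \<eta> p w"
    and metric_Reeb: "v \<in> tangent_space A p \<Longrightarrow> g p (\<xi> p) v = \<eta> p v"
    and ext_deriv_phi: "\<lbrakk>vfield_at A p X; vfield_at A p Y\<rbrakk> \<Longrightarrow>
        ext_deriv A \<eta> X Y p = 2 * g p (X p) (\<phi> p (Y p))"

locale sasaki_3_manifold = contact_riemannian_3_manifold A g D \<eta> \<xi> \<phi>
  for A :: "('m::{t2_space,second_countable_topology}, real^3) chart set" and g D \<eta> \<xi> \<phi> +
  assumes sasaki: "\<lbrakk>v \<in> tangent_space A p; vfield_at A p Y\<rbrakk> \<Longrightarrow>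
      tcomb 1 (D p v (\<lambda>q. \<phi> q (Y q))) (-1) (\<phi> p (D p v Y)) =
      tcomb (g p v (Y p)) (\<xi> p) (- \<eta> p (Y p)) v"

text \<open>The group \<open>K\<close> is \<open>range \<Phi>\<close>, a group of transformations of \<open>M\<close>; thus \<open>K\<close> may be
  a circle, in which case \<open>\<Phi>\<close> is not injective.\<close>

locale regular_sasaki_3_manifold = sasaki_3_manifold A g D \<eta> \<xi> \<phi>
  for A :: "('m::{t2_space,second_countable_topology}, real^3) chart set" and g D \<eta> \<xi> \<phi> +
  fixes \<Phi> :: "real \<Rightarrow> 'm \<Rightarrow> 'm"
  assumes flow_0: "\<Phi> 0 = id"
    and flow_add: "\<Phi> (s + t) = \<Phi> s \<circ> \<Phi> t"
    and flow_orbit_smooth: "smooth_map line A UNIV (\<lambda>t. \<Phi> t p)"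
    and flow_Reeb: "velocity A (\<lambda>t. \<Phi> t p) s = \<xi> (\<Phi> s p)"
    and flow_smooth: "smooth_map A A UNIV (\<Phi> t)"
    and flow_isometry: "\<lbrakk>v \<in> tangent_space A p; w \<in> tangent_space A p\<rbrakk> \<Longrightarrow>
        g (\<Phi> t p) (push A (\<Phi> t) p v) (push A (\<Phi> t) p w) = g p v w"
    and simply_transitive: "q \<in> range (\<lambda>t. \<Phi> t p) \<Longrightarrow> \<exists>!k. k \<in> range \<Phi> \<and> k p = q"

definition horizontal_space where
  "horizontal_space A g \<xi> p = {v \<in> tangent_space A p. g p (\<xi> p) v = 0}"

definition horizontal_lift where
  "horizontal_lift A g \<xi> B \<pi> p u = (THE v. v \<in> horizontal_space A g \<xi> p \<and> push B \<pi> p v = u)"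

text \<open>The orbit space is given up to diffeomorphism as a surface \<open>B\<close> with a smooth surjection \<open>\<pi>\<close>
  whose fibres are the orbits of \<open>K\<close>; as \<open>\<pi>\<close> is a submersion, \<open>B\<close> carries the quotient
  smooth structure. The last assumption defines \<open>J\<close>; the value of the right-hand side is the
  same at all points of a fibre because \<open>K\<close> preserves \<open>\<phi>\<close>.\<close>

locale boothby_wang_fibering =
  regular_sasaki_3_manifold A g D \<eta> \<xi> \<phi> \<Phi> + base: riemannian_manifold B gB DB
  for A :: "('m::{t2_space,second_countable_topology}, real^3) chart set" and g D \<eta> \<xi> \<phi> \<Phi>
    and B :: "('b::{t2_space,second_countable_topology}, real^2) chart set" and gB DB +
  fixes \<pi> :: "'m \<Rightarrow> 'b"
    and J :: "'b \<Rightarrow> 'b tvec \<Rightarrow> 'b tvec"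
  assumes proj_smooth: "smooth_map A B UNIV \<pi>"
    and proj_surj: "surj \<pi>"
    and proj_fibre: "\<pi> p = \<pi> q \<longleftrightarrow> (\<exists>k\<in>range \<Phi>. q = k p)"
    and proj_submersion: "push B \<pi> p ` horizontal_space A g \<xi> p = tangent_space B (\<pi> p)"
    and proj_isometry: "\<lbrakk>v \<in> horizontal_space A g \<xi> p; w \<in> horizontal_space A g \<xi> p\<rbrakk> \<Longrightarrow>
        gB (\<pi> p) (push B \<pi> p v) (push B \<pi> p w) = g p v w"
    and complex_structure: "u \<in> tangent_space B (\<pi> p) \<Longrightarrow>
        J (\<pi> p) u = push B \<pi> p (\<phi> p (horizontal_lift A g \<xi> B \<pi> p u))"


section \<open>Curves in the base\<close>

definition unit_speed_curve where
  "unit_speed_curve B gB I \<gamma> \<longleftrightarrow> open I \<and> is_interval I \<and> I \<noteq> {} \<and> smooth_map line B I \<gamma> \<and>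
     (\<forall>s\<in>I. gB (\<gamma> s) (velocity B \<gamma> s) (velocity B \<gamma> s) = 1)"

definition acceleration where
  "acceleration B DB \<gamma> s = cov_along line B DB \<gamma> s (velocity line (\<lambda>t. t) s) (velocity B \<gamma>)"

definition signed_curvature where
  "signed_curvature B DB J \<gamma> s =
     (THE k. acceleration B DB \<gamma> s = (\<lambda>h. k * J (\<gamma> s) (velocity B \<gamma> s) h))"

definition geodesic where
  "geodesic B DB I \<gamma> \<longleftrightarrow> (\<forall>s\<in>I. acceleration B DB \<gamma> s = tzero)"

definition riemannian_circle where
  "riemannian_circle B DB J I \<gamma> \<longleftrightarrow> (\<exists>c. \<forall>s\<in>I. signed_curvature B DB J \<gamma> s = c)"

definition riemannian_clothoid where
  "riemannian_clothoid B DB J I \<gamma> \<longleftrightarrow> (\<exists>a b. \<forall>s\<in>I. signed_curvature B DB J \<gamma> s = a * s + b)"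


section \<open>Hopf cylinders\<close>

text \<open>The Hopf cylinder is the pullback of \<open>\<pi>\<close> along \<open>\<gamma>\<close>: a surface \<open>S\<close> smoothly embedded by
  \<open>(\<sigma>, \<iota>)\<close> into \<open>I \<times> M\<close> with image \<open>{(s, p). \<pi>(p) = \<gamma>(s)}\<close>, which determines \<open>S\<close> up to
  diffeomorphism. Its immersion into \<open>M\<close> is \<open>\<iota>\<close>.\<close>

locale hopf_cylinder = smooth_manifold S
  for S :: "('s::{t2_space,second_countable_topology}, real^2) chart set" +
  fixes A :: "('m::{t2_space,second_countable_topology}, real^3) chart set"
    and \<pi> :: "'m \<Rightarrow> 'b"
    and I :: "real set"
    and \<gamma> :: "real \<Rightarrow> 'b"
    and \<sigma> :: "'s \<Rightarrow> real"
    and \<iota> :: "'s \<Rightarrow> 'm"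
  assumes sigma_smooth: "smooth_map S line UNIV \<sigma>"
    and iota_smooth: "smooth_map S A UNIV \<iota>"
    and homeo: "\<exists>h. homeomorphism UNIV {(s, p). s \<in> I \<and> \<pi> p = \<gamma> s} (\<lambda>q. (\<sigma> q, \<iota> q)) h"
    and immersion: "\<lbrakk>v \<in> tangent_space S q; push line \<sigma> q v = tzero; push A \<iota> q v = tzero\<rbrakk> \<Longrightarrow> v = tzero"

text \<open>The orthonormal frame \<open>(t, \<xi>)\<close> of the Hopf cylinder, as fields of tangent vectors of \<open>S\<close>:
  the vectors whose images under \<open>\<iota>\<^sub>*\<close> are the horizontal lift of \<open>\<gamma>'\<close> and \<open>\<xi>\<close>.\<close>

definition frame_t where
  "frame_t S A g \<xi> B \<pi> \<gamma> \<sigma> \<iota> q = (THE v. v \<in> tangent_space S q \<and>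
     push A \<iota> q v = horizontal_lift A g \<xi> B \<pi> (\<iota> q) (velocity B \<gamma> (\<sigma> q)))"

definition frame_xi where
  "frame_xi S A \<xi> \<iota> q = (THE v. v \<in> tangent_space S q \<and> push A \<iota> q v = \<xi> (\<iota> q))"

definition hopf_mean_curvature_vector where
  "hopf_mean_curvature_vector S A g D \<xi> B \<pi> \<gamma> \<sigma> \<iota> =
     mean_curvature_vector S A g D \<iota> (frame_t S A g \<xi> B \<pi> \<gamma> \<sigma> \<iota>) (frame_xi S A \<xi> \<iota>)"

definition hopf_normal_laplacian where
  "hopf_normal_laplacian S A g D \<xi> B \<pi> \<gamma> \<sigma> \<iota> =
     normal_laplacian S A g D \<iota> (frame_t S A g \<xi> B \<pi> \<gamma> \<sigma> \<iota>) (frame_xi S A \<xi> \<iota>)"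

end

theory Submission
  imports Defs
begin

text \<open>
  The vector field \<open>n = \<phi>(t)\<close> is a unit section of the normal line bundle of the cylinder, so it is
  normally parallel and \<open>\<nabla>\<^sup>\<bottom>\<^sub>v (f n) = v(f) n\<close>. O'Neill's formula for the submersion \<open>\<pi>\<close> turns
  \<open>g(\<nabla>\<^sub>t t, n)\<close> into the signed curvature \<open>\<kappa>\<close> of \<open>\<gamma>\<close>, and the integral curves of \<open>\<xi>\<close> are geodesics;
  hence the mean curvature vector is \<open>(\<kappa>/2) n\<close>. As \<open>t\<close> and \<open>\<xi>\<close> act on functions of the arclength
  as \<open>d/ds\<close> and \<open>0\<close>, its normal Laplacian is \<open>-(\<kappa>''/2) n\<close>, which vanishes exactly for affine \<open>\<kappa>\<close>.
\<close>

section \<open>Calculus of smooth maps between Euclidean spaces\<close>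

text \<open>Before any of these formulas can be used, the objects in them must be shown to exist:
  covariant derivatives along maps, normal parts, horizontal lifts, frame fields and the signed
  curvature are all given by definite descriptions. A second obstacle is that acceleration lives on
  a curve, whereas the Koszul formula speaks of fields on open sets. It is overcome by expanding
  \<gamma>' in coordinate fields of the base: the lift of \<gamma>' has the same coefficient
  functions of s with respect to the lifted fields, so the derivatives of \<gamma>' and of its lift
  agree term by term after pairing with the normal. Parallelism of n rests on rank one:
  differentiating g(n, n) = 1 kills the only component that a normal derivative could have. The
  curvature is affine with one pair of constants because the parameter domain is an interval, and
  the equation reaches every parameter because \<pi> is onto. Geodesics have curvature zero and
  circles constant curvature, so the three alternatives of the theorem collapse into the last
  one.\<close>

lemma Ck_on_cong:
  assumes "open U" "\<And>x. x \<in> U \<Longrightarrow> f x = g x" "Ck_on k f U"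
  shows "Ck_on k g U"
  using assms(2,3)
proof (induction k arbitrary: f g)
  case 0
  then show ?case by (auto cong: continuous_on_cong)
next
  case (Suc k)
  have d: "f differentiable (at x)" if "x \<in> U" for x using Suc.prems that by auto
  have e: "frechet_derivative f (at x) = frechet_derivative g (at x)" if "x \<in> U" for x
    using frechet_derivative_transform_within_open[OF d[OF that] assms(1) that] Suc.prems by blast
  have "g differentiable (at x)" if "x \<in> U" for x
    using d[OF that] has_derivative_transform_within_open[OF _ assms(1) that] Suc.prems(1)
    unfolding differentiable_def by metis
  moreover have "Ck_on k (\<lambda>x. frechet_derivative g (at x) v) U" for v
    by (rule Suc.IH[of "\<lambda>x. frechet_derivative f (at x) v"]) (use e Suc.prems(2) in auto)
  ultimately show ?case by simp
qed

lemma Ck_on_subset: "Ck_on k f V \<Longrightarrow> U \<subseteq> V \<Longrightarrow> Ck_on k f U"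
  by (induction k arbitrary: f) (auto intro: continuous_on_subset)

lemma Ck_on_Suc_imp: "Ck_on (Suc k) f U \<Longrightarrow> Ck_on k f U"
proof (induction k arbitrary: f)
  case 0
  then show ?case
    by (auto intro!: continuous_at_imp_continuous_on differentiable_imp_continuous_within)
next
  case (Suc k)
  have "\<forall>x\<in>U. f differentiable (at x)" "\<And>v. Ck_on (Suc k) (\<lambda>x. frechet_derivative f (at x) v) U"
    using Suc.prems by (simp_all only: Ck_on.simps) auto
  then show ?case using Suc.IH by simp
qed

text \<open>Differentiability at a point only sees a neighbourhood of it, so smoothness can be
  checked locally; this is what allows \<open>smooth_on\<close> to be replaced by the pointwise
  notion \<open>smooth_near\<close>.\<close>

lemma Ck_on_locally:
  assumes "\<And>x. x \<in> U \<Longrightarrow> \<exists>N. open N \<and> x \<in> N \<and> Ck_on k f N"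
  shows "Ck_on k f U"
  using assms
proof (induction k arbitrary: f)
  case 0
  then show ?case
    by (simp, intro continuous_at_imp_continuous_on ballI)
      (use continuous_on_eq_continuous_at in blast)
next
  case (Suc k)
  have "f differentiable (at x)" if "x \<in> U" for x using Suc.prems[OF that] by auto
  moreover have "Ck_on k (\<lambda>x. frechet_derivative f (at x) v) U" for v
  proof (rule Suc.IH)
    fix x assume "x \<in> U"
    then show "\<exists>N. open N \<and> x \<in> N \<and> Ck_on k (\<lambda>x. frechet_derivative f (at x) v) N"
      using Suc.prems[of x] by auto
  qed
  ultimately show ?case by simp
qed

lemma Ck_on_const: "Ck_on k (\<lambda>x. c) U"
proof (induction k arbitrary: c)
  case (Suc k)
  have "frechet_derivative (\<lambda>x. c) (at x) = (\<lambda>v. 0)" for x :: 'a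
    by (rule frechet_derivative_at[symmetric]) simp
  then show ?case using Suc by simp
qed simp

lemma Ck_on_bounded_linear_compose:
  assumes "open U" "bounded_linear L" "Ck_on k f U"
  shows "Ck_on k (\<lambda>x. L (f x)) U"
  using assms(3)
proof (induction k arbitrary: f)
  case 0
  then show ?case using bounded_linear.continuous_on[OF assms(2)] by simp
next
  case (Suc k)
  have d: "((\<lambda>x. L (f x)) has_derivative (\<lambda>v. L (frechet_derivative f (at x) v))) (at x)" if "x \<in> U" for x
    by (rule bounded_linear.has_derivative[OF assms(2)])
      (use Suc.prems that in \<open>simp add: frechet_derivative_works[symmetric]\<close>)
  have "Ck_on k (\<lambda>x. frechet_derivative (\<lambda>x. L (f x)) (at x) v) U" for v
    by (rule Ck_on_cong[OF assms(1) _ Suc.IH[of "\<lambda>x. frechet_derivative f (at x) v"]])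
      (use Suc.prems in \<open>auto intro: fun_cong[OF frechet_derivative_at[OF d]]\<close>)
  then show ?case using d by (auto simp: differentiable_def)
qed

lemma Ck_on_add:
  assumes "open U" "Ck_on k f U" "Ck_on k g U"
  shows "Ck_on k (\<lambda>x. f x + g x) U"
  using assms(2,3)
proof (induction k arbitrary: f g)
  case 0
  then show ?case by (auto intro: continuous_on_add)
next
  case (Suc k)
  have d: "((\<lambda>x. f x + g x) has_derivative
      (\<lambda>v. frechet_derivative f (at x) v + frechet_derivative g (at x) v)) (at x)" if "x \<in> U" for x
    by (rule has_derivative_add)
      (use Suc.prems that in \<open>simp_all add: frechet_derivative_works[symmetric]\<close>)
  have "Ck_on k (\<lambda>x. frechet_derivative (\<lambda>x. f x + g x) (at x) v) U" for v
    by (rule Ck_on_cong[OF assms(1) _ Suc.IH[of "\<lambda>x. frechet_derivative f (at x) v" "\<lambda>x. frechet_derivative g (at x) v"]])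
      (use Suc.prems in \<open>auto intro: fun_cong[OF frechet_derivative_at[OF d]]\<close>)
  then show ?case using d by (auto simp: differentiable_def)
qed

text \<open>The Leibniz rule leaves one factor undifferentiated in each summand;
  \<open>Ck_on_Suc_imp\<close> lowers its order so that the induction hypothesis applies.\<close>

lemma Ck_on_scaleR:
  assumes "open U" "Ck_on k f U" "Ck_on k g U"
  shows "Ck_on k (\<lambda>x. f x *\<^sub>R g x) U"
  using assms(2,3)
proof (induction k arbitrary: f g)
  case 0
  then show ?case by (auto intro: continuous_on_scaleR)
next
  case (Suc k)
  have d: "((\<lambda>x. f x *\<^sub>R g x) has_derivative
      (\<lambda>v. f x *\<^sub>R frechet_derivative g (at x) v + frechet_derivative f (at x) v *\<^sub>R g x)) (at x)" if "x \<in> U" for x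
    by (rule has_derivative_scaleR)
      (use Suc.prems that in \<open>simp_all add: frechet_derivative_works[symmetric]\<close>)
  have fg: "Ck_on k f U" "Ck_on k g U" using Suc.prems Ck_on_Suc_imp by blast+
  have "Ck_on k (\<lambda>x. f x *\<^sub>R frechet_derivative g (at x) v + frechet_derivative f (at x) v *\<^sub>R g x) U" for v
    by (intro Ck_on_add assms Suc.IH fg) (use Suc.prems in auto)
  then have "Ck_on k (\<lambda>x. frechet_derivative (\<lambda>x. f x *\<^sub>R g x) (at x) v) U" for v
    by (rule Ck_on_cong[OF assms(1), rotated]) (rule fun_cong[OF frechet_derivative_at[OF d]])
  then show ?case using d by (auto simp: differentiable_def)
qed

lemma Ck_on_sum:
  assumes "open U" "\<And>i. i \<in> K \<Longrightarrow> Ck_on k (f i) U"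
  shows "Ck_on k (\<lambda>x. \<Sum>i\<in>K. f i x) U"
  using assms(2)
  by (induction K rule: infinite_finite_induct) (auto simp: Ck_on_const intro!: Ck_on_add assms(1))

lemma Ck_on_inverse:
  fixes f :: "'a::euclidean_space \<Rightarrow> real"
  assumes "open U" "Ck_on k f U" "\<And>x. x \<in> U \<Longrightarrow> f x \<noteq> 0"
  shows "Ck_on k (\<lambda>x. inverse (f x)) U"
  using assms(2)
proof (induction k)
  case 0
  then show ?case using assms(3) by (auto intro: continuous_on_inverse)
next
  case (Suc k)
  \<comment> \<open>This is \<open>-f'/f^2\<close>, written as nested scalings so that
    \<open>Ck_on_scaleR\<close> applies; it contains the reciprocal itself, one order lower.\<close>
  let ?D = "\<lambda>x v. - 1 *\<^sub>R (inverse (f x) *\<^sub>R (frechet_derivative f (at x) v *\<^sub>R inverse (f x)))"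
  have d: "((\<lambda>x. inverse (f x)) has_derivative ?D x) (at x)" if "x \<in> U" for x
    using Deriv.has_derivative_inverse[where f = f, OF assms(3)[OF that], of "frechet_derivative f (at x)" UNIV] Suc.prems that
    by (simp add: frechet_derivative_works[symmetric] mult.assoc)
  have i: "Ck_on k (\<lambda>x. inverse (f x)) U" using Suc Ck_on_Suc_imp by blast
  have "Ck_on k (\<lambda>x. ?D x v) U" for v
    by (intro Ck_on_scaleR Ck_on_const assms i) (use Suc.prems in auto)
  then have "Ck_on k (\<lambda>x. frechet_derivative (\<lambda>x. inverse (f x)) (at x) v) U" for v
    by (rule Ck_on_cong[OF assms(1), rotated]) (rule fun_cong[OF frechet_derivative_at[OF d]])
  then show ?case using d by (auto simp: differentiable_def)
qed

text \<open>\<open>Ck_on\<close> differentiates in fixed directions only, but the chain rule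
  differentiates \<open>f\<close> in the direction \<open>F'(x) v\<close>, which moves with
  \<open>x\<close>. Expanding this direction in \<open>Basis\<close> leaves fixed directions with
  coefficients of class \<open>Ck_on k\<close>.\<close>

lemma Ck_on_compose:
  fixes F :: "'a::euclidean_space \<Rightarrow> 'b::euclidean_space" and f :: "'b \<Rightarrow> 'c::real_normed_vector"
  assumes "open U" "open V" "Ck_on k F U" "Ck_on k f V" "F ` U \<subseteq> V"
  shows "Ck_on k (\<lambda>x. f (F x)) U"
  using assms(3,4)
proof (induction k arbitrary: f)
  case 0
  then show ?case using assms(5) continuous_on_compose2 by (metis Ck_on.simps(1))
next
  case (Suc k)
  let ?D = "\<lambda>x v. \<Sum>b\<in>Basis. (frechet_derivative F (at x) v \<bullet> b) *\<^sub>R frechet_derivative f (at (F x)) b"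
  have d: "((\<lambda>x. f (F x)) has_derivative ?D x) (at x)" if "x \<in> U" for x
  proof -
    have F: "(F has_derivative frechet_derivative F (at x)) (at x)"
      using Suc.prems that by (simp add: frechet_derivative_works[symmetric])
    have f: "(f has_derivative frechet_derivative f (at (F x))) (at (F x))"
      using Suc.prems that assms(5) by (auto simp add: frechet_derivative_works[symmetric])
    interpret L: linear "frechet_derivative f (at (F x))" by (rule has_derivative_linear[OF f])
    have "frechet_derivative f (at (F x)) w = (\<Sum>b\<in>Basis. (w \<bullet> b) *\<^sub>R frechet_derivative f (at (F x)) b)" for w
      using L.sum[of "\<lambda>b. (w \<bullet> b) *\<^sub>R b" Basis] by (simp add: euclidean_representation L.scale)
    then have "(\<lambda>v. frechet_derivative f (at (F x)) (frechet_derivative F (at x) v)) = ?D x" by blast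
    then show ?thesis using has_derivative_compose[OF F f] by simp
  qed
  have "Ck_on k (\<lambda>x. ?D x v) U" for v
  proof (intro Ck_on_sum Ck_on_scaleR assms)
    fix b :: 'b
    show "Ck_on k (\<lambda>x. frechet_derivative F (at x) v \<bullet> b) U"
      by (rule Ck_on_bounded_linear_compose[OF assms(1) bounded_linear_inner_left]) (use Suc.prems in auto)
    show "Ck_on k (\<lambda>x. frechet_derivative f (at (F x)) b) U"
      by (rule Suc.IH[OF Ck_on_Suc_imp[OF Suc.prems(1)]]) (use Suc.prems(2) in simp)
  qed
  then have "Ck_on k (\<lambda>x. frechet_derivative (\<lambda>x. f (F x)) (at x) v) U" for v
    by (rule Ck_on_cong[OF assms(1), rotated]) (rule fun_cong[OF frechet_derivative_at[OF d]])
  then show ?case using d by (auto simp: differentiable_def)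
qed

text \<open>Smoothness as a property of germs: statements at a single point combine with
  \<open>eventually\<close> in \<open>nhds\<close> and avoid carrying domains around.\<close>

definition smooth_near :: "('a::euclidean_space \<Rightarrow> 'b::real_normed_vector) \<Rightarrow> 'a \<Rightarrow> bool" where
  "smooth_near f a \<longleftrightarrow> (\<exists>N. open N \<and> a \<in> N \<and> smooth_on f N)"

lemma smooth_on_iff_near:
  assumes "open U" shows "smooth_on f U \<longleftrightarrow> (\<forall>a\<in>U. smooth_near f a)"
proof
  assume "\<forall>a\<in>U. smooth_near f a"
  then show "smooth_on f U"
    unfolding smooth_near_def smooth_on_def by (intro allI Ck_on_locally) blast
qed (use assms in \<open>auto simp: smooth_near_def\<close>)

lemma smooth_near_eventually:
  assumes "smooth_near f a" shows "\<forall>\<^sub>F z in nhds a. smooth_near f z"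
proof -
  obtain N where "open N" "a \<in> N" "smooth_on f N" using assms unfolding smooth_near_def by blast
  then have "open N \<and> a \<in> N \<and> (\<forall>z\<in>N. smooth_near f z)" unfolding smooth_near_def by blast
  then show ?thesis unfolding eventually_nhds by blast
qed

lemma smooth_near_cong:
  assumes "smooth_near f a" "\<forall>\<^sub>F z in nhds a. f z = g z"
  shows "smooth_near g a"
proof -
  obtain N M where N: "open N" "a \<in> N" "smooth_on f N" and M: "open M" "a \<in> M" "\<forall>z\<in>M. f z = g z"
    using assms unfolding smooth_near_def eventually_nhds by blast
  have "smooth_on g (N \<inter> M)"
    unfolding smooth_on_def
  proof
    fix k
    have "Ck_on k f (N \<inter> M)" using N(3) Ck_on_subset unfolding smooth_on_def by blast
    then show "Ck_on k g (N \<inter> M)" using Ck_on_cong[of "N \<inter> M" f g] N M by auto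
  qed
  then show ?thesis unfolding smooth_near_def using N M by blast
qed

lemma smooth_near2:
  assumes "smooth_near f a" "smooth_near g a"
  obtains N where "open N" "a \<in> N" "smooth_on f N" "smooth_on g N"
proof -
  obtain N M where N: "open N" "a \<in> N" "smooth_on f N" and M: "open M" "a \<in> M" "smooth_on g M"
    using assms unfolding smooth_near_def by blast
  have "smooth_on f (N \<inter> M)" "smooth_on g (N \<inter> M)"
    using N M Ck_on_subset unfolding smooth_on_def by (meson inf_le1 inf_le2)+
  then show ?thesis using that N M by blast
qed

lemma smooth_near_const: "smooth_near (\<lambda>x. c) a"
  unfolding smooth_near_def smooth_on_def using Ck_on_const by blast

lemma smooth_near_add: "smooth_near f a \<Longrightarrow> smooth_near g a \<Longrightarrow> smooth_near (\<lambda>x. f x + g x) a"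
  by (erule (1) smooth_near2) (auto simp: smooth_near_def smooth_on_def intro: Ck_on_add)

lemma smooth_near_scaleR: "smooth_near f a \<Longrightarrow> smooth_near g a \<Longrightarrow> smooth_near (\<lambda>x. f x *\<^sub>R g x) a"
  by (erule (1) smooth_near2) (auto simp: smooth_near_def smooth_on_def intro: Ck_on_scaleR)

lemma smooth_near_bounded_linear:
  assumes "bounded_linear L" "smooth_near f a" shows "smooth_near (\<lambda>x. L (f x)) a"
  using assms(2) Ck_on_bounded_linear_compose[OF _ assms(1)] unfolding smooth_near_def smooth_on_def by blast

lemma smooth_near_id: "smooth_near (\<lambda>x. x) a"
proof -
  have "Ck_on k (\<lambda>x. x) UNIV" for k
    by (cases k) (auto simp: Ck_on_const)
  then show ?thesis unfolding smooth_near_def smooth_on_def by blast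
qed

lemma smooth_near_mult:
  fixes f g :: "'a::euclidean_space \<Rightarrow> real"
  shows "smooth_near f a \<Longrightarrow> smooth_near g a \<Longrightarrow> smooth_near (\<lambda>x. f x * g x) a"
  using smooth_near_scaleR[of f a g] by simp

lemma smooth_near_imp_differentiable:
  assumes "smooth_near f a"
  shows "f differentiable (at a)"
proof -
  from assms obtain N where "a \<in> N" "Ck_on (Suc 0) f N" unfolding smooth_near_def smooth_on_def by blast
  then show ?thesis by simp
qed

lemma smooth_near_frechet_derivative:
  assumes "smooth_near f a"
  shows "smooth_near (\<lambda>x. frechet_derivative f (at x) v) a"
proof -
  obtain N where N: "open N" "a \<in> N" "\<And>k. Ck_on k f N"
    using assms unfolding smooth_near_def smooth_on_def by blast
  have "Ck_on k (\<lambda>x. frechet_derivative f (at x) v) N" for k using N(3)[of "Suc k"] by simp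
  then show ?thesis using N unfolding smooth_near_def smooth_on_def by blast
qed

lemma smooth_near_has_derivative:
  "smooth_near f a \<Longrightarrow> (f has_derivative frechet_derivative f (at a)) (at a)"
  using smooth_near_imp_differentiable by (simp add: frechet_derivative_works[symmetric])

lemma smooth_near_imp_isCont: "smooth_near f a \<Longrightarrow> isCont f a"
  by (rule differentiable_imp_continuous_within[OF smooth_near_imp_differentiable])

lemma smooth_near_inverse:
  fixes f :: "'a::euclidean_space \<Rightarrow> real"
  assumes "smooth_near f a" "f a \<noteq> 0"
  shows "smooth_near (\<lambda>x. inverse (f x)) a"
proof -
  obtain N where N: "open N" "a \<in> N" "smooth_on f N" using assms unfolding smooth_near_def by blast
  obtain M where M: "open M" "a \<in> M" "\<forall>z\<in>M. f z \<noteq> 0"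
    using smooth_near_imp_isCont[OF assms(1)] assms(2) continuous_at_open[of a f]
    by (metis open_Compl Compl_iff closed_singleton singleton_iff)
  have "smooth_on (\<lambda>x. inverse (f x)) (N \<inter> M)"
    unfolding smooth_on_def
    by (intro allI Ck_on_inverse)
      (use N M in \<open>auto simp: smooth_on_def intro: Ck_on_subset[of _ f N]\<close>)
  then show ?thesis unfolding smooth_near_def using N M by blast
qed

lemma smooth_near_compose:
  fixes F :: "'a::euclidean_space \<Rightarrow> 'b::euclidean_space" and f :: "'b \<Rightarrow> 'c::real_normed_vector"
  assumes "smooth_near F a" "smooth_near f (F a)"
  shows "smooth_near (\<lambda>x. f (F x)) a"
proof -
  obtain N where N: "open N" "a \<in> N" "smooth_on F N" using assms unfolding smooth_near_def by blast
  obtain M where M: "open M" "F a \<in> M" "smooth_on f M" using assms unfolding smooth_near_def by blast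
  have c: "continuous_on N F" using N(3) Ck_on.simps(1) unfolding smooth_on_def by blast
  have o: "open (N \<inter> F -` M)" using continuous_open_preimage[OF c N(1) M(1)] .
  have "Ck_on k (\<lambda>x. f (F x)) (N \<inter> F -` M)" for k
  proof (rule Ck_on_compose[OF o M(1)])
    show "Ck_on k F (N \<inter> F -` M)"
      by (rule Ck_on_subset[of _ _ N]) (use N(3) in \<open>auto simp: smooth_on_def\<close>)
    show "Ck_on k f M" using M(3) unfolding smooth_on_def by blast
  qed blast
  then have "smooth_on (\<lambda>x. f (F x)) (N \<inter> F -` M)" unfolding smooth_on_def by blast
  then show ?thesis unfolding smooth_near_def using N M o by blast
qed

lemma deriv_eq_frechet_derivative:
  fixes f :: "real \<Rightarrow> real"
  assumes "smooth_near f a"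
  shows "deriv f a = frechet_derivative f (at a) 1" "(f has_real_derivative deriv f a) (at a)"
proof -
  have d: "(f has_derivative frechet_derivative f (at a)) (at a)" by (rule smooth_near_has_derivative[OF assms])
  have "frechet_derivative f (at a) = (*) (frechet_derivative f (at a) 1)"
  proof
    fix t
    show "frechet_derivative f (at a) t = frechet_derivative f (at a) 1 * t"
      using linear.scaleR[OF has_derivative_linear[OF d], of t 1] by simp
  qed
  then have "(f has_real_derivative frechet_derivative f (at a) 1) (at a)"
    using d unfolding has_field_derivative_def by metis
  then show "deriv f a = frechet_derivative f (at a) 1" "(f has_real_derivative deriv f a) (at a)"
    using DERIV_imp_deriv by metis+
qed

lemma smooth_near_deriv:
  fixes f :: "real \<Rightarrow> real"
  assumes "smooth_near f a"
  shows "smooth_near (deriv f) a"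
  by (rule smooth_near_cong[OF smooth_near_frechet_derivative[OF assms, of 1]])
    (use smooth_near_eventually[OF assms] in eventually_elim, simp add: deriv_eq_frechet_derivative)

text \<open>The inverse function theorem gives a differentiable inverse; smoothness follows by
  bootstrapping from \<rho>' = 1 / (\<psi>' o \<rho>), whose right side is as smooth as \<rho> is
  already known to be.\<close>

lemma smooth_local_inverse:
  fixes \<psi> :: "real \<Rightarrow> real"
  assumes "smooth_near \<psi> a" "deriv \<psi> a \<noteq> 0"
  obtains \<rho> where "smooth_near \<rho> (\<psi> a)" "\<rho> (\<psi> a) = a" "\<forall>\<^sub>F s in nhds (\<psi> a). \<psi> (\<rho> s) = s"
proof -
  obtain N where N: "open N" "a \<in> N" "smooth_on \<psi> N" using assms unfolding smooth_near_def by blast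
  let ?d = "\<lambda>x. frechet_derivative \<psi> (at x) 1"
  have near: "smooth_near \<psi> x" if "x \<in> N" for x using N that unfolding smooth_near_def by blast
  have D: "(\<psi> has_derivative blinfun_apply (blinfun_scaleR_left (?d x))) (at x)" if "x \<in> N" for x
  proof -
    have "(\<psi> has_derivative (*) (?d x)) (at x)"
      using deriv_eq_frechet_derivative[OF near[OF that]] unfolding has_field_derivative_def by simp
    moreover have "(*) (?d x) = blinfun_apply (blinfun_scaleR_left (?d x))" by (auto simp: fun_eq_iff)
    ultimately show ?thesis by simp
  qed
  have cd: "continuous_on N ?d" using N(3) unfolding smooth_on_def by (metis Ck_on.simps)
  have C: "continuous_on N (\<lambda>x. blinfun_scaleR_left (?d x) :: real \<Rightarrow>\<^sub>L real)"
    using bounded_linear.continuous_on[OF bounded_linear_blinfun_scaleR_left cd] .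
  have a0: "?d a \<noteq> 0" using assms deriv_eq_frechet_derivative(1) by metis
  \<comment> \<open>The inverse function theorem asks for a left inverse of the derivative at
    \<open>a\<close>, here multiplication by the reciprocal of \<psi>'(a).\<close>
  have inv: "blinfun_scaleR_left (inverse (?d a)) o\<^sub>L blinfun_scaleR_left (?d a) = (id_blinfun :: real \<Rightarrow>\<^sub>L real)"
    by (rule blinfun_eqI) (simp add: a0)
  obtain U' V \<rho> g' where U': "open U'" "U' \<subseteq> N" "a \<in> U'" "open V" "\<psi> a \<in> V" and hom: "homeomorphism U' V \<psi> \<rho>"
    and g: "\<And>y. y \<in> V \<Longrightarrow> (\<rho> has_derivative g' y) (at y)" "\<And>y. y \<in> V \<Longrightarrow> g' y = Hilbert_Choice.inv (blinfun_apply (blinfun_scaleR_left (?d (\<rho> y)) :: real \<Rightarrow>\<^sub>L real))"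
    "\<And>y. y \<in> V \<Longrightarrow> bij (blinfun_apply (blinfun_scaleR_left (?d (\<rho> y)) :: real \<Rightarrow>\<^sub>L real))"
    using inverse_function_theorem[OF N(1) D C N(2) inv] by metis
  have \<rho>V: "\<rho> y \<in> U'" "\<psi> (\<rho> y) = y" if "y \<in> V" for y using hom that unfolding homeomorphism_def by auto
  have nz: "?d (\<rho> y) \<noteq> 0" if "y \<in> V" for y
  proof
    assume "?d (\<rho> y) = 0"
    then have "blinfun_apply (blinfun_scaleR_left (?d (\<rho> y)) :: real \<Rightarrow>\<^sub>L real) 1 = blinfun_apply (blinfun_scaleR_left (?d (\<rho> y)) :: real \<Rightarrow>\<^sub>L real) 0" by simp
    then show False using bij_is_inj[OF g(3)[OF that]] by (metis injD one_neq_zero)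
  qed
  have D\<rho>: "(\<rho> has_derivative (\<lambda>t. t *\<^sub>R inverse (?d (\<rho> y)))) (at y)" if "y \<in> V" for y
  proof -
    have "Hilbert_Choice.inv (blinfun_apply (blinfun_scaleR_left (?d (\<rho> y)) :: real \<Rightarrow>\<^sub>L real)) = (\<lambda>t. t *\<^sub>R inverse (?d (\<rho> y)))"
      by (rule inv_equality) (use nz[OF that] in simp_all)
    then show ?thesis using g(1,2)[OF that] by simp
  qed
  have "Ck_on k \<rho> V" for k
  proof (induction k)
    case 0
    then show ?case using hom unfolding homeomorphism_def by simp
  next
    case (Suc k)
    have "Ck_on k ?d U'" using N(3) U'(2) Ck_on_subset unfolding smooth_on_def by (metis Ck_on.simps(2))
    then have "Ck_on k (\<lambda>y. ?d (\<rho> y)) V"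
      by (intro Ck_on_compose[OF U'(4) U'(1) Suc]) (use \<rho>V in auto)
    then have "Ck_on k (\<lambda>y. inverse (?d (\<rho> y))) V" by (rule Ck_on_inverse[OF U'(4)]) (rule nz)
    then have "Ck_on k (\<lambda>y. v *\<^sub>R inverse (?d (\<rho> y))) V" for v
      by (intro Ck_on_scaleR U' Ck_on_const)
    then have "Ck_on k (\<lambda>y. frechet_derivative \<rho> (at y) v) V" for v
      by (rule Ck_on_cong[OF U'(4), rotated]) (rule fun_cong[OF frechet_derivative_at[OF D\<rho>]])
    then show ?case using D\<rho> by (auto simp: differentiable_def)
  qed
  then have "smooth_near \<rho> (\<psi> a)" unfolding smooth_near_def smooth_on_def using U' by blast
  moreover have "\<rho> (\<psi> a) = a" using hom U' unfolding homeomorphism_def by blast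
  moreover have "\<forall>\<^sub>F s in nhds (\<psi> a). \<psi> (\<rho> s) = s" unfolding eventually_nhds using U' \<rho>V by blast
  ultimately show thesis using that by blast
qed

section \<open>Smooth functions and maps\<close>

lemma frechet_derivative_cong:
  assumes "smooth_near f a" "\<forall>\<^sub>F z in nhds a. f z = g z"
  shows "frechet_derivative f (at a) = frechet_derivative g (at a)"
proof -
  obtain M where M: "open M" "a \<in> M" "\<forall>z\<in>M. f z = g z" using assms(2) unfolding eventually_nhds by blast
  then show ?thesis
    using frechet_derivative_transform_within_open[OF smooth_near_imp_differentiable[OF assms(1)] M(1,2)] by blast
qed

lemma frechet_derivative_compose_near:
  assumes "smooth_near F a" "smooth_near f (F a)"
  shows "frechet_derivative (\<lambda>z. f (F z)) (at a) v = frechet_derivative f (at (F a)) (frechet_derivative F (at a) v)"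
  using frechet_derivative_at[OF has_derivative_compose[OF smooth_near_has_derivative[OF assms(1)] smooth_near_has_derivative[OF assms(2)]]]
  by metis

lemma frechet_derivative_linear:
  assumes "smooth_near f a"
  shows "frechet_derivative f (at a) (s *\<^sub>R u + t *\<^sub>R v) =
    s *\<^sub>R frechet_derivative f (at a) u + t *\<^sub>R frechet_derivative f (at a) v"
proof -
  interpret linear "frechet_derivative f (at a)"
    by (rule has_derivative_linear[OF smooth_near_has_derivative[OF assms]])
  show ?thesis by (simp add: add scale)
qed

section \<open>Charts and functions that are smooth at a point\<close>

context smooth_manifold
begin

lemma obtain_chart: obtains U x where "(U, x) \<in> A" "p \<in> U"
proof -
  have "p \<in> (\<Union>(U, x)\<in>A. U)" using cover by simp
  then show thesis using that by blast
qed

lemma chart_props: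
  assumes "(U, x) \<in> A"
  shows chart_open: "open U" and chart_open_image: "open (x ` U)"
    and chart_continuous: "continuous_on U x" and chart_inv_continuous: "continuous_on (x ` U) (inv_into U x)"
    and chart_inv: "\<And>p. p \<in> U \<Longrightarrow> inv_into U x (x p) = p"
    and chart_inv_in: "\<And>z. z \<in> x ` U \<Longrightarrow> inv_into U x z \<in> U"
    and chart_of_inv: "\<And>z. z \<in> x ` U \<Longrightarrow> x (inv_into U x z) = z"
  using chart[OF assms] unfolding homeomorphism_def by (auto simp: inv_into_into f_inv_into_f)

lemma chart_image_open:
  assumes "(U, x) \<in> A" "open W"
  shows "open (x ` (U \<inter> W))"
proof -
  have "x ` (U \<inter> W) = x ` U \<inter> inv_into U x -` W"
  proof (intro equalityI subsetI)
    fix z assume "z \<in> x ` U \<inter> inv_into U x -` W"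
    then have "inv_into U x z \<in> U \<inter> W" "x (inv_into U x z) = z" using chart_props(6,7)[OF assms(1)] by auto
    then show "z \<in> x ` (U \<inter> W)" by (metis imageI)
  qed (use chart_props(5)[OF assms(1)] in auto)
  then show ?thesis
    using continuous_open_preimage[OF chart_inv_continuous chart_open_image assms(2)] assms(1) by simp
qed

text \<open>Local equalities on the manifold become local equalities of coordinate expressions in
  this way.\<close>

lemma eventually_chart_inv:
  assumes "(U, x) \<in> A" "p \<in> U" "eventually P (nhds p)"
  shows "\<forall>\<^sub>F z in nhds (x p). z \<in> x ` U \<and> P (inv_into U x z)"
proof -
  obtain M where M: "open M" "p \<in> M" "\<forall>z\<in>M. P z" using assms(3) unfolding eventually_nhds by blast
  have "open (x ` (U \<inter> M)) \<and> x p \<in> x ` (U \<inter> M) \<and> (\<forall>z\<in>x ` (U \<inter> M). z \<in> x ` U \<and> P (inv_into U x z))"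
    using chart_image_open[OF assms(1) M(1)] chart_inv[OF assms(1)] assms(2) M by auto
  then show ?thesis unfolding eventually_nhds by blast
qed

lemma transition_smooth:
  assumes "(U, x) \<in> A" "(V, y) \<in> A" "p \<in> U" "p \<in> V"
  shows "smooth_near (\<lambda>z. y (inv_into U x z)) (x p)"
  using compatible[OF assms(1,2)] chart_image_open[OF assms(1) chart_open[OF assms(2)]] assms(3,4)
  unfolding smooth_near_def by (auto simp: comp_def intro!: exI[of _ "x ` (U \<inter> V)"])

text \<open>Compose with the transition map. The composite agrees with the coordinate expression in
  \<open>(V, y)\<close> only where \<open>inv_into V y\<close> takes values in \<open>U\<close>,
  hence the passage through germs.\<close>

lemma change_of_chart:
  fixes f :: "'m \<Rightarrow> 'c::real_normed_vector"
  assumes "(U, x) \<in> A" "(V, y) \<in> A" "p \<in> U" "p \<in> V" "smooth_near (\<lambda>z. f (inv_into U x z)) (x p)"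
  shows "smooth_near (\<lambda>z. f (inv_into V y z)) (y p)"
proof (rule smooth_near_cong)
  show "smooth_near (\<lambda>z. f (inv_into U x (x (inv_into V y z)))) (y p)"
    by (rule smooth_near_compose[of "\<lambda>z. x (inv_into V y z)"])
      (use transition_smooth[OF assms(2,1,4,3)] assms(5) chart_inv[OF assms(2,4)] in auto)
  show "\<forall>\<^sub>F z in nhds (y p). f (inv_into U x (x (inv_into V y z))) = f (inv_into V y z)"
    using eventually_chart_inv[OF assms(2,4) eventually_nhds_in_open[OF chart_open[OF assms(1)] assms(3)]]
    by eventually_elim (simp add: chart_inv[OF assms(1)])
qed

text \<open>Transition maps are smooth, so the quantifier over all charts in
  \<open>smooth_fun\<close> follows from one chart. The closure properties of
  \<open>smooth_at\<close> are then inherited from Euclidean space.\<close>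

lemma smooth_at_iff:
  assumes "(U, x) \<in> A" "p \<in> U"
  shows "smooth_at A p f \<longleftrightarrow> smooth_near (\<lambda>z. f (inv_into U x z)) (x p)"
proof
  assume "smooth_at A p f"
  then obtain W where W: "p \<in> W" "open W" "smooth_on (f \<circ> inv_into U x) (x ` (U \<inter> W))"
    using assms unfolding smooth_at_def smooth_fun_def by fast
  then show "smooth_near (\<lambda>z. f (inv_into U x z)) (x p)"
    using chart_image_open[OF assms(1) W(2)] assms(2) unfolding smooth_near_def
    by (auto simp: comp_def intro!: exI[of _ "x ` (U \<inter> W)"])
next
  assume "smooth_near (\<lambda>z. f (inv_into U x z)) (x p)"
  then obtain N where N: "open N" "x p \<in> N" "smooth_on (\<lambda>z. f (inv_into U x z)) N"
    unfolding smooth_near_def by blast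
  let ?W = "U \<inter> x -` N"
  have o: "open ?W"
    using continuous_open_preimage[OF chart_continuous[OF assms(1)] chart_open[OF assms(1)] N(1)] .
  have "smooth_on (f \<circ> inv_into V y) (y ` (V \<inter> ?W))" if "(V, y) \<in> A" for V y
    unfolding smooth_on_iff_near[OF chart_image_open[OF that o]]
  proof
    fix z assume "z \<in> y ` (V \<inter> ?W)"
    then obtain q where q: "z = y q" "q \<in> V" "q \<in> U" "x q \<in> N" by blast
    have "smooth_near (\<lambda>z. f (inv_into U x z)) (x q)" using N q unfolding smooth_near_def by blast
    from change_of_chart[OF assms(1) that q(3,2) this]
    show "smooth_near (f \<circ> inv_into V y) z" by (simp add: q comp_def)
  qed
  then have "smooth_fun A ?W f" unfolding smooth_fun_def using o by blast
  then show "smooth_at A p f" unfolding smooth_at_def using assms N by (intro exI[of _ ?W]) auto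
qed

lemma smooth_fun_iff: "smooth_fun A W f \<longleftrightarrow> open W \<and> (\<forall>p\<in>W. smooth_at A p f)"
proof
  assume "smooth_fun A W f"
  then show "open W \<and> (\<forall>p\<in>W. smooth_at A p f)" unfolding smooth_at_def smooth_fun_def by blast
next
  assume W: "open W \<and> (\<forall>p\<in>W. smooth_at A p f)"
  have "smooth_on (f \<circ> inv_into U x) (x ` (U \<inter> W))" if "(U, x) \<in> A" for U x
    unfolding smooth_on_iff_near[OF chart_image_open[OF that conjunct1[OF W]]]
    using W smooth_at_iff[OF that] by (auto simp: comp_def)
  then show "smooth_fun A W f" unfolding smooth_fun_def using W by blast
qed

lemma eventually_smooth_at: "smooth_at A p f \<Longrightarrow> \<forall>\<^sub>F q in nhds p. smooth_at A q f"
  unfolding smooth_at_def[of A p f] eventually_nhds smooth_fun_iff by blast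

lemma smooth_at_cong:
  assumes "smooth_at A p f" "\<forall>\<^sub>F q in nhds p. f q = h q"
  shows "smooth_at A p h"
proof -
  obtain U x where U: "(U, x) \<in> A" "p \<in> U" by (rule obtain_chart)
  show ?thesis using assms(1) unfolding smooth_at_iff[OF U]
    by (rule smooth_near_cong)
      (use eventually_chart_inv[OF U assms(2)] in \<open>eventually_elim, blast\<close>)
qed

lemma smooth_at_const: "smooth_at A p (\<lambda>q. c)"
proof -
  obtain U x where U: "(U, x) \<in> A" "p \<in> U" by (rule obtain_chart)
  show ?thesis unfolding smooth_at_iff[OF U] by (rule smooth_near_const)
qed

lemma smooth_at_add:
  assumes "smooth_at A p f" "smooth_at A p h"
  shows "smooth_at A p (\<lambda>q. f q + h q)"
proof -
  obtain U x where U: "(U, x) \<in> A" "p \<in> U" by (rule obtain_chart)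
  show ?thesis using assms unfolding smooth_at_iff[OF U] by (rule smooth_near_add)
qed

lemma smooth_at_mult:
  assumes "smooth_at A p f" "smooth_at A p h"
  shows "smooth_at A p (\<lambda>q. f q * h q)"
proof -
  obtain U x where U: "(U, x) \<in> A" "p \<in> U" by (rule obtain_chart)
  show ?thesis using assms unfolding smooth_at_iff[OF U] by (rule smooth_near_mult)
qed

lemma smooth_at_minus: "smooth_at A p f \<Longrightarrow> smooth_at A p (\<lambda>q. - f q)"
  using smooth_at_mult[OF smooth_at_const[of p "-1"]] by simp

lemma smooth_at_sum:
  "(\<And>i. i \<in> K \<Longrightarrow> smooth_at A p (f i)) \<Longrightarrow> smooth_at A p (\<lambda>q. \<Sum>i\<in>K. f i q)"
  by (induction K rule: infinite_finite_induct) (auto simp: smooth_at_const intro!: smooth_at_add)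

lemma smooth_at_inverse:
  assumes "smooth_at A p f" "f p \<noteq> 0" shows "smooth_at A p (\<lambda>q. inverse (f q))"
proof -
  obtain U x where U: "(U, x) \<in> A" "p \<in> U" by (rule obtain_chart)
  show ?thesis using assms chart_inv[OF U] unfolding smooth_at_iff[OF U]
    by (intro smooth_near_inverse) auto
qed

lemma smooth_at_real_compose:
  assumes "smooth_at A p f" "smooth_near k (f p)" shows "smooth_at A p (\<lambda>q. k (f q))"
proof -
  obtain U x where U: "(U, x) \<in> A" "p \<in> U" by (rule obtain_chart)
  show ?thesis using assms(1) unfolding smooth_at_iff[OF U]
    by (rule smooth_near_compose) (use assms(2) chart_inv[OF U] in simp)
qed

lemma smooth_at_coordinate:
  assumes "(U, x) \<in> A" "p \<in> U"
  shows "smooth_at A p (\<lambda>q. x q \<bullet> b)"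
proof -
  have "\<forall>\<^sub>F z in nhds (x p). z \<bullet> b = x (inv_into U x z) \<bullet> b"
    using eventually_nhds_in_open[OF chart_open_image[OF assms(1)] imageI[OF assms(2)]]
    by eventually_elim (simp add: chart_of_inv[OF assms(1)])
  then show ?thesis unfolding smooth_at_iff[OF assms]
    by (rule smooth_near_cong[OF smooth_near_bounded_linear[OF bounded_linear_inner_left smooth_near_id]])
qed

lemma smooth_at_isCont:
  assumes "smooth_at A p f" shows "isCont f p"
proof -
  obtain U x where U: "(U, x) \<in> A" "p \<in> U" by (rule obtain_chart)
  have 1: "isCont (\<lambda>z. f (inv_into U x z)) (x p)"
    using assms smooth_near_imp_isCont unfolding smooth_at_iff[OF U] by blast
  have 2: "isCont x p" using chart_continuous[OF U(1)] chart_open[OF U(1)] U(2) continuous_on_eq_continuous_at by blast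
  have 3: "\<forall>\<^sub>F q in nhds p. f (inv_into U x (x q)) = f q"
    using eventually_nhds_in_open[OF chart_open[OF U(1)] U(2)] by eventually_elim (simp add: chart_inv[OF U(1)])
  show ?thesis using isCont_o2[OF 2 1] isCont_cong[OF 3] by blast
qed

section \<open>Smooth maps in charts\<close>

lemma smooth_map_near:
  assumes "smooth_manifold N" "smooth_map N A W F" "q \<in> W" "(V, y) \<in> N" "q \<in> V" "(U, x) \<in> A" "F q \<in> U"
  shows "smooth_near (\<lambda>z. x (F (inv_into V y z))) (y q)"
proof -
  interpret N: smooth_manifold N by fact
  have W: "open W" "continuous_on W F" and s: "smooth_on (x \<circ> F \<circ> inv_into V y) (y ` (V \<inter> W \<inter> F -` U))"
    using assms(2,4,6) unfolding smooth_map_def by fast+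
  have "open (y ` (V \<inter> (W \<inter> F -` U)))"
    by (intro N.chart_image_open assms continuous_open_preimage W chart_open[OF assms(6)])
  then show ?thesis using s assms unfolding smooth_near_def
    by (intro exI[of _ "y ` (V \<inter> W \<inter> F -` U)"]) (auto simp: comp_def Int_assoc)
qed

lemma eventually_smooth_map:
  assumes "smooth_map N A W F" "q \<in> W" "eventually P (nhds (F q))"
  shows "\<forall>\<^sub>F r in nhds q. P (F r)"
proof -
  obtain M where M: "open M" "F q \<in> M" "\<forall>z\<in>M. P z" using assms(3) unfolding eventually_nhds by blast
  have "open (W \<inter> F -` M)"
    using assms(1) continuous_open_preimage M(1) unfolding smooth_map_def by blast
  then have "open (W \<inter> F -` M) \<and> q \<in> W \<inter> F -` M \<and> (\<forall>r\<in>W \<inter> F -` M. P (F r))"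
    using M assms(2) by auto
  then show ?thesis unfolding eventually_nhds by blast
qed

lemma smooth_at_compose:
  assumes "smooth_manifold N" "smooth_map N A W F" "q \<in> W" "smooth_at A (F q) f"
  shows "smooth_at N q (\<lambda>r. f (F r))"
proof -
  interpret N: smooth_manifold N by fact
  obtain V y where V: "(V, y) \<in> N" "q \<in> V" by (rule N.obtain_chart)
  obtain U x where U: "(U, x) \<in> A" "F q \<in> U" by (rule obtain_chart)
  have "smooth_near (\<lambda>z. f (inv_into U x (x (F (inv_into V y z))))) (y q)"
    by (rule smooth_near_compose[OF smooth_map_near[OF assms(1-3) V U]])
      (use assms(4) in \<open>simp add: smooth_at_iff[OF U] N.chart_inv[OF V]\<close>)
  moreover have "\<forall>\<^sub>F z in nhds (y q). f (inv_into U x (x (F (inv_into V y z)))) = f (F (inv_into V y z))"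
    using N.eventually_chart_inv[OF V eventually_smooth_map[OF assms(2,3) eventually_nhds_in_open[OF chart_open[OF U(1)] U(2)]]]
    by eventually_elim (simp add: chart_inv[OF U(1)])
  ultimately show ?thesis unfolding N.smooth_at_iff[OF V] by (rule smooth_near_cong)
qed

end

lemma inv_into_UNIV_ident [simp]: "inv_into UNIV (\<lambda>t. t) = (\<lambda>t. t)"
  by (intro ext) (simp add: inv_into_def)

interpretation line: smooth_manifold line
proof
  show "smooth_on (y \<circ> inv_into U x) (x ` (U \<inter> V))" if "(U, x) \<in> line" "(V, y) \<in> line" for U V :: "real set" and x y
    using that smooth_near_id by (auto simp: line_def comp_def smooth_on_iff_near)
qed (auto simp: line_def homeomorphism_def)

lemma smooth_at_line_iff: "smooth_at line s f \<longleftrightarrow> smooth_near f s"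
  using line.smooth_at_iff[of UNIV "\<lambda>t. t" s f] by (simp add: line_def)

section \<open>Tangent vectors and vector fields\<close>

text \<open>The partial derivative of the chart in the direction \<open>u\<close>. The default value
  on functions that are not smooth at \<open>p\<close> is that of \<open>velocity\<close>, so that
  the two can be equal as operators.\<close>

definition coord_vec :: "('m::topological_space, 'e::euclidean_space) chart set \<Rightarrow> 'm set \<Rightarrow> ('m \<Rightarrow> 'e) \<Rightarrow> 'e \<Rightarrow> 'm \<Rightarrow> 'm tvec" where
  "coord_vec A U x u p =
    (\<lambda>f. if smooth_at A p f then frechet_derivative (\<lambda>z. f (inv_into U x z)) (at (x p)) u else 0)"

context smooth_manifold
begin

lemma coord_vec_linear:
  assumes "(U, x) \<in> A" "p \<in> U"
  shows "coord_vec A U x (s *\<^sub>R u + t *\<^sub>R v) p = tcomb s (coord_vec A U x u p) t (coord_vec A U x v p)"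
proof
  fix f :: "'m \<Rightarrow> real"
  show "coord_vec A U x (s *\<^sub>R u + t *\<^sub>R v) p f = tcomb s (coord_vec A U x u p) t (coord_vec A U x v p) f"
  proof (cases "smooth_at A p f")
    case True
    then have "smooth_near (\<lambda>z. f (inv_into U x z)) (x p)" unfolding smooth_at_iff[OF assms] .
    from frechet_derivative_linear[OF this] show ?thesis using True by (simp add: coord_vec_def tcomb_def)
  qed (simp add: coord_vec_def tcomb_def)
qed

lemma velocity_eq_coord_vec:
  assumes "smooth_map line A W c" "t \<in> W" "(U, x) \<in> A" "c t \<in> U"
  shows "velocity A c t = coord_vec A U x (frechet_derivative (\<lambda>s. x (c s)) (at t) 1) (c t)"
proof
  fix f :: "'m \<Rightarrow> real"
  let ?f = "\<lambda>z. f (inv_into U x z)"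
  have xc: "smooth_near (\<lambda>s. x (c s)) t"
    using smooth_map_near[OF line.smooth_manifold_axioms assms(1,2) _ _ assms(3,4), of UNIV "\<lambda>t. t"]
    by (simp add: line_def)
  show "velocity A c t f = coord_vec A U x (frechet_derivative (\<lambda>s. x (c s)) (at t) 1) (c t) f"
  proof (cases "smooth_at A (c t) f")
    case True
    have fc: "smooth_near (\<lambda>s. f (c s)) t"
      using smooth_at_compose[OF line.smooth_manifold_axioms assms(1,2) True] by (simp add: smooth_at_line_iff)
    have F: "smooth_near ?f (x (c t))" using True unfolding smooth_at_iff[OF assms(3,4)] .
    have ev: "\<forall>\<^sub>F s in nhds t. f (c s) = ?f (x (c s))"
      using eventually_smooth_map[OF assms(1,2) eventually_nhds_in_open[OF chart_open[OF assms(3)] assms(4)]]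
      by eventually_elim (simp add: chart_inv[OF assms(3)])
    have "deriv (\<lambda>s. f (c s)) t = frechet_derivative (\<lambda>s. ?f (x (c s))) (at t) 1"
      by (simp add: deriv_eq_frechet_derivative(1)[OF fc] frechet_derivative_cong[OF fc ev])
    also have "\<dots> = frechet_derivative ?f (at (x (c t))) (frechet_derivative (\<lambda>s. x (c s)) (at t) 1)"
      by (rule frechet_derivative_compose_near[OF xc F])
    finally show ?thesis using True by (simp add: velocity_def coord_vec_def)
  qed (simp add: velocity_def coord_vec_def)
qed

text \<open>The witness is the straight line \<open>x p + t u\<close> read back through the chart;
  \<open>e\<close> is chosen so that the line stays in the image of the chart.\<close>

lemma coord_vec_tangent:
  assumes "(U, x) \<in> A" "p \<in> U"
  shows "coord_vec A U x u p \<in> tangent_space A p"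
proof -
  let ?L = "\<lambda>t. x p + t *\<^sub>R u"
  let ?c = "\<lambda>t. inv_into U x (?L t)"
  have L: "smooth_near ?L t" for t
    by (intro smooth_near_add smooth_near_scaleR smooth_near_const smooth_near_id)
  have "open (?L -` (x ` U))"
    by (intro open_vimage chart_open_image[OF assms(1)] continuous_intros)
  moreover have "0 \<in> ?L -` (x ` U)" using assms(2) by simp
  ultimately obtain e where e: "e > 0" "ball 0 e \<subseteq> ?L -` (x ` U)"
    by (rule openE)
  have eU: "?L t \<in> x ` U" if "t \<in> {-e<..<e}" for t
  proof -
    have "t \<in> ball 0 e" using that by (auto simp: dist_real_def)
    then show ?thesis using e(2) by blast
  qed
  have cc: "continuous_on {-e<..<e} ?c"
  proof (rule continuous_on_compose2[OF chart_inv_continuous[OF assms(1)], of _ ?L])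
    show "continuous_on {-e<..<e} ?L" by (intro continuous_intros)
    show "?L ` {-e<..<e} \<subseteq> x ` U" using eU by blast
  qed
  have *: "smooth_on (\<lambda>s. y (inv_into U x (?L s))) ({-e<..<e} \<inter> ?c -` V)"
    if V: "(V, y) \<in> A" for V y
  proof -
    have o: "open ({-e<..<e} \<inter> ?c -` V)" by (rule continuous_open_preimage[OF cc _ chart_open[OF V]]) simp
    have "smooth_near (\<lambda>s. y (inv_into U x (?L s))) t" if "t \<in> {-e<..<e} \<inter> ?c -` V" for t
    proof (rule smooth_near_compose[OF L])
      have "?c t \<in> U" "x (?c t) = ?L t" using chart_inv_in[OF assms(1)] chart_of_inv[OF assms(1)] eU that by auto
      then show "smooth_near (\<lambda>z. y (inv_into U x z)) (?L t)"
        using transition_smooth[OF assms(1) V, of "?c t"] that by simp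
    qed
    then show ?thesis unfolding smooth_on_iff_near[OF o] by blast
  qed
  have c: "smooth_map line A {-e<..<e} ?c"
    unfolding smooth_map_def line_def using * cc by (clarsimp simp: comp_def)
  have c0: "?c 0 = p" using chart_inv[OF assms] by simp
  have "\<forall>\<^sub>F s in nhds 0. x (?c s) = ?L s"
    unfolding eventually_nhds using e(1) eU chart_of_inv[OF assms(1)]
    by (intro exI[of _ "{-e<..<e}"]) auto
  then have "\<forall>\<^sub>F s in nhds 0. ?L s = x (?c s)" by eventually_elim simp
  then have "frechet_derivative (\<lambda>s. x (?c s)) (at 0) = frechet_derivative ?L (at 0)"
    by (rule frechet_derivative_cong[OF L, symmetric])
  also have "\<dots> = (\<lambda>t. t *\<^sub>R u)"
    by (rule frechet_derivative_at[symmetric]) (auto intro!: derivative_eq_intros)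
  finally have "velocity A ?c 0 = coord_vec A U x u p"
    using velocity_eq_coord_vec[OF c _ assms(1), of 0] e(1) c0 assms(2) by simp
  then show ?thesis unfolding tangent_space_def using c c0 e(1) by (intro CollectI exI[of _ ?c]) auto
qed

text \<open>Velocities of curves carry no evident linear structure, whereas coordinate vectors
  depend linearly on \<open>u\<close>. Linear combinations and derivation rules are read off from
  this description.\<close>

lemma tangent_space_eq:
  assumes "(U, x) \<in> A" "p \<in> U"
  shows "tangent_space A p = range (\<lambda>u. coord_vec A U x u p)"
proof
  show "tangent_space A p \<subseteq> range (\<lambda>u. coord_vec A U x u p)"
  proof
    fix v assume "v \<in> tangent_space A p"
    then obtain c e where "v = velocity A c 0" "c 0 = p" "e > 0" "smooth_map line A {-e<..<e} c"
      unfolding tangent_space_def by blast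
    then show "v \<in> range (\<lambda>u. coord_vec A U x u p)"
      using velocity_eq_coord_vec[of "{-e<..<e}" c 0 U x] assms by auto
  qed
qed (use coord_vec_tangent[OF assms] in blast)

lemma velocity_tangent:
  assumes "smooth_map line A W c" "t \<in> W"
  shows "velocity A c t \<in> tangent_space A (c t)"
proof -
  obtain U x where U: "(U, x) \<in> A" "c t \<in> U" by (rule obtain_chart)
  show ?thesis using velocity_eq_coord_vec[OF assms U] coord_vec_tangent[OF U] by simp
qed

lemma coord_vec_coordinate:
  assumes "(U, x) \<in> A" "p \<in> U"
  shows "coord_vec A U x u p (\<lambda>q. x q \<bullet> b) = u \<bullet> b"
proof -
  have ev: "\<forall>\<^sub>F z in nhds (x p). z \<bullet> b = x (inv_into U x z) \<bullet> b"
    using eventually_nhds_in_open[OF chart_open_image[OF assms(1)] imageI[OF assms(2)]]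
    by eventually_elim (simp add: chart_of_inv[OF assms(1)])
  have "frechet_derivative (\<lambda>z. x (inv_into U x z) \<bullet> b) (at (x p)) = frechet_derivative (\<lambda>z. z \<bullet> b) (at (x p))"
    using frechet_derivative_cong[OF smooth_near_bounded_linear[OF bounded_linear_inner_left smooth_near_id] ev] by simp
  also have "\<dots> = (\<lambda>z. z \<bullet> b)"
    by (rule frechet_derivative_at[symmetric]) (auto intro!: derivative_eq_intros)
  finally show ?thesis using smooth_at_coordinate[OF assms] by (simp add: coord_vec_def)
qed

section \<open>Linear structure, locality and derivation rules of tangent vectors\<close>

lemma tangent_tcomb:
  assumes "v \<in> tangent_space A p" "w \<in> tangent_space A p"
  shows "tcomb a v b w \<in> tangent_space A p"
proof -
  obtain U x where U: "(U, x) \<in> A" "p \<in> U" by (rule obtain_chart)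
  obtain u u' where "v = coord_vec A U x u p" "w = coord_vec A U x u' p"
    using assms unfolding tangent_space_eq[OF U] by blast
  then have "tcomb a v b w = coord_vec A U x (a *\<^sub>R u + b *\<^sub>R u') p" by (simp add: coord_vec_linear[OF U])
  then show ?thesis using coord_vec_tangent[OF U] by simp
qed

lemma tangent_zero: "tzero \<in> tangent_space A p"
proof -
  obtain U x where U: "(U, x) \<in> A" "p \<in> U" by (rule obtain_chart)
  have "tcomb 0 (coord_vec A U x 0 p) 0 (coord_vec A U x 0 p) = tzero" by (simp add: tcomb_def)
  then show ?thesis using tangent_tcomb[OF coord_vec_tangent[OF U] coord_vec_tangent[OF U]] by metis
qed

lemma tangent_scale: "v \<in> tangent_space A p \<Longrightarrow> (\<lambda>h. a * v h) \<in> tangent_space A p"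
  using tangent_tcomb[of v p tzero a 0] tangent_zero by (simp add: tcomb_def)

lemma tangent_lincomb:
  "(\<And>i. i \<in> K \<Longrightarrow> X i \<in> tangent_space A p) \<Longrightarrow> (\<lambda>h. \<Sum>i\<in>K. a i * X i h) \<in> tangent_space A p"
proof (induction K rule: infinite_finite_induct)
  case (insert k K)
  then have "tcomb (a k) (X k) 1 (\<lambda>h. \<Sum>i\<in>K. a i * X i h) \<in> tangent_space A p" by (intro tangent_tcomb) auto
  then show ?case using insert by (simp add: tcomb_def)
qed (auto simp: tangent_zero)

lemma tangent_not_smooth: "v \<in> tangent_space A p \<Longrightarrow> \<not> smooth_at A p f \<Longrightarrow> v f = 0"
  unfolding tangent_space_def velocity_def by auto

text \<open>A function that is not smooth at \<open>p\<close> cannot agree near \<open>p\<close>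
  with one that is; in that case both sides take the default value 0.\<close>

lemma tangent_cong:
  assumes "v \<in> tangent_space A p" "\<forall>\<^sub>F q in nhds p. f q = h q"
  shows "v f = v h"
proof -
  obtain U x where U: "(U, x) \<in> A" "p \<in> U" by (rule obtain_chart)
  obtain u where u: "v = coord_vec A U x u p" using assms(1) unfolding tangent_space_eq[OF U] by blast
  show ?thesis
  proof (cases "smooth_at A p f")
    case True
    have "smooth_near (\<lambda>z. f (inv_into U x z)) (x p)" using True smooth_at_iff[OF U] by blast
    moreover have "\<forall>\<^sub>F z in nhds (x p). f (inv_into U x z) = h (inv_into U x z)"
      using eventually_chart_inv[OF U assms(2)] by eventually_elim blast
    ultimately have "frechet_derivative (\<lambda>z. f (inv_into U x z)) (at (x p)) = frechet_derivative (\<lambda>z. h (inv_into U x z)) (at (x p))"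
      by (rule frechet_derivative_cong)
    then show ?thesis using True smooth_at_cong[OF True assms(2)] u by (simp add: coord_vec_def)
  next
    case False
    moreover have "\<forall>\<^sub>F q in nhds p. h q = f q" using assms(2) by eventually_elim simp
    ultimately have "\<not> smooth_at A p h" using smooth_at_cong by blast
    then show ?thesis using tangent_not_smooth[OF assms(1)] False by simp
  qed
qed

lemma tangent_const:
  assumes "v \<in> tangent_space A p"
  shows "v (\<lambda>q. c) = 0"
proof -
  obtain U x where U: "(U, x) \<in> A" "p \<in> U" by (rule obtain_chart)
  obtain u where u: "v = coord_vec A U x u p" using assms(1) unfolding tangent_space_eq[OF U] by blast
  have "frechet_derivative (\<lambda>z. c) (at (x p)) = (\<lambda>t. 0)" by (rule frechet_derivative_at[symmetric]) simp
  then show ?thesis unfolding u coord_vec_def by simp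
qed

lemma tangent_add:
  assumes "v \<in> tangent_space A p" "smooth_at A p f" "smooth_at A p h"
  shows "v (\<lambda>q. f q + h q) = v f + v h"
proof -
  obtain U x where U: "(U, x) \<in> A" "p \<in> U" by (rule obtain_chart)
  obtain u where u: "v = coord_vec A U x u p" using assms(1) unfolding tangent_space_eq[OF U] by blast
  have s: "smooth_near (\<lambda>z. f (inv_into U x z)) (x p)" "smooth_near (\<lambda>z. h (inv_into U x z)) (x p)"
    using assms smooth_at_iff[OF U] by blast+
  have "frechet_derivative (\<lambda>z. f (inv_into U x z) + h (inv_into U x z)) (at (x p)) =
     (\<lambda>t. frechet_derivative (\<lambda>z. f (inv_into U x z)) (at (x p)) t + frechet_derivative (\<lambda>z. h (inv_into U x z)) (at (x p)) t)"
    by (rule frechet_derivative_at[symmetric]) (intro has_derivative_add s[THEN smooth_near_has_derivative])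
  then show ?thesis unfolding u coord_vec_def using assms smooth_at_add[OF assms(2,3)] by simp
qed

lemma tangent_mult:
  assumes "v \<in> tangent_space A p" "smooth_at A p f" "smooth_at A p h"
  shows "v (\<lambda>q. f q * h q) = v f * h p + f p * v h"
proof -
  obtain U x where U: "(U, x) \<in> A" "p \<in> U" by (rule obtain_chart)
  obtain u where u: "v = coord_vec A U x u p" using assms(1) unfolding tangent_space_eq[OF U] by blast
  have s: "smooth_near (\<lambda>z. f (inv_into U x z)) (x p)" "smooth_near (\<lambda>z. h (inv_into U x z)) (x p)"
    using assms smooth_at_iff[OF U] by blast+
  have "frechet_derivative (\<lambda>z. f (inv_into U x z) * h (inv_into U x z)) (at (x p)) =
     (\<lambda>t. f (inv_into U x (x p)) * frechet_derivative (\<lambda>z. h (inv_into U x z)) (at (x p)) t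
       + frechet_derivative (\<lambda>z. f (inv_into U x z)) (at (x p)) t * h (inv_into U x (x p)))"
    by (rule frechet_derivative_at[symmetric]) (intro has_derivative_mult s[THEN smooth_near_has_derivative])
  then show ?thesis unfolding u coord_vec_def using assms smooth_at_mult[OF assms(2,3)] by (simp add: chart_inv[OF U])
qed

lemma tangent_sum:
  assumes "v \<in> tangent_space A p" "\<And>i. i \<in> K \<Longrightarrow> smooth_at A p (f i)"
  shows "v (\<lambda>q. \<Sum>i\<in>K. f i q) = (\<Sum>i\<in>K. v (f i))"
  using assms(2)
proof (induction K rule: infinite_finite_induct)
  case (insert k K)
  then show ?case using tangent_add[OF assms(1), of "f k" "\<lambda>q. \<Sum>i\<in>K. f i q"] smooth_at_sum[of K p f] by simp
qed (simp_all add: tangent_const[OF assms(1)])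

text \<open>With \<open>f\<close> the arclength \<sigma>, this chain rule turns derivatives on the
  cylinder into derivatives in s.\<close>

lemma tangent_real_compose:
  assumes "v \<in> tangent_space A p" "smooth_at A p f" "smooth_near k (f p)"
  shows "v (\<lambda>q. k (f q)) = deriv k (f p) * v f"
proof -
  obtain U x where U: "(U, x) \<in> A" "p \<in> U" by (rule obtain_chart)
  obtain u where u: "v = coord_vec A U x u p" using assms(1) unfolding tangent_space_eq[OF U] by blast
  have s: "smooth_near (\<lambda>z. f (inv_into U x z)) (x p)" using assms smooth_at_iff[OF U] by blast
  have k: "(k has_derivative (*) (deriv k (f p))) (at (f (inv_into U x (x p))))"
    using deriv_eq_frechet_derivative(2)[OF assms(3)] by (simp add: has_field_derivative_def chart_inv[OF U])
  have "frechet_derivative (\<lambda>z. k (f (inv_into U x z))) (at (x p)) =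
     (\<lambda>t. deriv k (f p) * frechet_derivative (\<lambda>z. f (inv_into U x z)) (at (x p)) t)"
    by (rule frechet_derivative_at[symmetric]) (rule has_derivative_compose[OF smooth_near_has_derivative[OF s] k])
  then show ?thesis unfolding u coord_vec_def using assms smooth_at_real_compose[OF assms(2,3)] by simp
qed

lemma tangent_expand:
  assumes "v \<in> tangent_space A p" "(U, x) \<in> A" "p \<in> U"
  shows "v = (\<lambda>h. \<Sum>b\<in>Basis. v (\<lambda>q. x q \<bullet> b) * coord_vec A U x b p h)"
proof -
  note U = assms(2,3)
  obtain u where u: "v = coord_vec A U x u p" using assms(1) unfolding tangent_space_eq[OF U] by blast
  have "coord_vec A U x (\<Sum>b\<in>K. (u \<bullet> b) *\<^sub>R b) p = (\<lambda>h. \<Sum>b\<in>K. (u \<bullet> b) * coord_vec A U x b p h)" if "finite K" for K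
    using that
  proof induction
    case empty
    then show ?case using coord_vec_linear[OF U, of 0 0 0 0] by (simp add: tcomb_def)
  next
    case (insert k K)
    then show ?case using coord_vec_linear[OF U, of "u \<bullet> k" k 1] by (simp add: tcomb_def)
  qed
  from this[OF finite_Basis] show ?thesis
    unfolding u coord_vec_coordinate[OF U] by (simp only: euclidean_representation)
qed

text \<open>In charts the differential of \<open>F\<close> is the Jacobian, so it sends coordinate
  vectors to coordinate vectors, and these are tangent.\<close>

lemma push_tangent:
  assumes "smooth_manifold N" "smooth_map N A W F" "q \<in> W" "v \<in> tangent_space N q"
  shows "push A F q v \<in> tangent_space A (F q)"
proof -
  interpret N: smooth_manifold N by fact
  obtain V y where V: "(V, y) \<in> N" "q \<in> V" by (rule N.obtain_chart)
  obtain U x where U: "(U, x) \<in> A" "F q \<in> U" by (rule obtain_chart)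
  obtain u where u: "v = coord_vec N V y u q" using assms(4) unfolding N.tangent_space_eq[OF V] by blast
  let ?G = "\<lambda>z. x (F (inv_into V y z))"
  have G: "smooth_near ?G (y q)" by (rule smooth_map_near[OF assms(1-3) V U])
  have Gq: "?G (y q) = x (F q)" by (simp add: N.chart_inv[OF V])
  have "push A F q v f = coord_vec A U x (frechet_derivative ?G (at (y q)) u) (F q) f" for f
  proof (cases "smooth_at A (F q) f")
    case True
    let ?f = "\<lambda>z. f (inv_into U x z)"
    have f: "smooth_near ?f (x (F q))" using True smooth_at_iff[OF U] by blast
    have fF: "smooth_at N q (\<lambda>r. f (F r))" by (rule smooth_at_compose[OF assms(1-3) True])
    then have fF': "smooth_near (\<lambda>z. f (F (inv_into V y z))) (y q)" unfolding N.smooth_at_iff[OF V] .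
    have ev: "\<forall>\<^sub>F z in nhds (y q). f (F (inv_into V y z)) = ?f (?G z)"
      using N.eventually_chart_inv[OF V eventually_smooth_map[OF assms(2,3) eventually_nhds_in_open[OF chart_open[OF U(1)] U(2)]]]
      by eventually_elim (simp add: chart_inv[OF U(1)])
    have "push A F q v f = frechet_derivative (\<lambda>z. f (F (inv_into V y z))) (at (y q)) u"
      using True fF by (simp add: push_def u coord_vec_def comp_def)
    also have "\<dots> = frechet_derivative (\<lambda>z. ?f (?G z)) (at (y q)) u"
      by (simp add: frechet_derivative_cong[OF fF' ev])
    also have "\<dots> = frechet_derivative ?f (at (x (F q))) (frechet_derivative ?G (at (y q)) u)"
      using frechet_derivative_compose_near[OF G, of ?f u] f Gq by simp
    finally show ?thesis using True by (simp add: coord_vec_def)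
  qed (simp add: push_def coord_vec_def)
  then have "push A F q v = coord_vec A U x (frechet_derivative ?G (at (y q)) u) (F q)" by blast
  then show ?thesis using coord_vec_tangent[OF U] by simp
qed

section \<open>Vector fields near a point\<close>

lemma vfield_iff:
  "vfield A W X \<longleftrightarrow> open W \<and>
    (\<forall>q\<in>W. X q \<in> tangent_space A q \<and> (\<forall>f. smooth_at A q f \<longrightarrow> smooth_at A q (\<lambda>r. X r f)))"
proof
  assume X: "vfield A W X"
  have "smooth_at A q (\<lambda>r. X r f)" if q: "q \<in> W" "smooth_at A q f" for q f
  proof -
    obtain M where M: "q \<in> M" "smooth_fun A M f" using q(2) unfolding smooth_at_def by blast
    \<comment> \<open>The test functions in \<open>vfield\<close> live on subsets of
      \<open>W\<close>, so \<open>f\<close> is first restricted.\<close>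
    have "smooth_fun A (W \<inter> M) f" using M X unfolding smooth_fun_iff vfield_def by auto
    then have "smooth_fun A (W \<inter> M) (\<lambda>r. X r f)" using X unfolding vfield_def by blast
    then show ?thesis using M q unfolding smooth_fun_iff by blast
  qed
  then show "open W \<and> (\<forall>q\<in>W. X q \<in> tangent_space A q \<and> (\<forall>f. smooth_at A q f \<longrightarrow> smooth_at A q (\<lambda>r. X r f)))"
    using X unfolding vfield_def by blast
qed (auto simp: vfield_def smooth_fun_iff subset_iff)

lemma vfield_at_iff:
  "vfield_at A p X \<longleftrightarrow>
    (\<forall>\<^sub>F q in nhds p. X q \<in> tangent_space A q \<and> (\<forall>f. smooth_at A q f \<longrightarrow> smooth_at A q (\<lambda>r. X r f)))"
proof
  assume "vfield_at A p X"
  then obtain W where "p \<in> W" "vfield A W X" unfolding vfield_at_def by blast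
  then show "\<forall>\<^sub>F q in nhds p. X q \<in> tangent_space A q \<and> (\<forall>f. smooth_at A q f \<longrightarrow> smooth_at A q (\<lambda>r. X r f))"
    unfolding vfield_iff eventually_nhds by (intro exI[of _ W]) simp
next
  assume "\<forall>\<^sub>F q in nhds p. X q \<in> tangent_space A q \<and> (\<forall>f. smooth_at A q f \<longrightarrow> smooth_at A q (\<lambda>r. X r f))"
  then obtain W where "open W" "p \<in> W"
    "\<forall>q\<in>W. X q \<in> tangent_space A q \<and> (\<forall>f. smooth_at A q f \<longrightarrow> smooth_at A q (\<lambda>r. X r f))"
    unfolding eventually_nhds by auto
  then show "vfield_at A p X" unfolding vfield_at_def vfield_iff by (intro exI[of _ W]) simp
qed

lemma vfield_at_tangent: "vfield_at A p X \<Longrightarrow> X p \<in> tangent_space A p"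
  unfolding vfield_at_def vfield_iff by blast

lemma eventually_vfield_at:
  assumes "vfield_at A p X" shows "\<forall>\<^sub>F q in nhds p. vfield_at A q X"
proof -
  obtain W where W: "p \<in> W" "vfield A W X" using assms unfolding vfield_at_def by blast
  have "open W" using W(2) unfolding vfield_def by blast
  moreover have "\<forall>q\<in>W. vfield_at A q X" using W(2) unfolding vfield_at_def by blast
  ultimately have "open W" "\<forall>q\<in>W. vfield_at A q X" by blast+
  then show ?thesis unfolding eventually_nhds using W(1) by (intro exI[of _ W]) simp
qed

lemma vfield_at_smooth: "vfield_at A p X \<Longrightarrow> smooth_at A p f \<Longrightarrow> smooth_at A p (\<lambda>q. X q f)"
  unfolding vfield_at_def vfield_iff by blast

lemma vfield_at_cong:
  assumes "vfield_at A p X" "\<forall>\<^sub>F q in nhds p. X q = Y q"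
  shows "vfield_at A p Y"
proof -
  obtain W where W: "open W" "p \<in> W" "vfield A W X" using assms(1) unfolding vfield_at_def vfield_iff by blast
  obtain M where M: "open M" "p \<in> M" "\<forall>q\<in>M. X q = Y q" using assms(2) unfolding eventually_nhds by blast
  have "vfield A (W \<inter> M) Y"
    unfolding vfield_iff
  proof (intro conjI ballI allI impI)
    fix q f assume q: "q \<in> W \<inter> M" "smooth_at A q f"
    have "\<forall>\<^sub>F r in nhds q. X r f = Y r f" unfolding eventually_nhds using M q by (intro exI[of _ M]) auto
    moreover have "smooth_at A q (\<lambda>r. X r f)" using W(3) q unfolding vfield_iff by blast
    ultimately show "smooth_at A q (\<lambda>r. Y r f)" by (rule smooth_at_cong[rotated])
  qed (use W M vfield_iff in auto)
  then show ?thesis unfolding vfield_at_def using W M by blast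
qed

lemma obtain_common_vfield:
  assumes "vfield_at A p X" "vfield_at A p Y"
  obtains W where "p \<in> W" "vfield A W X" "vfield A W Y"
proof -
  obtain W V where W: "p \<in> W" "vfield A W X" and V: "p \<in> V" "vfield A V Y" using assms unfolding vfield_at_def by blast
  have "vfield A (W \<inter> V) X" "vfield A (W \<inter> V) Y" using W V unfolding vfield_iff by auto
  then show thesis using that W V by blast
qed

lemma vfield_at_lincomb:
  assumes "finite K" "\<And>i. i \<in> K \<Longrightarrow> smooth_at A p (f i)" "\<And>i. i \<in> K \<Longrightarrow> vfield_at A p (X i)"
  shows "vfield_at A p (\<lambda>q h. \<Sum>i\<in>K. f i q * X i q h)"
proof -
  have "\<forall>\<^sub>F q in nhds p. \<forall>i\<in>K. smooth_at A q (f i) \<and> vfield_at A q (X i)"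
    using assms eventually_smooth_at eventually_vfield_at by (simp add: eventually_ball_finite_distrib eventually_conj)
  then show ?thesis unfolding vfield_at_iff[of p "\<lambda>q h. \<Sum>i\<in>K. f i q * X i q h"]
  proof eventually_elim
    case (elim q)
    then have "(\<lambda>h. \<Sum>i\<in>K. f i q * X i q h) \<in> tangent_space A q"
      by (intro tangent_lincomb) (blast intro: vfield_at_tangent)
    moreover have "smooth_at A q (\<lambda>r. \<Sum>i\<in>K. f i r * X i r h)" if "smooth_at A q h" for h
    proof (rule smooth_at_sum, rule smooth_at_mult)
      fix i assume "i \<in> K"
      then show "smooth_at A q (f i)" "smooth_at A q (\<lambda>r. X i r h)"
        using elim vfield_at_smooth[OF _ that] by auto
    qed
    ultimately show ?case by blast
  qed
qed

lemma vfield_at_tcomb: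
  assumes "smooth_at A p a" "vfield_at A p X" "smooth_at A p b" "vfield_at A p Y"
  shows "vfield_at A p (\<lambda>q. tcomb (a q) (X q) (b q) (Y q))"
  using vfield_at_lincomb[of "{True, False}" p "\<lambda>i. if i then a else b" "\<lambda>i. if i then X else Y"] assms
  by (simp add: tcomb_def)

lemma vfield_at_coord_vec:
  assumes "(U, x) \<in> A" "p \<in> U"
  shows "vfield_at A p (coord_vec A U x u)"
proof -
  have "smooth_at A q (\<lambda>r. coord_vec A U x u r f)" if q: "q \<in> U" "smooth_at A q f" for q f
  proof -
    note U = assms(1) q(1)
    have "\<forall>\<^sub>F z in nhds (x q). frechet_derivative (\<lambda>z. f (inv_into U x z)) (at z) u = coord_vec A U x u (inv_into U x z) f"
      using eventually_chart_inv[OF U eventually_smooth_at[OF q(2)]]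
      by eventually_elim (simp add: coord_vec_def chart_of_inv[OF assms(1)])
    moreover have "smooth_near (\<lambda>z. frechet_derivative (\<lambda>z. f (inv_into U x z)) (at z) u) (x q)"
      by (rule smooth_near_frechet_derivative) (use q smooth_at_iff[OF U] in blast)
    ultimately show ?thesis unfolding smooth_at_iff[OF U] by (rule smooth_near_cong[rotated])
  qed
  then have "vfield A U (coord_vec A U x u)"
    unfolding vfield_iff using chart_open[OF assms(1)] coord_vec_tangent[OF assms(1)] by blast
  then show ?thesis unfolding vfield_at_def using assms(2) by blast
qed

text \<open>The extension has constant coefficients in a chart. It makes the axioms about local
  fields available for single tangent vectors.\<close>

lemma extend_tangent:
  assumes "v \<in> tangent_space A p"
  obtains X where "vfield_at A p X" "X p = v"
proof -
  obtain U x where U: "(U, x) \<in> A" "p \<in> U" by (rule obtain_chart)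
  obtain u where "v = coord_vec A U x u p" using assms(1) unfolding tangent_space_eq[OF U] by blast
  then show thesis using that[OF vfield_at_coord_vec[OF U]] by simp
qed

end

section \<open>Riemannian metrics and connections along maps\<close>

context smooth_manifold
begin

text \<open>Rank-nullity. Tangent vectors are operators rather than elements of a finite-dimensional
  type, so the functionals are transported to an endomorphism \<open>?L\<close> of the coordinate
  space by matching \<open>K\<close> with \<open>Basis\<close>. One direction serves for orthonormal
  frames, the other for the tangent plane of the cylinder.\<close>

lemma functionals_injective_iff_surjective:
  fixes l :: "'k \<Rightarrow> 'm tvec \<Rightarrow> real"
  assumes lin: "\<And>k v w a b. k \<in> K \<Longrightarrow> v \<in> tangent_space A p \<Longrightarrow> w \<in> tangent_space A p \<Longrightarrow>
      l k (tcomb a v b w) = a * l k v + b * l k w"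
    and K: "finite K" "card K = DIM('e)"
  shows "(\<forall>v\<in>tangent_space A p. (\<forall>k\<in>K. l k v = 0) \<longrightarrow> v = tzero) \<longleftrightarrow>
    (\<forall>c. \<exists>v\<in>tangent_space A p. \<forall>k\<in>K. l k v = c k)"
proof -
  obtain U x where U: "(U, x) \<in> A" "p \<in> U" by (rule obtain_chart)
  obtain \<beta> where \<beta>: "bij_betw \<beta> (Basis :: 'e set) K"
    using finite_same_card_bij[OF finite_Basis K(1)] K(2) by auto
  let ?v = "\<lambda>a. coord_vec A U x a p"
  let ?L = "\<lambda>a. \<Sum>b\<in>Basis. l (\<beta> b) (?v a) *\<^sub>R b"
  have vT: "?v a \<in> tangent_space A p" for a by (rule coord_vec_tangent[OF U])
  have v0: "?v 0 = tzero" using coord_vec_linear[OF U, of 0 0 0 0] by (simp add: tcomb_def)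
  have vinj: "a = 0" if "?v a = tzero" for a
  proof (rule euclidean_eqI)
    fix b show "a \<bullet> b = 0 \<bullet> b" using coord_vec_coordinate[OF U, of a b] that by simp
  qed
  have Lb: "?L a \<bullet> b = l (\<beta> b) (?v a)" if "b \<in> Basis" for a b
    using that by (simp add: inner_sum_left inner_Basis if_distrib cong: if_cong)
  have L: "linear ?L"
  proof (rule linearI)
    fix a a' :: 'e and s :: real
    show "?L (a + a') = ?L a + ?L a'"
    proof (rule euclidean_eqI)
      fix b :: 'e assume b: "b \<in> Basis"
      show "?L (a + a') \<bullet> b = (?L a + ?L a') \<bullet> b"
        using coord_vec_linear[OF U, of 1 a 1 a'] lin[of "\<beta> b" "?v a" "?v a'" 1 1] vT \<beta> b
        by (simp only: Lb inner_add_left) (auto simp: bij_betw_def)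
    qed
    show "?L (s *\<^sub>R a) = s *\<^sub>R ?L a"
    proof (rule euclidean_eqI)
      fix b :: 'e assume b: "b \<in> Basis"
      show "?L (s *\<^sub>R a) \<bullet> b = (s *\<^sub>R ?L a) \<bullet> b"
        using coord_vec_linear[OF U, of s a 0 a] lin[of "\<beta> b" "?v a" "?v a" s 0] vT \<beta> b
        by (simp only: Lb inner_scaleR_left) (auto simp: bij_betw_def)
    qed
  qed
  have zero: "?L a = 0 \<longleftrightarrow> (\<forall>k\<in>K. l k (?v a) = 0)" for a
    using \<beta> Lb[of _ a] unfolding bij_betw_def euclidean_eq_iff[where 'a = 'e] by auto
  have inj: "inj ?L \<longleftrightarrow> (\<forall>v\<in>tangent_space A p. (\<forall>k\<in>K. l k v = 0) \<longrightarrow> v = tzero)"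
    unfolding linear_injective_0[OF L] zero tangent_space_eq[OF U] using v0 vinj by auto
  have surj: "surj ?L \<longleftrightarrow> (\<forall>c. \<exists>v\<in>tangent_space A p. \<forall>k\<in>K. l k v = c k)"
  proof
    assume s: "surj ?L"
    show "\<forall>c. \<exists>v\<in>tangent_space A p. \<forall>k\<in>K. l k v = c k"
    proof
      fix c
      obtain a where a: "?L a = (\<Sum>b\<in>Basis. c (\<beta> b) *\<^sub>R b)" using surjD[OF s, of "\<Sum>b\<in>Basis. c (\<beta> b) *\<^sub>R b"] by metis
      have "l (\<beta> b) (?v a) = c (\<beta> b)" if "b \<in> Basis" for b
        using Lb[OF that, of a] that unfolding a by (simp add: inner_sum_left inner_Basis if_distrib cong: if_cong)
      then have "\<forall>k\<in>K. l k (?v a) = c k" using \<beta> unfolding bij_betw_def by auto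
      then show "\<exists>v\<in>tangent_space A p. \<forall>k\<in>K. l k v = c k" using vT by blast
    qed
  next
    assume s: "\<forall>c. \<exists>v\<in>tangent_space A p. \<forall>k\<in>K. l k v = c k"
    have "\<exists>a. z = ?L a" for z
    proof -
      obtain v where v: "v \<in> tangent_space A p" "\<forall>k\<in>K. l k v = z \<bullet> inv_into Basis \<beta> k"
        using spec[OF s, of "\<lambda>k. z \<bullet> inv_into Basis \<beta> k"] by blast
      obtain a where a: "v = ?v a" using v(1) unfolding tangent_space_eq[OF U] by blast
      have "z = ?L a"
      proof (rule euclidean_eqI)
        fix b :: 'e assume b: "b \<in> Basis"
        have "\<beta> b \<in> K" "inv_into Basis \<beta> (\<beta> b) = b" using b \<beta> unfolding bij_betw_def by auto
        then show "z \<bullet> b = ?L a \<bullet> b" using v(2) Lb[OF b, of a] a by simp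
      qed
      then show ?thesis by blast
    qed
    then show "surj ?L" unfolding surj_def by blast
  qed
  have "inj ?L \<longleftrightarrow> surj ?L"
    using linear_injective_imp_surjective[OF L] linear_surjective_imp_injective[OF L] by blast
  then show ?thesis unfolding inj surj .
qed

end

context riemannian_manifold
begin

section \<open>Linear algebra of the metric\<close>

lemma metric_linear_right:
  assumes "u \<in> tangent_space A p" "v \<in> tangent_space A p" "w \<in> tangent_space A p"
  shows "g p w (tcomb a u b v) = a * g p w u + b * g p w v"
  using metric_linear[OF assms] metric_sym[OF assms(3)] assms tangent_tcomb by simp

lemma metric_zero_left: "w \<in> tangent_space A p \<Longrightarrow> g p tzero w = 0"
  using metric_linear[of w p w w 0 0] by (simp add: tcomb_def)

lemma metric_scale_left:
  "v \<in> tangent_space A p \<Longrightarrow> w \<in> tangent_space A p \<Longrightarrow> g p (\<lambda>h. a * v h) w = a * g p v w"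
  using metric_linear[of v p v w a 0] by (simp add: tcomb_def)

lemma metric_scale_right:
  "v \<in> tangent_space A p \<Longrightarrow> w \<in> tangent_space A p \<Longrightarrow> g p w (\<lambda>h. a * v h) = a * g p w v"
  using metric_linear_right[of v p v w a 0] by (simp add: tcomb_def)

lemma metric_sum_left:
  assumes "\<And>i. i \<in> K \<Longrightarrow> X i \<in> tangent_space A p" "w \<in> tangent_space A p"
  shows "g p (\<lambda>h. \<Sum>i\<in>K. a i * X i h) w = (\<Sum>i\<in>K. a i * g p (X i) w)"
  using assms(1)
proof (induction K rule: infinite_finite_induct)
  case (insert k K)
  have "(\<lambda>h. \<Sum>i\<in>K. a i * X i h) \<in> tangent_space A p" by (intro tangent_lincomb insert) auto
  then have "g p (tcomb (a k) (X k) 1 (\<lambda>h. \<Sum>i\<in>K. a i * X i h)) w = a k * g p (X k) w + 1 * g p (\<lambda>h. \<Sum>i\<in>K. a i * X i h) w"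
    by (intro metric_linear assms(2) insert.prems) auto
  then show ?case using insert by (simp add: tcomb_def)
qed (simp_all add: metric_zero_left[OF assms(2)])

lemma metric_lincomb2_left:
  assumes "w \<in> tangent_space A p" "\<And>i. i \<in> K \<Longrightarrow> Y i \<in> tangent_space A p" "\<And>i. i \<in> K \<Longrightarrow> Z i \<in> tangent_space A p"
  shows "g p (\<lambda>h. \<Sum>i\<in>K. a i * Y i h + b i * Z i h) w = (\<Sum>i\<in>K. a i * g p (Y i) w + b i * g p (Z i) w)"
proof -
  have "g p (tcomb 1 (\<lambda>h. \<Sum>i\<in>K. a i * Y i h) 1 (\<lambda>h. \<Sum>i\<in>K. b i * Z i h)) w =
      1 * g p (\<lambda>h. \<Sum>i\<in>K. a i * Y i h) w + 1 * g p (\<lambda>h. \<Sum>i\<in>K. b i * Z i h) w"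
    by (intro metric_linear tangent_lincomb assms)
  also have "\<dots> = (\<Sum>i\<in>K. a i * g p (Y i) w) + (\<Sum>i\<in>K. b i * g p (Z i) w)"
    using metric_sum_left[of K Y p w a] metric_sum_left[of K Z p w b] assms by simp
  finally show ?thesis by (simp add: tcomb_def sum.distrib)
qed

lemma metric_sum_right:
  assumes "\<And>i. i \<in> K \<Longrightarrow> X i \<in> tangent_space A p" "w \<in> tangent_space A p"
  shows "g p w (\<lambda>h. \<Sum>i\<in>K. a i * X i h) = (\<Sum>i\<in>K. a i * g p w (X i))"
proof -
  have "g p w (\<lambda>h. \<Sum>i\<in>K. a i * X i h) = g p (\<lambda>h. \<Sum>i\<in>K. a i * X i h) w"
    by (intro metric_sym assms(2) tangent_lincomb assms(1))
  also have "\<dots> = (\<Sum>i\<in>K. a i * g p (X i) w)" by (rule metric_sum_left[OF assms])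
  also have "\<dots> = (\<Sum>i\<in>K. a i * g p w (X i))"
    by (intro sum.cong refl arg_cong2[where f = "(*)"] metric_sym assms)
  finally show ?thesis .
qed

text \<open>The difference, tested against itself, has length 0. Two candidate covariant derivatives
  are later compared through their inner products.\<close>

lemma metric_eqI:
  assumes "v \<in> tangent_space A p" "w \<in> tangent_space A p"
    and "\<And>z. z \<in> tangent_space A p \<Longrightarrow> g p v z = g p w z"
  shows "v = w"
proof -
  let ?z = "tcomb 1 v (-1) w"
  have z: "?z \<in> tangent_space A p" using assms tangent_tcomb by blast
  have "g p ?z ?z = 0" using metric_linear[OF assms(1,2) z, of 1 "-1"] assms(3)[OF z] by simp
  then have "?z = tzero" using metric_pos[OF z] by fastforce
  then show ?thesis by (auto simp: tcomb_def fun_eq_iff)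
qed

text \<open>Linear combinations of the \<open>u k\<close> attain every tuple of inner products, so
  the functionals \<open>g p _ (u k)\<close> are jointly onto. Being as many as the dimension, they
  are jointly injective, and \<open>w\<close> and its expansion have the same values under
  them.\<close>

lemma orthonormal_expand:
  assumes u: "\<And>k. k \<in> K \<Longrightarrow> u k \<in> tangent_space A p" "\<And>k j. k \<in> K \<Longrightarrow> j \<in> K \<Longrightarrow> g p (u k) (u j) = of_bool (k = j)"
    and K: "finite K" "card K = DIM('e)"
    and w: "w \<in> tangent_space A p"
  shows "w = (\<lambda>h. \<Sum>k\<in>K. g p w (u k) * u k h)"
proof -
  let ?l = "\<lambda>k v. g p v (u k)"
  have s: "?l k (\<lambda>h. \<Sum>k\<in>K. c k * u k h) = c k" if "k \<in> K" for c k
    using that metric_sum_left[of K u p "u k" c] u K(1)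
    by (simp add: if_distrib of_bool_def cong: if_cong)
  have "\<forall>c. \<exists>v\<in>tangent_space A p. \<forall>k\<in>K. ?l k v = c k"
  proof
    fix c
    show "\<exists>v\<in>tangent_space A p. \<forall>k\<in>K. ?l k v = c k"
      using s[of _ c] by (intro bexI[of _ "\<lambda>h. \<Sum>k\<in>K. c k * u k h"] ballI tangent_lincomb u)
  qed
  then have "\<forall>v\<in>tangent_space A p. (\<forall>k\<in>K. ?l k v = 0) \<longrightarrow> v = tzero"
    by (subst functionals_injective_iff_surjective[OF _ K]) (auto intro: metric_linear u(1))
  then have z: "v = tzero" if "v \<in> tangent_space A p" "\<And>k. k \<in> K \<Longrightarrow> ?l k v = 0" for v
    using that by blast
  let ?w = "\<lambda>h. \<Sum>k\<in>K. g p w (u k) * u k h"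
  have wT: "?w \<in> tangent_space A p" by (rule tangent_lincomb[OF u(1)])
  have "tcomb 1 w (-1) ?w = tzero"
  proof (rule z)
    fix k assume k: "k \<in> K"
    show "g p (tcomb 1 w (-1) ?w) (u k) = 0"
      using metric_linear[OF w wT u(1)[OF k], of 1 "-1"] s[OF k, of "\<lambda>k. g p w (u k)"] by simp
  qed (rule tangent_tcomb[OF w wT])
  then show ?thesis by (auto simp: tcomb_def fun_eq_iff)
qed

section \<open>The Levi-Civita derivative near a point\<close>

lemma metric_smooth_at:
  assumes "vfield_at A p X" "vfield_at A p Y"
  shows "smooth_at A p (\<lambda>q. g q (X q) (Y q))"
proof -
  obtain W where "p \<in> W" "vfield A W X" "vfield A W Y" using obtain_common_vfield[OF assms] .
  then show ?thesis using metric_smooth unfolding smooth_at_def by blast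
qed

lemma conn_smooth_at:
  assumes "vfield_at A p X" "vfield_at A p Y"
  shows "vfield_at A p (\<lambda>q. D q (X q) Y)"
proof -
  obtain W where "p \<in> W" "vfield A W X" "vfield A W Y" using obtain_common_vfield[OF assms] .
  then show ?thesis using conn_smooth unfolding vfield_at_def by blast
qed

lemma conn_tangent:
  assumes "v \<in> tangent_space A p" "vfield_at A p Y"
  shows "D p v Y \<in> tangent_space A p"
proof -
  obtain X where X: "vfield_at A p X" "X p = v" by (rule extend_tangent[OF assms(1)])
  show ?thesis using vfield_at_tangent[OF conn_smooth_at[OF X(1) assms(2)]] X(2) by simp
qed

lemma conn_zero_direction: "vfield_at A p Y \<Longrightarrow> D p tzero Y = tzero"
  using conn_linear[OF tangent_zero tangent_zero, of p Y 0 0] by (simp add: tcomb_def)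

lemma conn_sum_direction:
  assumes "\<And>i. i \<in> K \<Longrightarrow> X i \<in> tangent_space A p" "vfield_at A p Y"
  shows "D p (\<lambda>h. \<Sum>i\<in>K. a i * X i h) Y = (\<lambda>h. \<Sum>i\<in>K. a i * D p (X i) Y h)"
  using assms(1)
proof (induction K rule: infinite_finite_induct)
  case (insert k K)
  have "(\<lambda>h. \<Sum>i\<in>K. a i * X i h) \<in> tangent_space A p" by (intro tangent_lincomb insert) auto
  then have "D p (tcomb (a k) (X k) 1 (\<lambda>h. \<Sum>i\<in>K. a i * X i h)) Y =
      tcomb (a k) (D p (X k) Y) 1 (D p (\<lambda>h. \<Sum>i\<in>K. a i * X i h) Y)"
    by (intro conn_linear assms insert.prems) auto
  then show ?case using insert by (simp add: tcomb_def)
qed (simp_all add: conn_zero_direction[OF assms(2)])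

text \<open>Torsion freeness spares the direct verification that a commutator is the velocity of a
  curve: the bracket is a difference of covariant derivatives.\<close>

lemma bracket_tangent:
  assumes "vfield_at A p X" "vfield_at A p Y"
  shows "bracket A X Y p \<in> tangent_space A p"
  unfolding conn_torsion_free[OF assms, symmetric]
  by (rule tangent_tcomb; rule conn_tangent; (rule vfield_at_tangent)?; rule assms)

text \<open>Metric compatibility expands the three derivatives, torsion freeness the three brackets,
  and everything cancels except twice the term sought. The right side is free of \<open>D\<close>,
  which allows connections of two manifolds to be compared through their metrics and
  brackets.\<close>

lemma koszul:
  assumes "vfield_at A p X" "vfield_at A p Y" "vfield_at A p Z"
  shows "2 * g p (D p (X p) Y) (Z p) =
    X p (\<lambda>q. g q (Y q) (Z q)) + Y p (\<lambda>q. g q (X q) (Z q)) - Z p (\<lambda>q. g q (X q) (Y q))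
    + g p (bracket A X Y p) (Z p) - g p (bracket A X Z p) (Y p) - g p (bracket A Y Z p) (X p)"
proof -
  note T = assms[THEN vfield_at_tangent]
  have DT: "D p (X p) Y \<in> tangent_space A p" "D p (Y p) X \<in> tangent_space A p" "D p (X p) Z \<in> tangent_space A p"
    "D p (Z p) X \<in> tangent_space A p" "D p (Y p) Z \<in> tangent_space A p" "D p (Z p) Y \<in> tangent_space A p"
    using conn_tangent T assms by blast+
  have "g p (bracket A X Y p) (Z p) = g p (D p (X p) Y) (Z p) - g p (D p (Y p) X) (Z p)"
    "g p (bracket A X Z p) (Y p) = g p (D p (X p) Z) (Y p) - g p (D p (Z p) X) (Y p)"
    "g p (bracket A Y Z p) (X p) = g p (D p (Y p) Z) (X p) - g p (D p (Z p) Y) (X p)"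
    using metric_linear DT T
    by (simp_all add: conn_torsion_free[symmetric] assms)
  moreover have "X p (\<lambda>q. g q (Y q) (Z q)) = g p (D p (X p) Y) (Z p) + g p (D p (X p) Z) (Y p)"
    "Y p (\<lambda>q. g q (X q) (Z q)) = g p (D p (Y p) X) (Z p) + g p (D p (Y p) Z) (X p)"
    "Z p (\<lambda>q. g q (X q) (Y q)) = g p (D p (Z p) X) (Y p) + g p (D p (Z p) Y) (X p)"
    using conn_metric[OF T(1) assms(2,3)] conn_metric[OF T(2) assms(1,3)] conn_metric[OF T(3) assms(1,2)]
      metric_sym[OF T(2) DT(3)] metric_sym[OF T(1) DT(5)] metric_sym[OF T(1) DT(6)] by simp_all
  ultimately show ?thesis by simp
qed

end

text \<open>Three maps fit this setting: the projection \<pi>, the base curve \<gamma> and the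
  immersion \<iota> of the cylinder. The open set \<open>W\<close> is there for the curve, which is
  assumed smooth only on its interval.\<close>

locale map_into_riemannian = riemannian_manifold A g D + N: smooth_manifold N
  for A :: "('m::{t2_space,second_countable_topology}, 'e::euclidean_space) chart set" and g D
    and N :: "('n::{t2_space,second_countable_topology}, 'd::euclidean_space) chart set" +
  fixes W :: "'n set" and F :: "'n \<Rightarrow> 'm"
  assumes smooth_map: "smooth_map N A W F"
begin

text \<open>The index set may be a finite set of any type, so that \<open>Basis\<close> can index
  expansions in coordinate fields.\<close>

definition represents :: "'n \<Rightarrow> 'k set \<Rightarrow> ('k \<Rightarrow> 'n \<Rightarrow> real) \<Rightarrow> ('k \<Rightarrow> 'm \<Rightarrow> 'm tvec) \<Rightarrow> ('n \<Rightarrow> 'm tvec) \<Rightarrow> bool" where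
  "represents q K f X V \<longleftrightarrow> finite K \<and> (\<forall>i\<in>K. smooth_at N q (f i) \<and> vfield_at A (F q) (X i)) \<and>
     (\<forall>\<^sub>F r in nhds q. V r = (\<lambda>h. \<Sum>i\<in>K. f i r * X i (F r) h))"

definition rep_deriv :: "'n \<Rightarrow> 'n tvec \<Rightarrow> 'k set \<Rightarrow> ('k \<Rightarrow> 'n \<Rightarrow> real) \<Rightarrow> ('k \<Rightarrow> 'm \<Rightarrow> 'm tvec) \<Rightarrow> 'm tvec" where
  "rep_deriv q v K f X =
     (\<lambda>h. \<Sum>i\<in>K. v (f i) * X i (F q) h + f i q * D (F q) (push A F q v) (X i) h)"

text \<open>Index types cannot be quantified over, so initial segments of the naturals stand for all
  finite index sets.\<close>

definition smooth_section :: "'n \<Rightarrow> ('n \<Rightarrow> 'm tvec) \<Rightarrow> bool" where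
  "smooth_section q V \<longleftrightarrow> (\<exists>(n::nat) f X. represents q {..<n} f X V)"

lemma pull_smooth_at: "q \<in> W \<Longrightarrow> smooth_at A (F q) f \<Longrightarrow> smooth_at N q (\<lambda>r. f (F r))"
  by (rule smooth_at_compose[OF N.smooth_manifold_axioms smooth_map])

lemma push_in_tangent: "q \<in> W \<Longrightarrow> v \<in> tangent_space N q \<Longrightarrow> push A F q v \<in> tangent_space A (F q)"
  by (rule push_tangent[OF N.smooth_manifold_axioms smooth_map])

lemma eventually_pull: "q \<in> W \<Longrightarrow> eventually P (nhds (F q)) \<Longrightarrow> \<forall>\<^sub>F r in nhds q. P (F r)"
  by (rule eventually_smooth_map[OF smooth_map])

lemma represents_at: "represents q K f X V \<Longrightarrow> V q = (\<lambda>h. \<Sum>i\<in>K. f i q * X i (F q) h)"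
  unfolding represents_def by (elim conjE eventually_nhds_x_imp_x)

lemma represents_tangent: "represents q K f X V \<Longrightarrow> V q \<in> tangent_space A (F q)"
  by (subst represents_at, assumption, rule tangent_lincomb)
    (auto simp: represents_def dest: vfield_at_tangent)

lemma rep_deriv_split:
  "rep_deriv q v K f X = tcomb 1 (\<lambda>h. \<Sum>i\<in>K. v (f i) * X i (F q) h)
     1 (\<lambda>h. \<Sum>i\<in>K. f i q * D (F q) (push A F q v) (X i) h)"
  unfolding rep_deriv_def tcomb_def by (simp add: sum.distrib)

lemma rep_deriv_tangent:
  assumes "q \<in> W" "v \<in> tangent_space N q" "represents q K f X V"
  shows "rep_deriv q v K f X \<in> tangent_space A (F q)"
  unfolding rep_deriv_split
proof (intro tangent_tcomb tangent_lincomb)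
  fix i assume "i \<in> K"
  then have "vfield_at A (F q) (X i)" using assms(3) unfolding represents_def by blast
  then show "X i (F q) \<in> tangent_space A (F q)" "D (F q) (push A F q v) (X i) \<in> tangent_space A (F q)"
    using vfield_at_tangent conn_tangent[OF push_in_tangent[OF assms(1,2)]] by blast+
qed

lemma eventually_metric_represents:
  assumes "q \<in> W" "represents q K f X V" "represents q K' f' X' V'"
  shows "\<forall>\<^sub>F r in nhds q. g (F r) (V r) (V' r) =
    (\<Sum>i\<in>K. \<Sum>j\<in>K'. f i r * (f' j r * g (F r) (X i (F r)) (X' j (F r))))"
proof -
  have "\<forall>\<^sub>F r in nhds q. \<forall>i\<in>K. vfield_at A (F r) (X i)"
    if "represents q K f X V" for K and f :: "'z \<Rightarrow> 'n \<Rightarrow> real" and X V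
    using that unfolding represents_def
    by (intro eventually_ball_finite ballI, simp)
      (rule eventually_pull[OF assms(1)], rule eventually_vfield_at, simp)
  note ev = this[OF assms(2)] this[OF assms(3)]
  note ev
  moreover have "\<forall>\<^sub>F r in nhds q. V r = (\<lambda>h. \<Sum>i\<in>K. f i r * X i (F r) h)"
    "\<forall>\<^sub>F r in nhds q. V' r = (\<lambda>h. \<Sum>i\<in>K'. f' i r * X' i (F r) h)"
    using assms(2,3) unfolding represents_def by blast+
  ultimately show ?thesis
  proof eventually_elim
    case (elim r)
    have T: "X i (F r) \<in> tangent_space A (F r)" if "i \<in> K" for i using elim(1) that vfield_at_tangent by blast
    have T': "X' i (F r) \<in> tangent_space A (F r)" if "i \<in> K'" for i using elim(2) that vfield_at_tangent by blast
    have "g (F r) (V r) (V' r) = (\<Sum>i\<in>K. f i r * g (F r) (X i (F r)) (V' r))"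
      unfolding elim(3) using T by (rule metric_sum_left) (auto simp: elim(4) intro!: tangent_lincomb T')
    also have "\<dots> = (\<Sum>i\<in>K. f i r * (\<Sum>j\<in>K'. f' j r * g (F r) (X i (F r)) (X' j (F r))))"
      unfolding elim(4) by (intro sum.cong refl arg_cong2[where f = "(*)"] metric_sum_right T T') auto
    finally show ?case by (simp add: sum_distrib_left)
  qed
qed

lemma smooth_at_metric_represents:
  assumes "q \<in> W" "represents q K f X V" "represents q K' f' X' V'"
  shows "smooth_at N q (\<lambda>r. g (F r) (V r) (V' r))"
proof (rule N.smooth_at_cong)
  show "\<forall>\<^sub>F r in nhds q. (\<Sum>i\<in>K. \<Sum>j\<in>K'. f i r * (f' j r * g (F r) (X i (F r)) (X' j (F r)))) = g (F r) (V r) (V' r)"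
    using eventually_metric_represents[OF assms] by eventually_elim simp
  show "smooth_at N q (\<lambda>r. \<Sum>i\<in>K. \<Sum>j\<in>K'. f i r * (f' j r * g (F r) (X i (F r)) (X' j (F r))))"
    using assms(2,3) unfolding represents_def
    by (intro N.smooth_at_sum N.smooth_at_mult pull_smooth_at[OF assms(1)] metric_smooth_at) auto
qed

text \<open>Compatibility with the metric holds for each single representation. Testing against the
  sections \<open>Z \<circ> F\<close> then shows that the derivative does not depend on the representation.\<close>

lemma metric_rep_deriv:
  assumes "q \<in> W" "v \<in> tangent_space N q" "represents q K f X V" "represents q K' f' X' V'"
  shows "v (\<lambda>r. g (F r) (V r) (V' r)) =
    g (F q) (rep_deriv q v K f X) (V' q) + g (F q) (V q) (rep_deriv q v K' f' X')"
proof -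
  let ?p = "F q" let ?w = "push A F q v"
  let ?G = "\<lambda>i j p. g p (X i p) (X' j p)"
  have w: "?w \<in> tangent_space A ?p" by (rule push_in_tangent[OF assms(1,2)])
  have f: "smooth_at N q (f i)" "vfield_at A ?p (X i)" if "i \<in> K" for i using that assms(3) unfolding represents_def by auto
  have f': "smooth_at N q (f' i)" "vfield_at A ?p (X' i)" if "i \<in> K'" for i using that assms(4) unfolding represents_def by auto
  have T: "X i ?p \<in> tangent_space A ?p" "D ?p ?w (X i) \<in> tangent_space A ?p" if "i \<in> K" for i
    using f[OF that] vfield_at_tangent conn_tangent w by auto
  have T': "X' i ?p \<in> tangent_space A ?p" "D ?p ?w (X' i) \<in> tangent_space A ?p" if "i \<in> K'" for i
    using f'[OF that] vfield_at_tangent conn_tangent w by auto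
  have G: "smooth_at N q (\<lambda>r. ?G i j (F r))" if "i \<in> K" "j \<in> K'" for i j
    by (intro pull_smooth_at[OF assms(1)] metric_smooth_at f f' that)
  have dG: "v (\<lambda>r. ?G i j (F r)) = g ?p (D ?p ?w (X i)) (X' j ?p) + g ?p (X i ?p) (D ?p ?w (X' j))"
    if "i \<in> K" "j \<in> K'" for i j
  proof -
    have "smooth_at A ?p (?G i j)" by (intro metric_smooth_at f f' that)
    then have "v (\<lambda>r. ?G i j (F r)) = ?w (?G i j)" by (simp add: push_def comp_def)
    also have "\<dots> = g ?p (D ?p ?w (X i)) (X' j ?p) + g ?p (X i ?p) (D ?p ?w (X' j))"
      by (rule conn_metric[OF w f(2)[OF that(1)] f'(2)[OF that(2)]])
    finally show ?thesis .
  qed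
  have "v (\<lambda>r. g (F r) (V r) (V' r)) = v (\<lambda>r. \<Sum>i\<in>K. \<Sum>j\<in>K'. f i r * (f' j r * ?G i j (F r)))"
    by (rule N.tangent_cong[OF assms(2) eventually_metric_represents[OF assms(1,3,4)]])
  also have "\<dots> = (\<Sum>i\<in>K. \<Sum>j\<in>K'. v (\<lambda>r. f i r * (f' j r * ?G i j (F r))))"
    by (subst N.tangent_sum[OF assms(2)], (intro N.smooth_at_sum N.smooth_at_mult f f' G; assumption),
        intro sum.cong refl N.tangent_sum[OF assms(2)] N.smooth_at_mult f f' G)
  also have "\<dots> = (\<Sum>i\<in>K. \<Sum>j\<in>K'. v (f i) * (f' j q * ?G i j ?p)
      + f i q * (v (f' j) * ?G i j ?p + f' j q * (g ?p (D ?p ?w (X i)) (X' j ?p) + g ?p (X i ?p) (D ?p ?w (X' j)))))"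
    by (intro sum.cong refl)
      (simp add: N.tangent_mult[OF assms(2)] N.smooth_at_mult f f' G dG)
  also have "\<dots> = (\<Sum>i\<in>K. v (f i) * (\<Sum>j\<in>K'. f' j q * ?G i j ?p) + f i q * (\<Sum>j\<in>K'. f' j q * g ?p (D ?p ?w (X i)) (X' j ?p)))
    + (\<Sum>i\<in>K. f i q * (\<Sum>j\<in>K'. v (f' j) * ?G i j ?p + f' j q * g ?p (X i ?p) (D ?p ?w (X' j))))"
    by (simp add: sum.distrib sum_distrib_left algebra_simps)
  also have "\<dots> = g ?p (rep_deriv q v K f X) (V' q) + g ?p (V q) (rep_deriv q v K' f' X')"
  proof -
    have V': "g ?p z (V' q) = (\<Sum>j\<in>K'. f' j q * g ?p z (X' j ?p))" if "z \<in> tangent_space A ?p" for z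
      unfolding represents_at[OF assms(4)] by (rule metric_sum_right[OF T'(1) that])
    have R': "g ?p z (rep_deriv q v K' f' X') = (\<Sum>j\<in>K'. v (f' j) * g ?p z (X' j ?p) + f' j q * g ?p z (D ?p ?w (X' j)))"
      if "z \<in> tangent_space A ?p" for z
    proof -
      let ?S = "\<lambda>h. \<Sum>j\<in>K'. v (f' j) * X' j ?p h" and ?S' = "\<lambda>h. \<Sum>j\<in>K'. f' j q * D ?p ?w (X' j) h"
      have "g ?p z (rep_deriv q v K' f' X') = 1 * g ?p z ?S + 1 * g ?p z ?S'"
        unfolding rep_deriv_split by (intro metric_linear_right tangent_lincomb T' that)
      moreover have "g ?p z ?S = (\<Sum>j\<in>K'. v (f' j) * g ?p z (X' j ?p))" by (rule metric_sum_right[OF T'(1) that])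
      moreover have "g ?p z ?S' = (\<Sum>j\<in>K'. f' j q * g ?p z (D ?p ?w (X' j)))" by (rule metric_sum_right[OF T'(2) that])
      ultimately show ?thesis by (simp add: sum.distrib)
    qed
    have V'T: "V' q \<in> tangent_space A ?p" and R'T: "rep_deriv q v K' f' X' \<in> tangent_space A ?p"
      using represents_tangent[OF assms(4)] rep_deriv_tangent[OF assms(1,2,4)] by auto
    have "g ?p (rep_deriv q v K f X) (V' q) =
      (\<Sum>i\<in>K. v (f i) * g ?p (X i ?p) (V' q) + f i q * g ?p (D ?p ?w (X i)) (V' q))"
    proof -
      let ?S = "\<lambda>h. \<Sum>i\<in>K. v (f i) * X i ?p h" and ?S' = "\<lambda>h. \<Sum>i\<in>K. f i q * D ?p ?w (X i) h"
      have "g ?p (rep_deriv q v K f X) (V' q) = 1 * g ?p ?S (V' q) + 1 * g ?p ?S' (V' q)"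
        unfolding rep_deriv_split by (intro metric_linear tangent_lincomb T V'T)
      moreover have "g ?p ?S (V' q) = (\<Sum>i\<in>K. v (f i) * g ?p (X i ?p) (V' q))" by (rule metric_sum_left[OF T(1) V'T])
      moreover have "g ?p ?S' (V' q) = (\<Sum>i\<in>K. f i q * g ?p (D ?p ?w (X i)) (V' q))" by (rule metric_sum_left[OF T(2) V'T])
      ultimately show ?thesis by (simp add: sum.distrib)
    qed
    moreover have "g ?p (V q) (rep_deriv q v K' f' X') = (\<Sum>i\<in>K. f i q * g ?p (X i ?p) (rep_deriv q v K' f' X'))"
      unfolding represents_at[OF assms(3)] by (rule metric_sum_left[OF T(1) R'T])
    ultimately show ?thesis by (simp add: V' R' T)
  qed
  finally show ?thesis .
qed

lemma represents_vfield:
  assumes "vfield_at A (F q) Z"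
  shows "represents q {()} (\<lambda>_ _. 1) (\<lambda>_. Z) (\<lambda>r. Z (F r))"
  unfolding represents_def using assms N.smooth_at_const by simp

lemma rep_deriv_unique:
  assumes "q \<in> W" "v \<in> tangent_space N q" "represents q K f X V" "represents q K' f' X' V"
  shows "rep_deriv q v K f X = rep_deriv q v K' f' X'"
proof (rule metric_eqI)
  show "rep_deriv q v K f X \<in> tangent_space A (F q)" by (rule rep_deriv_tangent[OF assms(1-3)])
  show "rep_deriv q v K' f' X' \<in> tangent_space A (F q)" by (rule rep_deriv_tangent[OF assms(1,2,4)])
  fix z assume "z \<in> tangent_space A (F q)"
  then obtain Z where Z: "vfield_at A (F q) Z" "Z (F q) = z" by (rule extend_tangent)
  show "g (F q) (rep_deriv q v K f X) z = g (F q) (rep_deriv q v K' f' X') z"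
    using metric_rep_deriv[OF assms(1,2,3) represents_vfield[OF Z(1)]]
      metric_rep_deriv[OF assms(1,2,4) represents_vfield[OF Z(1)]] Z(2) by simp
qed

lemma represents_imp_section:
  assumes "represents q K f X V" shows "smooth_section q V"
proof -
  obtain \<beta> where \<beta>: "bij_betw \<beta> {..<card K} K"
    using ex_bij_betw_nat_finite[of K] assms unfolding represents_def atLeast0LessThan by blast
  have "represents q {..<card K} (\<lambda>i. f (\<beta> i)) (\<lambda>i. X (\<beta> i)) V"
    using assms bij_betwE[OF \<beta>] unfolding represents_def
    by (auto simp: sum.reindex_bij_betw[OF \<beta>, of "\<lambda>i. f i r * X i (F r) h" for r h])
  then show ?thesis unfolding smooth_section_def by blast
qed

text \<open>This resolves the description in \<open>cov_along\<close>: a representation indexed by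
  an initial segment exists, and all representations have the same derivative, so any convenient one
  may be used for computing.\<close>

lemma cov_along_represents:
  assumes "q \<in> W" "v \<in> tangent_space N q" "represents q K f X V"
  shows "cov_along N A D F q v V = rep_deriv q v K f X"
proof -
  have "cov_along N A D F q v V = (THE w. \<exists>(n::nat) f X. represents q {..<n} f X V \<and> w = rep_deriv q v {..<n} f X)"
    unfolding cov_along_def represents_def rep_deriv_def by (simp add: Ball_def conj_assoc)
  also have "\<dots> = rep_deriv q v K f X"
  proof (rule the_equality)
    show "\<exists>(n::nat) f' X'. represents q {..<n} f' X' V \<and> rep_deriv q v K f X = rep_deriv q v {..<n} f' X'"
      using represents_imp_section[OF assms(3)] rep_deriv_unique[OF assms(1,2,3)]
      unfolding smooth_section_def by blast
    show "w = rep_deriv q v K f X"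
      if "\<exists>(n::nat) f X. represents q {..<n} f X V \<and> w = rep_deriv q v {..<n} f X" for w
      using that rep_deriv_unique[OF assms(1,2) _ assms(3)] by blast
  qed
  finally show ?thesis .
qed

lemma cov_along_tangent:
  assumes "q \<in> W" "v \<in> tangent_space N q" "smooth_section q V"
  shows "cov_along N A D F q v V \<in> tangent_space A (F q)"
proof -
  obtain n :: nat and f X where r: "represents q {..<n} f X V" using assms(3) unfolding smooth_section_def by blast
  show ?thesis unfolding cov_along_represents[OF assms(1,2) r] by (rule rep_deriv_tangent[OF assms(1,2) r])
qed

lemma smooth_at_metric_section:
  assumes "q \<in> W" "smooth_section q V" "smooth_section q V'"
  shows "smooth_at N q (\<lambda>r. g (F r) (V r) (V' r))"
  using assms(2,3) smooth_at_metric_represents[OF assms(1)] unfolding smooth_section_def by blast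

lemma metric_cov_along:
  assumes "q \<in> W" "v \<in> tangent_space N q" "smooth_section q V" "smooth_section q V'"
  shows "v (\<lambda>r. g (F r) (V r) (V' r)) =
    g (F q) (cov_along N A D F q v V) (V' q) + g (F q) (V q) (cov_along N A D F q v V')"
proof -
  obtain n :: nat and f X where r: "represents q {..<n} f X V" using assms(3) unfolding smooth_section_def by blast
  obtain m :: nat and f' X' where r': "represents q {..<m} f' X' V'" using assms(4) unfolding smooth_section_def by blast
  show ?thesis unfolding cov_along_represents[OF assms(1,2) r] cov_along_represents[OF assms(1,2) r']
    by (rule metric_rep_deriv[OF assms(1,2) r r'])
qed

text \<open>Multiplying all coefficients of a representation by \<open>a\<close> represents the
  scaled section; the product rule for \<open>v\<close> on \<open>a * f i\<close> splits off the
  term with \<open>v a\<close>.\<close>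

lemma cov_along_scale:
  assumes "q \<in> W" "v \<in> tangent_space N q" "smooth_section q V" "smooth_at N q a"
  shows "cov_along N A D F q v (\<lambda>r h. a r * V r h) =
      tcomb (v a) (V q) (a q) (cov_along N A D F q v V)"
proof -
  obtain n :: nat and f X where r: "represents q {..<n} f X V" using assms(3) unfolding smooth_section_def by blast
  have r': "represents q {..<n} (\<lambda>i r. a r * f i r) X (\<lambda>r h. a r * V r h)"
  proof -
    have "\<forall>\<^sub>F r in nhds q. V r = (\<lambda>h. \<Sum>i<n. f i r * X i (F r) h)" using r unfolding represents_def by blast
    then have "\<forall>\<^sub>F r in nhds q. (\<lambda>h. a r * V r h) = (\<lambda>h. \<Sum>i<n. a r * f i r * X i (F r) h)"
      by eventually_elim (simp add: sum_distrib_left mult.assoc)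
    then show ?thesis using r N.smooth_at_mult[OF assms(4)] unfolding represents_def by blast
  qed
  have f: "smooth_at N q (f i)" if "i < n" for i using that r unfolding represents_def by blast
  show "cov_along N A D F q v (\<lambda>r h. a r * V r h) = tcomb (v a) (V q) (a q) (cov_along N A D F q v V)"
    unfolding cov_along_represents[OF assms(1,2) r'] cov_along_represents[OF assms(1,2) r] rep_deriv_def
      tcomb_def represents_at[OF r]
    by (intro ext, simp add: sum_distrib_left flip: sum.distrib, intro sum.cong refl)
      (simp add: N.tangent_mult[OF assms(2,4) f] algebra_simps)
qed

end

section \<open>Sasakian geometry and horizontal lifts\<close>

context contact_riemannian_3_manifold
begin

section \<open>Algebra of the contact metric structure\<close>

lemma xi_vfield_at: "vfield_at A p \<xi>"
  using Reeb_field unfolding vfield_at_def by blast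

lemma xi_tangent: "\<xi> p \<in> tangent_space A p"
  by (rule vfield_at_tangent[OF xi_vfield_at])

lemma phi_tangent: "v \<in> tangent_space A p \<Longrightarrow> \<phi> p v \<in> tangent_space A p"
  using endo unfolding endo_field_def by blast

lemma phi_tcomb: "v \<in> tangent_space A p \<Longrightarrow> w \<in> tangent_space A p \<Longrightarrow>
    \<phi> p (tcomb a v b w) = tcomb a (\<phi> p v) b (\<phi> p w)"
  using endo unfolding endo_field_def by blast

lemma phi_zero: "\<phi> p tzero = tzero"
  using phi_tcomb[OF tangent_zero tangent_zero, of p 0 0] by (simp add: tcomb_def)

lemma phi_scale: "v \<in> tangent_space A p \<Longrightarrow> \<phi> p (\<lambda>h. a * v h) = (\<lambda>h. a * \<phi> p v h)"
  using phi_tcomb[of v p v a 0] by (simp add: tcomb_def)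

lemma phi_lincomb:
  assumes "\<And>i. i \<in> K \<Longrightarrow> X i \<in> tangent_space A p"
  shows "\<phi> p (\<lambda>h. \<Sum>i\<in>K. a i * X i h) = (\<lambda>h. \<Sum>i\<in>K. a i * \<phi> p (X i) h)"
  using assms
proof (induction K rule: infinite_finite_induct)
  case (insert k K)
  have "(\<lambda>h. \<Sum>i\<in>K. a i * X i h) \<in> tangent_space A p" by (intro tangent_lincomb insert) auto
  then have "\<phi> p (tcomb (a k) (X k) 1 (\<lambda>h. \<Sum>i\<in>K. a i * X i h)) =
      tcomb (a k) (\<phi> p (X k)) 1 (\<phi> p (\<lambda>h. \<Sum>i\<in>K. a i * X i h))"
    by (intro phi_tcomb insert.prems) auto
  then show ?case using insert by (simp add: tcomb_def)
qed (simp_all add: phi_zero)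

lemma phi_vfield_at:
  assumes "vfield_at A p X" shows "vfield_at A p (\<lambda>q. \<phi> q (X q))"
  using assms endo unfolding endo_field_def vfield_at_def by blast

lemma eta_tcomb: "v \<in> tangent_space A p \<Longrightarrow> w \<in> tangent_space A p \<Longrightarrow>
    \<eta> p (tcomb a v b w) = a * \<eta> p v + b * \<eta> p w"
  using one_form unfolding one_form_def by blast

lemma eta_smooth_at:
  assumes "vfield_at A p X" shows "smooth_at A p (\<lambda>q. \<eta> q (X q))"
  using assms one_form unfolding one_form_def vfield_at_def smooth_at_def by blast

lemma metric_xi_xi: "g p (\<xi> p) (\<xi> p) = 1"
  using metric_Reeb[OF xi_tangent] Reeb_eta by simp

lemma metric_xi_right: "v \<in> tangent_space A p \<Longrightarrow> g p v (\<xi> p) = \<eta> p v"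
  using metric_Reeb metric_sym[OF xi_tangent] by metis

text \<open>By \<open>metric_phi\<close> the squared length of this vector is
  \<open>1 - 1\<close>.\<close>

lemma phi_xi: "\<phi> p (\<xi> p) = tzero"
proof -
  have "g p (\<phi> p (\<xi> p)) (\<phi> p (\<xi> p)) = 0"
    using metric_phi[OF xi_tangent xi_tangent] by (simp add: metric_xi_xi Reeb_eta)
  then show ?thesis using metric_pos[OF phi_tangent[OF xi_tangent]] by fastforce
qed

text \<open>The two ways of evaluating the third power of \<phi> on \<open>v\<close> can differ only
  in the coefficient of \<xi>, which is therefore zero.\<close>

lemma eta_phi:
  assumes "v \<in> tangent_space A p"
  shows "\<eta> p (\<phi> p v) = 0"
proof -
  have "tcomb (-1) (\<phi> p v) (\<eta> p (\<phi> p v)) (\<xi> p) = \<phi> p (tcomb (-1) v (\<eta> p v) (\<xi> p))"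
    using phi_phi[OF phi_tangent[OF assms]] phi_phi[OF assms] by simp
  also have "\<dots> = tcomb (-1) (\<phi> p v) (\<eta> p v) tzero"
    by (simp add: phi_tcomb[OF assms xi_tangent] phi_xi)
  finally have "(\<lambda>h. \<eta> p (\<phi> p v) * \<xi> p h) = tzero" by (auto simp: tcomb_def fun_eq_iff)
  then have "\<eta> p (\<phi> p v) * g p (\<xi> p) (\<xi> p) = 0"
    using metric_scale_left[where p = p and a = "\<eta> p (\<phi> p v)", OF xi_tangent xi_tangent] metric_zero_left[OF xi_tangent, of p] by simp
  then show ?thesis by (simp add: metric_xi_xi)
qed

text \<open>Compatibility moves \<phi> across the metric with a change of sign, while the metric is
  symmetric, so the value is its own negative.\<close>

lemma metric_phi_self:
  assumes "v \<in> tangent_space A p"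
  shows "g p v (\<phi> p v) = 0" "g p (\<phi> p v) v = 0"
proof -
  note P = phi_tangent[OF assms]
  have "g p (\<phi> p v) (\<phi> p (\<phi> p v)) = g p v (\<phi> p v)"
    using metric_phi[OF assms P] eta_phi[OF assms] by simp
  moreover have "g p (\<phi> p v) (\<phi> p (\<phi> p v)) = - g p (\<phi> p v) v"
    unfolding phi_phi[OF assms] metric_linear_right[OF assms xi_tangent P]
    by (simp add: metric_xi_right[OF P] eta_phi[OF assms])
  ultimately show "g p v (\<phi> p v) = 0" "g p (\<phi> p v) v = 0" using metric_sym[OF assms P] by simp_all
qed

lemma horizontal_iff: "v \<in> horizontal_space A g \<xi> p \<longleftrightarrow> v \<in> tangent_space A p \<and> \<eta> p v = 0"
  unfolding horizontal_space_def using metric_Reeb by auto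

lemma phi_horizontal: "v \<in> tangent_space A p \<Longrightarrow> \<phi> p v \<in> horizontal_space A g \<xi> p"
  unfolding horizontal_iff using phi_tangent eta_phi by blast

text \<open>The preceding identities make \<xi>, \<open>v\<close> and \<phi> v orthonormal, and the
  dimension is three.\<close>

lemma frame_expand:
  assumes v: "v \<in> horizontal_space A g \<xi> p" "g p v v = 1" and w: "w \<in> tangent_space A p"
  shows "w = (\<lambda>h. \<eta> p w * \<xi> p h + g p w v * v h + g p w (\<phi> p v) * \<phi> p v h)"
proof -
  have vT: "v \<in> tangent_space A p" and v0: "\<eta> p v = 0" using v(1) unfolding horizontal_iff by auto
  let ?u = "\<lambda>k::nat. if k = 0 then \<xi> p else if k = 1 then v else \<phi> p v"
  have "w = (\<lambda>h. \<Sum>k\<in>{0,1,2}. g p w (?u k) * ?u k h)"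
  proof (rule orthonormal_expand)
    show "?u k \<in> tangent_space A p" for k using vT xi_tangent phi_tangent by simp
    show "g p (?u k) (?u j) = of_bool (k = j)" if "k \<in> {0,1,2}" "j \<in> {0,1,2}" for k j
      using that metric_xi_xi metric_xi_right[OF vT] metric_Reeb[OF vT] metric_xi_right[OF phi_tangent[OF vT]]
        metric_Reeb[OF phi_tangent[OF vT]] v0 eta_phi[OF vT] v(2) metric_phi_self[OF vT] metric_phi[OF vT vT]
      by auto
  qed (use w in auto)
  then show ?thesis by (simp add: metric_xi_right[OF w] add.assoc)
qed

text \<open>Rescaling \<open>v\<close> to unit length brings in
  \<open>c = 1 / sqrt (g p v v)\<close>, but only \<open>c * c\<close> survives. The coefficients
  are therefore rational in values of the metric, which is the form needed for smoothness of
  lifts.\<close>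

lemma horizontal_expand:
  assumes v: "v \<in> horizontal_space A g \<xi> p" "v \<noteq> tzero" and w: "w \<in> horizontal_space A g \<xi> p"
  shows "w = (\<lambda>h. g p w v / g p v v * v h + g p w (\<phi> p v) / g p v v * \<phi> p v h)"
proof -
  have vT: "v \<in> tangent_space A p" and v0: "\<eta> p v = 0" using v(1) unfolding horizontal_iff by auto
  have wT: "w \<in> tangent_space A p" and w0: "\<eta> p w = 0" using w unfolding horizontal_iff by auto
  have pos: "g p v v > 0" by (rule metric_pos[OF vT v(2)])
  define c where "c = 1 / sqrt (g p v v)"
  have cc: "c * c = 1 / g p v v" using pos by (simp add: c_def)
  let ?v = "\<lambda>h. c * v h"
  have v'T: "?v \<in> tangent_space A p" by (rule tangent_scale[OF vT])
  have "\<eta> p ?v = 0" using eta_tcomb[OF vT vT, of c 0] v0 by (simp add: tcomb_def)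
  then have v': "?v \<in> horizontal_space A g \<xi> p" using v'T horizontal_iff by blast
  have n: "g p ?v ?v = 1"
    using pos cc by (simp add: metric_scale_left[OF vT v'T] metric_scale_right[OF vT vT] mult.assoc[symmetric])
  have "w = (\<lambda>h. \<eta> p w * \<xi> p h + g p w ?v * ?v h + g p w (\<phi> p ?v) * \<phi> p ?v h)"
    by (rule frame_expand[OF v' n wT])
  also have "\<dots> = (\<lambda>h. (c * c) * g p w v * v h + (c * c) * g p w (\<phi> p v) * \<phi> p v h)"
    using phi_tangent[OF vT] by (simp add: w0 phi_scale[OF vT] metric_scale_right wT vT mult_ac)
  finally show ?thesis by (simp add: cc)
qed

end

context sasaki_3_manifold
begin

text \<open>The Sasaki identity with both arguments \<xi> has right side zero, and \<phi> \<xi>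
  vanishes identically, so \<phi> kills the derivative and only a multiple of \<xi> is left. The
  constant length of \<xi> excludes that multiple.\<close>

lemma conn_xi_xi: "D p (\<xi> p) \<xi> = tzero"
proof -
  let ?w = "D p (\<xi> p) \<xi>"
  have wT: "?w \<in> tangent_space A p" by (rule conn_tangent[OF xi_tangent xi_vfield_at])
  \<comment> \<open>The zero field is written as \<open>0 * \<xi>\<close> so that the Leibniz rule
    yields its derivative.\<close>
  have "D p (\<xi> p) (\<lambda>q h. 0 * \<xi> q h) = tcomb ((\<xi> p) (\<lambda>q. 0)) (\<xi> p) 0 ?w"
    by (rule conn_leibniz[OF xi_tangent smooth_at_const xi_vfield_at])
  then have "D p (\<xi> p) (\<lambda>q. \<phi> q (\<xi> q)) = tzero"
    by (simp add: phi_xi tangent_const[OF xi_tangent] tcomb_def)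
  with sasaki[OF xi_tangent xi_vfield_at, of p] have "\<phi> p ?w = tzero"
    by (auto simp: tcomb_def fun_eq_iff metric_xi_xi Reeb_eta)
  then have "tcomb (-1) ?w (\<eta> p ?w) (\<xi> p) = tzero" using phi_phi[OF wT] phi_zero by simp
  moreover have "\<eta> p ?w = 0"
  proof -
    have "(\<xi> p) (\<lambda>q. g q (\<xi> q) (\<xi> q)) = g p ?w (\<xi> p) + g p (\<xi> p) ?w"
      by (rule conn_metric[OF xi_tangent xi_vfield_at xi_vfield_at])
    then show ?thesis
      by (simp add: metric_xi_xi tangent_const[OF xi_tangent] metric_Reeb[OF wT] metric_xi_right[OF wT])
  qed
  ultimately show ?thesis by (auto simp: tcomb_def fun_eq_iff)
qed

end

sublocale boothby_wang_fibering \<subseteq> proj: map_into_riemannian B gB DB A UNIV \<pi>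
  by unfold_locales (rule proj_smooth)

context boothby_wang_fibering
begin

section \<open>Horizontal lifts and their smoothness\<close>

abbreviation lift where "lift p u \<equiv> horizontal_lift A g \<xi> B \<pi> p u"

lemma push_tcomb: "push B \<pi> p (tcomb a v b w) = tcomb a (push B \<pi> p v) b (push B \<pi> p w)"
  by (auto simp: push_def tcomb_def)

lemma push_lincomb: "push B \<pi> p (\<lambda>h. \<Sum>i\<in>K. a i * X i h) = (\<lambda>h. \<Sum>i\<in>K. a i * push B \<pi> p (X i) h)"
  by (auto simp: push_def)

lemma push_pi_tangent: "v \<in> tangent_space A p \<Longrightarrow> push B \<pi> p v \<in> tangent_space B (\<pi> p)"
  by (rule proj.push_in_tangent) simp

lemma horizontal_tangent: "v \<in> horizontal_space A g \<xi> p \<Longrightarrow> v \<in> tangent_space A p"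
  unfolding horizontal_iff by blast

lemma horizontal_tcomb:
  "v \<in> horizontal_space A g \<xi> p \<Longrightarrow> w \<in> horizontal_space A g \<xi> p \<Longrightarrow> tcomb a v b w \<in> horizontal_space A g \<xi> p"
  unfolding horizontal_iff using tangent_tcomb eta_tcomb by auto

lemma horizontal_lincomb:
  assumes "\<And>i. i \<in> K \<Longrightarrow> X i \<in> horizontal_space A g \<xi> p"
  shows "(\<lambda>h. \<Sum>i\<in>K. a i * X i h) \<in> horizontal_space A g \<xi> p"
  using assms
proof (induction K rule: infinite_finite_induct)
  case (insert k K)
  then have "tcomb (a k) (X k) 1 (\<lambda>h. \<Sum>i\<in>K. a i * X i h) \<in> horizontal_space A g \<xi> p" by (intro horizontal_tcomb) auto
  then show ?case using insert by (simp add: tcomb_def)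
qed (simp_all add: horizontal_space_def tangent_zero metric_Reeb, (use eta_tcomb[OF tangent_zero tangent_zero, of p 0 0] in \<open>simp add: tcomb_def\<close>)+)

text \<open>The flow of \<xi> stays in a fibre, so \<open>f \<circ> \<pi>\<close> is constant along
  it.\<close>

lemma push_xi: "push B \<pi> p (\<xi> p) = tzero"
proof
  fix f
  have "\<pi> (\<Phi> s p) = \<pi> p" for s using proj_fibre[of p "\<Phi> s p"] by auto
  then have "velocity A (\<lambda>t. \<Phi> t p) 0 (f \<circ> \<pi>) = 0" by (simp add: velocity_def)
  then show "push B \<pi> p (\<xi> p) f = 0" using flow_Reeb[of p 0] flow_0 by (simp add: push_def)
qed

text \<open>Two horizontal vectors with the same image differ by a horizontal vector with image
  zero, and the projection preserves horizontal lengths.\<close>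

lemma lift_unique:
  assumes "v \<in> horizontal_space A g \<xi> p"
  shows "lift p (push B \<pi> p v) = v"
  unfolding horizontal_lift_def
proof (rule the_equality)
  fix w assume w: "w \<in> horizontal_space A g \<xi> p \<and> push B \<pi> p w = push B \<pi> p v"
  let ?z = "tcomb 1 w (-1) v"
  have z: "?z \<in> horizontal_space A g \<xi> p" using w assms horizontal_tcomb by blast
  have "push B \<pi> p ?z = tzero" unfolding push_tcomb using w by (simp add: tcomb_def)
  then have "g p ?z ?z = 0"
    using proj_isometry[OF z z] base.metric_zero_left[OF base.tangent_zero] by simp
  then have "?z = tzero" using metric_pos[OF horizontal_tangent[OF z]] by fastforce
  then show "w = v" by (auto simp: tcomb_def fun_eq_iff)
qed (use assms in blast)

lemma
  assumes "u \<in> tangent_space B (\<pi> p)"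
  shows lift_horizontal: "lift p u \<in> horizontal_space A g \<xi> p" and push_lift: "push B \<pi> p (lift p u) = u"
proof -
  have "u \<in> push B \<pi> p ` horizontal_space A g \<xi> p" using proj_submersion assms by simp
  then obtain v where "v \<in> horizontal_space A g \<xi> p" "push B \<pi> p v = u" by blast
  then show "lift p u \<in> horizontal_space A g \<xi> p" "push B \<pi> p (lift p u) = u" using lift_unique by auto
qed

lemma lift_tangent: "u \<in> tangent_space B (\<pi> p) \<Longrightarrow> lift p u \<in> tangent_space A p"
  using lift_horizontal horizontal_tangent by blast

lemma lift_lincomb:
  assumes "\<And>i. i \<in> K \<Longrightarrow> u i \<in> tangent_space B (\<pi> p)"
  shows "lift p (\<lambda>h. \<Sum>i\<in>K. a i * u i h) = (\<lambda>h. \<Sum>i\<in>K. a i * lift p (u i) h)"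
proof -
  have "push B \<pi> p (\<lambda>h. \<Sum>i\<in>K. a i * lift p (u i) h) = (\<lambda>h. \<Sum>i\<in>K. a i * u i h)"
    unfolding push_lincomb using push_lift[OF assms] by simp
  then show ?thesis using lift_unique[OF horizontal_lincomb[of K "\<lambda>i. lift p (u i)" p a]] lift_horizontal[OF assms] by simp
qed

text \<open>The lift is adjoint to the differential of \<pi>. The vertical part of \<open>w\<close>
  is orthogonal to lifts and killed by the projection; for the horizontal part this is the isometry
  axiom.\<close>

lemma metric_lift:
  assumes w: "w \<in> tangent_space A p" and u: "u \<in> tangent_space B (\<pi> p)"
  shows "g p w (lift p u) = gB (\<pi> p) (push B \<pi> p w) u"
proof -
  let ?w = "tcomb 1 w (- \<eta> p w) (\<xi> p)"
  have h: "?w \<in> horizontal_space A g \<xi> p"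
    unfolding horizontal_iff using tangent_tcomb[OF w xi_tangent] eta_tcomb[OF w xi_tangent, of 1 "- \<eta> p w"]
    by (simp add: Reeb_eta)
  have l: "lift p u \<in> tangent_space A p" "\<eta> p (lift p u) = 0" using lift_horizontal[OF u] unfolding horizontal_iff by auto
  have "g p ?w (lift p u) = g p w (lift p u)"
    by (simp add: metric_linear[OF w xi_tangent l(1)] metric_Reeb[OF l(1)] l(2))
  moreover have "push B \<pi> p ?w = push B \<pi> p w" unfolding push_tcomb push_xi by (simp add: tcomb_def)
  ultimately show ?thesis using proj_isometry[OF h lift_horizontal[OF u]] push_lift[OF u] by simp
qed

text \<open>A projected field may vary along a fibre, so it is only a section along \<pi>. Its
  components in a base chart are the derivatives along \<open>X\<close> of the pulled-back
  coordinate functions.\<close>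

lemma push_vfield_section:
  assumes "vfield_at A p X"
  shows "proj.smooth_section p (\<lambda>q. push B \<pi> q (X q))"
proof -
  obtain V y where V: "(V, y) \<in> B" "\<pi> p \<in> V" by (rule base.obtain_chart)
  have ev: "\<forall>\<^sub>F q in nhds p. \<pi> q \<in> V"
    by (rule proj.eventually_pull[OF UNIV_I eventually_nhds_in_open[OF base.chart_open[OF V(1)] V(2)]])
  have "\<forall>\<^sub>F q in nhds p. push B \<pi> q (X q) =
      (\<lambda>h. \<Sum>b\<in>Basis. X q (\<lambda>r. y (\<pi> r) \<bullet> b) * coord_vec B V y b (\<pi> q) h)"
    using ev eventually_vfield_at[OF assms]
  proof eventually_elim
    case (elim q)
    have "push B \<pi> q (X q) (\<lambda>r. y r \<bullet> b) = X q (\<lambda>r. y (\<pi> r) \<bullet> b)" for b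
      using base.smooth_at_coordinate[OF V(1) elim(1)] by (simp add: push_def comp_def)
    then show ?case
      using base.tangent_expand[OF push_pi_tangent[OF vfield_at_tangent[OF elim(2)]] V(1) elim(1)] by simp
  qed
  then have "proj.represents p Basis (\<lambda>b q. X q (\<lambda>r. y (\<pi> r) \<bullet> b)) (\<lambda>b. coord_vec B V y b) (\<lambda>q. push B \<pi> q (X q))"
    unfolding proj.represents_def
    using base.vfield_at_coord_vec[OF V] vfield_at_smooth[OF assms] proj.pull_smooth_at[OF UNIV_I base.smooth_at_coordinate[OF V]]
    by simp
  then show ?thesis by (rule proj.represents_imp_section)
qed

lemma smooth_at_metric_push:
  assumes "vfield_at A p X" "vfield_at B (\<pi> p) e"
  shows "smooth_at A p (\<lambda>q. gB (\<pi> q) (push B \<pi> q (X q)) (e (\<pi> q)))"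
  by (rule proj.smooth_at_metric_section[OF UNIV_I push_vfield_section[OF assms(1)]
      proj.represents_imp_section[OF proj.represents_vfield[OF assms(2)]]])

text \<open>The lift of a nonzero base vector is extended to a field, which becomes horizontal on
  subtracting its component along \<xi>; at \<open>p\<close> that component is already zero, so the
  value there stays nonzero.\<close>

lemma obtain_horizontal_field:
  obtains X where "vfield_at A p X" "\<forall>q. \<eta> q (X q) = 0" "X p \<noteq> tzero"
proof -
  obtain V y where V: "(V, y) \<in> B" "\<pi> p \<in> V" by (rule base.obtain_chart)
  obtain b :: "real^2" where b: "b \<in> Basis" using nonempty_Basis by blast
  let ?u = "coord_vec B V y b (\<pi> p)"
  have uT: "?u \<in> tangent_space B (\<pi> p)" by (rule base.coord_vec_tangent[OF V])
  have u: "?u \<noteq> tzero"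
  proof
    assume "?u = tzero"
    then have "?u (\<lambda>q. y q \<bullet> b) = 0" by simp
    then show False using base.coord_vec_coordinate[OF V, of b b] b by simp
  qed
  obtain Y where Y: "vfield_at A p Y" "Y p = lift p ?u" using extend_tangent[OF lift_tangent[OF uT]] .
  \<comment> \<open>\<open>Y\<close> is known to be tangent only near \<open>p\<close>; the value
    zero elsewhere makes \<eta> annihilate the field at every point.\<close>
  let ?X = "\<lambda>q. if Y q \<in> tangent_space A q then tcomb 1 (Y q) (- \<eta> q (Y q)) (\<xi> q) else tzero"
  have "vfield_at A p (\<lambda>q. tcomb 1 (Y q) (- \<eta> q (Y q)) (\<xi> q))"
    by (intro vfield_at_tcomb Y(1) xi_vfield_at smooth_at_const smooth_at_minus eta_smooth_at)
  then have "vfield_at A p ?X"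
    by (rule vfield_at_cong) (use eventually_vfield_at[OF Y(1)] in eventually_elim, simp add: vfield_at_tangent)
  moreover have "\<eta> q (?X q) = 0" for q
    using eta_tcomb[OF _ xi_tangent, of "Y q" q 1 "- \<eta> q (Y q)"] eta_tcomb[OF tangent_zero tangent_zero, of q 0 0]
    by (auto simp: Reeb_eta) (simp add: tcomb_def)
  moreover have "?X p \<noteq> tzero"
  proof
    assume z: "?X p = tzero"
    have "?X p = lift p ?u" using lift_horizontal[OF uT] lift_tangent[OF uT] unfolding horizontal_iff Y(2) by (simp add: tcomb_def)
    then have "?u = push B \<pi> p tzero" using push_lift[OF uT] z by simp
    then show False using u by (auto simp: push_def fun_eq_iff)
  qed
  ultimately show thesis using that by blast
qed

text \<open>A local horizontal field \<open>X\<close> gives the orthogonal frame \<open>(X, \<phi>X)\<close>, in which the coefficients of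
  the lift are smooth functions of the form \<open>gB(\<pi>\<^sub>*X, e)\<close>.\<close>

lemma lift_vfield_at:
  assumes e: "vfield_at B (\<pi> p) e"
  shows "vfield_at A p (\<lambda>q. lift q (e (\<pi> q)))"
proof -
  obtain X where X: "vfield_at A p X" "\<forall>q. \<eta> q (X q) = 0" "X p \<noteq> tzero"
    by (rule obtain_horizontal_field[of p])
  let ?a = "\<lambda>q. inverse (g q (X q) (X q))"
  let ?c = "\<lambda>q. gB (\<pi> q) (push B \<pi> q (X q)) (e (\<pi> q))"
  let ?d = "\<lambda>q. gB (\<pi> q) (push B \<pi> q (\<phi> q (X q))) (e (\<pi> q))"
  have XT: "X p \<in> tangent_space A p" by (rule vfield_at_tangent[OF X(1)])
  have a: "smooth_at A p (\<lambda>q. g q (X q) (X q))" by (rule metric_smooth_at[OF X(1) X(1)])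
  have ap: "g p (X p) (X p) \<noteq> 0" using metric_pos[OF XT X(3)] by simp
  have "\<forall>\<^sub>F q in nhds p. g q (X q) (X q) \<noteq> 0"
    using tendsto_imp_eventually_ne[OF smooth_at_isCont[OF a, unfolded isCont_def] ap] ap
    by (simp add: eventually_nhds_conv_at)
  moreover have "\<forall>\<^sub>F q in nhds p. e (\<pi> q) \<in> tangent_space B (\<pi> q)"
    by (rule proj.eventually_pull[OF UNIV_I]) (use base.eventually_vfield_at[OF e] in eventually_elim, rule base.vfield_at_tangent)
  ultimately have "\<forall>\<^sub>F q in nhds p.
      tcomb (?c q * ?a q) (X q) (?d q * ?a q) (\<phi> q (X q)) = lift q (e (\<pi> q))"
    using eventually_vfield_at[OF X(1)]
  proof eventually_elim
    case (elim q)
    have XT: "X q \<in> tangent_space A q" by (rule vfield_at_tangent[OF elim(3)])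
    then have Xh: "X q \<in> horizontal_space A g \<xi> q" unfolding horizontal_iff using X(2) by blast
    have X0: "X q \<noteq> tzero" using elim(1) metric_zero_left[OF tangent_zero] by metis
    note lT = lift_tangent[OF elim(2)]
    show ?case
      using horizontal_expand[OF Xh X0 lift_horizontal[OF elim(2)]]
        metric_sym[OF lT XT] metric_sym[OF lT phi_tangent[OF XT]]
        metric_lift[OF XT elim(2)] metric_lift[OF phi_tangent[OF XT] elim(2)]
      by (simp add: tcomb_def divide_inverse)
  qed
  moreover have "vfield_at A p (\<lambda>q. tcomb (?c q * ?a q) (X q) (?d q * ?a q) (\<phi> q (X q)))"
    by (intro vfield_at_tcomb smooth_at_mult smooth_at_metric_push[OF _ e] smooth_at_inverse a ap phi_vfield_at X(1))
  ultimately show ?thesis by (rule vfield_at_cong[rotated])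
qed

section \<open>Covariant derivatives of lifts and the complex structure\<close>

lemma metric_lift_lift:
  assumes "u \<in> tangent_space B (\<pi> p)" "u' \<in> tangent_space B (\<pi> p)"
  shows "g p (lift p u) (lift p u') = gB (\<pi> p) u u'"
  using metric_lift[OF lift_tangent[OF assms(1)] assms(2)] push_lift[OF assms(1)] by simp

lemma push_apply: "smooth_at B (\<pi> p) f \<Longrightarrow> v (\<lambda>q. f (\<pi> q)) = push B \<pi> p v f"
  by (simp add: push_def comp_def)

text \<open>The inner product of two lifts is a function pulled back from the base, and on such
  functions a lift acts through its projection.\<close>

lemma lift_metric_deriv:
  assumes "u \<in> tangent_space B (\<pi> p)" "vfield_at B (\<pi> p) Y" "vfield_at B (\<pi> p) Z"
  shows "lift p u (\<lambda>q. g q (lift q (Y (\<pi> q))) (lift q (Z (\<pi> q)))) = u (\<lambda>b. gB b (Y b) (Z b))"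
proof -
  have "\<forall>\<^sub>F q in nhds p. vfield_at B (\<pi> q) Y" "\<forall>\<^sub>F q in nhds p. vfield_at B (\<pi> q) Z"
    by (intro proj.eventually_pull[OF UNIV_I] base.eventually_vfield_at assms)+
  then have "\<forall>\<^sub>F q in nhds p. g q (lift q (Y (\<pi> q))) (lift q (Z (\<pi> q))) = gB (\<pi> q) (Y (\<pi> q)) (Z (\<pi> q))"
    by eventually_elim (intro metric_lift_lift base.vfield_at_tangent)
  then have "lift p u (\<lambda>q. g q (lift q (Y (\<pi> q))) (lift q (Z (\<pi> q)))) = lift p u (\<lambda>q. gB (\<pi> q) (Y (\<pi> q)) (Z (\<pi> q)))"
    by (rule tangent_cong[OF lift_tangent[OF assms(1)]])
  also have "\<dots> = u (\<lambda>b. gB b (Y b) (Z b))"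
    using push_apply[OF base.metric_smooth_at[OF assms(2,3)], of "lift p u"] push_lift[OF assms(1)] by simp
  finally show ?thesis .
qed

text \<open>A lift is \<pi>-related to its base field: it differentiates
  \<open>f \<circ> \<pi>\<close> as the base field differentiates \<open>f\<close>. Commutators of
  related fields are related.\<close>

lemma push_bracket_lift:
  assumes X: "vfield_at B (\<pi> p) X" and Y: "vfield_at B (\<pi> p) Y"
  shows "push B \<pi> p (bracket A (\<lambda>q. lift q (X (\<pi> q))) (\<lambda>q. lift q (Y (\<pi> q))) p) = bracket B X Y (\<pi> p)"
proof
  fix f
  let ?b = "bracket A (\<lambda>q. lift q (X (\<pi> q))) (\<lambda>q. lift q (Y (\<pi> q))) p"
  show "push B \<pi> p ?b f = bracket B X Y (\<pi> p) f"
  proof (cases "smooth_at B (\<pi> p) f")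
    case True
    have f: "smooth_at A p (\<lambda>q. f (\<pi> q))" by (rule proj.pull_smooth_at[OF UNIV_I True])
    have key: "lift p (X (\<pi> p)) (\<lambda>q. lift q (Y (\<pi> q)) (\<lambda>q. f (\<pi> q))) = X (\<pi> p) (\<lambda>b. Y b f)"
      if X: "vfield_at B (\<pi> p) X" and Y: "vfield_at B (\<pi> p) Y" for X Y
    proof -
      note XT = base.vfield_at_tangent[OF X]
      have "\<forall>\<^sub>F q in nhds p. vfield_at B (\<pi> q) Y \<and> smooth_at B (\<pi> q) f"
        by (intro proj.eventually_pull[OF UNIV_I] eventually_conj base.eventually_vfield_at Y base.eventually_smooth_at True)
      then have "\<forall>\<^sub>F q in nhds p. lift q (Y (\<pi> q)) (\<lambda>q. f (\<pi> q)) = Y (\<pi> q) f"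
        by eventually_elim (metis push_apply push_lift base.vfield_at_tangent)
      then have "lift p (X (\<pi> p)) (\<lambda>q. lift q (Y (\<pi> q)) (\<lambda>q. f (\<pi> q))) = lift p (X (\<pi> p)) (\<lambda>q. Y (\<pi> q) f)"
        by (rule tangent_cong[OF lift_tangent[OF XT]])
      also have "\<dots> = X (\<pi> p) (\<lambda>b. Y b f)"
        using push_apply[OF base.vfield_at_smooth[OF Y True], of "lift p (X (\<pi> p))"] push_lift[OF XT] by simp
      finally show ?thesis .
    qed
    show ?thesis using True f key[OF X Y] key[OF Y X] by (simp add: push_def bracket_def comp_def)
  qed (simp add: push_def bracket_def)
qed

text \<open>O'Neill's formula: every term of the Koszul formula for the lifts is the corresponding term in
  the base, since brackets of lifts project to brackets.\<close>

lemma metric_conn_lift: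
  assumes "u \<in> tangent_space B (\<pi> p)" "vfield_at B (\<pi> p) Y" "z \<in> tangent_space B (\<pi> p)"
  shows "g p (D p (lift p u) (\<lambda>q. lift q (Y (\<pi> q)))) (lift p z) = gB (\<pi> p) (DB (\<pi> p) u Y) z"
proof -
  obtain X where X: "vfield_at B (\<pi> p) X" "X (\<pi> p) = u" by (rule base.extend_tangent[OF assms(1)])
  obtain Z where Z: "vfield_at B (\<pi> p) Z" "Z (\<pi> p) = z" by (rule base.extend_tangent[OF assms(3)])
  note Y = assms(2)
  let ?X = "\<lambda>q. lift q (X (\<pi> q))" let ?Y = "\<lambda>q. lift q (Y (\<pi> q))" let ?Z = "\<lambda>q. lift q (Z (\<pi> q))"
  note l = lift_vfield_at[OF X(1)] lift_vfield_at[OF Y] lift_vfield_at[OF Z(1)]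
  note T = base.vfield_at_tangent[OF X(1)] base.vfield_at_tangent[OF Y] base.vfield_at_tangent[OF Z(1)]
  have br: "g p (bracket A (\<lambda>q. lift q (E (\<pi> q))) (\<lambda>q. lift q (E' (\<pi> q))) p) (lift p w) = gB (\<pi> p) (bracket B E E' (\<pi> p)) w"
    if "vfield_at B (\<pi> p) E" "vfield_at B (\<pi> p) E'" "w \<in> tangent_space B (\<pi> p)" for E E' w
    using metric_lift[OF bracket_tangent[OF lift_vfield_at[OF that(1)] lift_vfield_at[OF that(2)]] that(3)]
      push_bracket_lift[OF that(1,2)] by simp
  have "2 * g p (D p (?X p) ?Y) (?Z p) = 2 * gB (\<pi> p) (DB (\<pi> p) (X (\<pi> p)) Y) (Z (\<pi> p))"
    unfolding koszul[OF l] base.koszul[OF X(1) Y Z(1)]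
    using br[OF X(1) Y T(3)] br[OF X(1) Z(1) T(2)] br[OF Y Z(1) T(1)]
      lift_metric_deriv[OF T(1) Y Z(1)] lift_metric_deriv[OF T(2) X(1) Z(1)] lift_metric_deriv[OF T(3) X(1) Y]
    by simp
  then show ?thesis using X(2) Z(2) by simp
qed

text \<open>\<phi> takes horizontal values, so the vector projected to define \<open>J\<close> is
  already the lift of its image.\<close>

lemma
  assumes "u \<in> tangent_space B (\<pi> p)"
  shows J_tangent: "J (\<pi> p) u \<in> tangent_space B (\<pi> p)" and lift_J: "lift p (J (\<pi> p) u) = \<phi> p (lift p u)"
proof -
  note lT = lift_tangent[OF assms]
  show "J (\<pi> p) u \<in> tangent_space B (\<pi> p)"
    unfolding complex_structure[OF assms] by (rule push_pi_tangent[OF phi_tangent[OF lT]])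
  show "lift p (J (\<pi> p) u) = \<phi> p (lift p u)"
    unfolding complex_structure[OF assms] by (rule lift_unique[OF phi_horizontal[OF lT]])
qed

text \<open>The properties of \<open>J\<close> are those of \<phi> on horizontal vectors, read off
  at any point of the fibre; surjectivity of \<pi> provides such a point.\<close>

lemma
  assumes "u \<in> tangent_space B b"
  shows J_in_tangent: "J b u \<in> tangent_space B b" and metric_J_J: "gB b (J b u) (J b u) = gB b u u"
    and metric_J: "gB b u (J b u) = 0"
proof -
  obtain p where p: "b = \<pi> p" using proj_surj by blast
  note u = assms[unfolded p]
  have l: "lift p u \<in> tangent_space A p" "\<eta> p (lift p u) = 0" using lift_horizontal[OF u] unfolding horizontal_iff by auto
  show "J b u \<in> tangent_space B b" unfolding p by (rule J_tangent[OF u])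
  show "gB b (J b u) (J b u) = gB b u u" "gB b u (J b u) = 0"
    unfolding p using metric_lift_lift[OF J_tangent[OF u] J_tangent[OF u]] metric_lift_lift[OF u J_tangent[OF u]]
      metric_lift_lift[OF u u] metric_phi[OF l(1) l(1)] l(2) metric_phi_self(1)[OF l(1)]
    by (simp_all add: lift_J[OF u])
qed

lemma base_expand:
  assumes u: "u \<in> tangent_space B b" "gB b u u = 1" and w: "w \<in> tangent_space B b"
  shows "w = (\<lambda>h. gB b w u * u h + gB b w (J b u) * J b u h)"
proof -
  let ?u = "\<lambda>k::nat. if k = 0 then u else J b u"
  have "w = (\<lambda>h. \<Sum>k\<in>{0,1}. gB b w (?u k) * ?u k h)"
  proof (rule base.orthonormal_expand)
    show "?u k \<in> tangent_space B b" for k using u J_in_tangent by simp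
    show "gB b (?u k) (?u j) = of_bool (k = j)" if "k \<in> {0,1}" "j \<in> {0,1}" for k j
      using that u metric_J_J[OF u(1)] metric_J[OF u(1)] base.metric_sym[OF u(1) J_in_tangent[OF u(1)]] by auto
  qed (use w in auto)
  then show ?thesis by simp
qed

end

section \<open>The Hopf cylinder\<close>

text \<open>Two integrations: on an interval a vanishing derivative forces a constant, which makes
  \<open>a\<close> and \<open>b\<close> the same for the whole curve.\<close>

lemma second_deriv_zero_iff_affine:
  fixes k :: "real \<Rightarrow> real"
  assumes "open I" "is_interval I" and k: "\<And>s. s \<in> I \<Longrightarrow> smooth_near k s"
  shows "(\<forall>s\<in>I. deriv (deriv k) s = 0) \<longleftrightarrow> (\<exists>a b. \<forall>s\<in>I. k s = a * s + b)"
proof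
  assume z: "\<forall>s\<in>I. deriv (deriv k) s = 0"
  have c: "convex I" using assms(2) is_interval_convex by blast
  have "(deriv k has_real_derivative 0) (at s within I)" if "s \<in> I" for s
    using deriv_eq_frechet_derivative(2)[OF smooth_near_deriv[OF k[OF that]]] z that
    by (simp add: has_field_derivative_at_within)
  from has_field_derivative_zero_constant[OF c this]
  obtain a where a: "\<And>s. s \<in> I \<Longrightarrow> deriv k s = a" by auto
  have "((\<lambda>s. k s - a * s) has_real_derivative 0) (at s within I)" if "s \<in> I" for s
  proof -
    have "(k has_real_derivative a) (at s)"
      using deriv_eq_frechet_derivative(2)[OF k[OF that]] a[OF that] by simp
    then have "((\<lambda>s. k s - a * s) has_real_derivative a - a * 1) (at s)"
      by (intro DERIV_diff DERIV_cmult DERIV_ident)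
    then show ?thesis by (simp add: has_field_derivative_at_within)
  qed
  from has_field_derivative_zero_constant[OF c this]
  obtain b where "\<forall>s\<in>I. k s - a * s = b" by auto
  then have "\<forall>s\<in>I. k s = a * s + b" by (simp add: diff_eq_eq add.commute)
  then show "\<exists>a b. \<forall>s\<in>I. k s = a * s + b" by blast
next
  assume "\<exists>a b. \<forall>s\<in>I. k s = a * s + b"
  then obtain a b where ab: "\<And>s. s \<in> I \<Longrightarrow> k s = a * s + b" by blast
  \<comment> \<open>Openness of \<open>I\<close> makes the affine formula hold near each point, so
    it can be differentiated.\<close>
  have near: "\<forall>\<^sub>F t in nhds s. t \<in> I" if "s \<in> I" for s
    by (rule eventually_nhds_in_open[OF assms(1) that])
  have d: "deriv k s = a" if "s \<in> I" for s
  proof -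
    have "deriv k s = deriv (\<lambda>s. a * s + b) s"
      by (rule deriv_cong_ev[OF _ refl]) (use near[OF that] in eventually_elim, rule ab)
    also have "\<dots> = a" by (rule DERIV_imp_deriv) (auto intro!: derivative_eq_intros)
    finally show ?thesis .
  qed
  show "\<forall>s\<in>I. deriv (deriv k) s = 0"
  proof
    fix s assume s: "s \<in> I"
    have "deriv (deriv k) s = deriv (\<lambda>_. a) s"
      by (rule deriv_cong_ev[OF _ refl]) (use near[OF s] in eventually_elim, rule d)
    then show "deriv (deriv k) s = 0" by simp
  qed
qed

locale hopf_cylinder_over_curve =
  boothby_wang_fibering A g D \<eta> \<xi> \<phi> \<Phi> B gB DB \<pi> J + cyl: hopf_cylinder S A \<pi> I \<gamma> \<sigma> \<iota>
  for A :: "('m::{t2_space,second_countable_topology}, real^3) chart set" and g D \<eta> \<xi> \<phi> \<Phi>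
    and B :: "('b::{t2_space,second_countable_topology}, real^2) chart set" and gB DB \<pi> J
    and I \<gamma> and S :: "('s::{t2_space,second_countable_topology}, real^2) chart set" and \<sigma> \<iota> +
  assumes unit_speed: "unit_speed_curve B gB I \<gamma>"

sublocale hopf_cylinder_over_curve \<subseteq> crv: map_into_riemannian B gB DB line I \<gamma>
  by unfold_locales (use unit_speed in \<open>simp add: unit_speed_curve_def\<close>)

sublocale hopf_cylinder_over_curve \<subseteq> imm: map_into_riemannian A g D S UNIV \<iota>
  by unfold_locales (rule cyl.iota_smooth)

lemma line_smooth_map: "smooth_map line line UNIV (\<lambda>t. t)"
  using smooth_near_id by (auto simp: smooth_map_def line_def comp_def smooth_on_iff_near)

context hopf_cylinder_over_curve
begin

abbreviation vel where "vel s \<equiv> velocity B \<gamma> s"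
abbreviation acc where "acc s \<equiv> acceleration B DB \<gamma> s"
abbreviation \<kappa> where "\<kappa> s \<equiv> signed_curvature B DB J \<gamma> s"
text \<open>Chart components of the velocity. The same functions of arclength reappear as components
  of the lifted velocity in the lifted coordinate fields.\<close>

abbreviation coeff where "coeff y b s \<equiv> deriv (\<lambda>t. y (\<gamma> t) \<bullet> b) s"
abbreviation ddt where "ddt s \<equiv> velocity line (\<lambda>t. t) s"

section \<open>The base curve: velocity, acceleration and signed curvature\<close>

lemma I_open: "open I" and I_interval: "is_interval I"
  using unit_speed unfolding unit_speed_curve_def by auto

lemma vel_tangent: "s \<in> I \<Longrightarrow> vel s \<in> tangent_space B (\<gamma> s)"
  by (rule base.velocity_tangent[OF crv.smooth_map])

lemma vel_unit: "s \<in> I \<Longrightarrow> gB (\<gamma> s) (vel s) (vel s) = 1"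
  using unit_speed unfolding unit_speed_curve_def by auto

lemma eventually_in_I: "s \<in> I \<Longrightarrow> \<forall>\<^sub>F r in nhds s. r \<in> I"
  by (rule eventually_nhds_in_open[OF I_open])

lemma coeff_smooth:
  assumes "s \<in> I" "(V, y) \<in> B" "\<gamma> s \<in> V"
  shows "smooth_near (coeff y b) s"
  using crv.pull_smooth_at[OF assms(1) base.smooth_at_coordinate[OF assms(2,3)]]
  unfolding smooth_at_line_iff by (rule smooth_near_deriv)

lemma vel_expand:
  assumes "s \<in> I" "(V, y) \<in> B" "\<gamma> s \<in> V"
  shows "vel s = (\<lambda>h. \<Sum>b\<in>Basis. coeff y b s * coord_vec B V y b (\<gamma> s) h)"
proof -
  have "vel s (\<lambda>r. y r \<bullet> b) = coeff y b s" for b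
    using base.smooth_at_coordinate[OF assms(2,3)] by (simp add: velocity_def)
  then show ?thesis using base.tangent_expand[OF vel_tangent[OF assms(1)] assms(2,3)] by simp
qed

lemma vel_represents:
  assumes "s \<in> I" "(V, y) \<in> B" "\<gamma> s \<in> V"
  shows "crv.represents s Basis (\<lambda>b. coeff y b) (\<lambda>b. coord_vec B V y b) (velocity B \<gamma>)"
proof -
  have "\<forall>\<^sub>F r in nhds s. \<gamma> r \<in> V"
    by (rule crv.eventually_pull[OF assms(1) eventually_nhds_in_open[OF base.chart_open[OF assms(2)] assms(3)]])
  then have "\<forall>\<^sub>F r in nhds s. vel r = (\<lambda>h. \<Sum>b\<in>Basis. coeff y b r * coord_vec B V y b (\<gamma> r) h)"
    using eventually_in_I[OF assms(1)] by eventually_elim (rule vel_expand[OF _ assms(2)])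
  then show ?thesis
    unfolding crv.represents_def using base.vfield_at_coord_vec[OF assms(2,3)] coeff_smooth[OF assms]
    by (simp add: smooth_at_line_iff)
qed

lemma ddt_tangent: "ddt s \<in> tangent_space line s"
  using line.velocity_tangent[OF line_smooth_map UNIV_I] .

lemma ddt_apply: "smooth_near f s \<Longrightarrow> ddt s f = deriv f s"
  by (simp add: velocity_def smooth_at_line_iff)

lemma push_ddt:
  assumes "s \<in> I" shows "push B \<gamma> s (ddt s) = vel s"
proof
  fix f
  show "push B \<gamma> s (ddt s) f = vel s f"
    using crv.pull_smooth_at[OF assms, of f]
    by (auto simp: push_def velocity_def comp_def)
qed

lemma vel_section: "s \<in> I \<Longrightarrow> crv.smooth_section s (velocity B \<gamma>)"
  by (rule base.obtain_chart[of "\<gamma> s"]) (rule crv.represents_imp_section[OF vel_represents])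

lemma acc_tangent: "s \<in> I \<Longrightarrow> acc s \<in> tangent_space B (\<gamma> s)"
  unfolding acceleration_def by (rule crv.cov_along_tangent[OF _ ddt_tangent vel_section])

lemma acc_expand:
  assumes "s \<in> I" "(V, y) \<in> B" "\<gamma> s \<in> V"
  shows "acc s = (\<lambda>h. \<Sum>b\<in>Basis. deriv (coeff y b) s * coord_vec B V y b (\<gamma> s) h
    + coeff y b s * DB (\<gamma> s) (vel s) (coord_vec B V y b) h)"
  unfolding acceleration_def crv.cov_along_represents[OF assms(1) ddt_tangent vel_represents[OF assms]]
    crv.rep_deriv_def push_ddt[OF assms(1)]
  by (simp add: ddt_apply[OF coeff_smooth[OF assms]])

text \<open>Differentiate the constant squared speed.\<close>

lemma acc_orthogonal:
  assumes "s \<in> I" shows "gB (\<gamma> s) (acc s) (vel s) = 0"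
proof -
  have "\<forall>\<^sub>F r in nhds s. gB (\<gamma> r) (vel r) (vel r) = 1"
    using eventually_in_I[OF assms] by eventually_elim (rule vel_unit)
  then have "ddt s (\<lambda>r. gB (\<gamma> r) (vel r) (vel r)) = ddt s (\<lambda>_. 1)"
    by (rule line.tangent_cong[OF ddt_tangent])
  also have "\<dots> = 0" by (rule line.tangent_const[OF ddt_tangent])
  finally show ?thesis
    unfolding crv.metric_cov_along[OF assms ddt_tangent vel_section[OF assms] vel_section[OF assms]]
    using base.metric_sym[OF acc_tangent[OF assms] vel_tangent[OF assms]] by (simp add: acceleration_def)
qed

text \<open>In a surface a vector orthogonal to the unit velocity is a multiple of its image under
  \<open>J\<close>. Pairing with that unit vector makes the described number explicit and
  unique.\<close>

lemma curvature_eq: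
  assumes "s \<in> I"
  shows "\<kappa> s = gB (\<gamma> s) (acc s) (J (\<gamma> s) (vel s))"
proof -
  note v = vel_tangent[OF assms] and a = acc_tangent[OF assms]
  note Jv = J_in_tangent[OF v]
  have *: "acc s = (\<lambda>h. gB (\<gamma> s) (acc s) (J (\<gamma> s) (vel s)) * J (\<gamma> s) (vel s) h)"
    using base_expand[OF v vel_unit[OF assms] a] acc_orthogonal[OF assms] by simp
  show "\<kappa> s = gB (\<gamma> s) (acc s) (J (\<gamma> s) (vel s))"
    unfolding signed_curvature_def
  proof (rule the_equality)
    show "acc s = (\<lambda>h. gB (\<gamma> s) (acc s) (J (\<gamma> s) (vel s)) * J (\<gamma> s) (vel s) h)" by (rule *)
    fix k assume k: "acc s = (\<lambda>h. k * J (\<gamma> s) (vel s) h)"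
    have "gB (\<gamma> s) (acc s) (J (\<gamma> s) (vel s)) = gB (\<gamma> s) (\<lambda>h. k * J (\<gamma> s) (vel s) h) (J (\<gamma> s) (vel s))"
      by (rule arg_cong[OF k, where f = "\<lambda>z. gB (\<gamma> s) z (J (\<gamma> s) (vel s))"])
    also have "\<dots> = k * gB (\<gamma> s) (J (\<gamma> s) (vel s)) (J (\<gamma> s) (vel s))"
      by (rule base.metric_scale_left[OF Jv Jv])
    also have "\<dots> = k" unfolding metric_J_J[OF v] vel_unit[OF assms] by simp
    finally show "k = gB (\<gamma> s) (acc s) (J (\<gamma> s) (vel s))" by (rule sym)
  qed
qed

section \<open>Tangent and normal spaces of the cylinder\<close>

lemma
  shows pi_iota: "\<pi> (\<iota> q) = \<gamma> (\<sigma> q)" and sigma_in_I: "\<sigma> q \<in> I"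
    and obtain_over: "s \<in> I \<Longrightarrow> \<exists>q. \<sigma> q = s"
proof -
  have r: "range (\<lambda>q. (\<sigma> q, \<iota> q)) = {(s, p). s \<in> I \<and> \<pi> p = \<gamma> s}"
    using cyl.homeo unfolding homeomorphism_def by blast
  then have "(\<sigma> q, \<iota> q) \<in> {(s, p). s \<in> I \<and> \<pi> p = \<gamma> s}" by blast
  then show "\<pi> (\<iota> q) = \<gamma> (\<sigma> q)" "\<sigma> q \<in> I" by auto
  assume s: "s \<in> I"
  obtain p where "\<gamma> s = \<pi> p" using proj_surj by blast
  then have "(s, p) \<in> range (\<lambda>q. (\<sigma> q, \<iota> q))" unfolding r using s by simp
  then show "\<exists>q. \<sigma> q = s" by blast
qed

lemma smooth_at_sigma: "smooth_near k (\<sigma> q) \<Longrightarrow> smooth_at S q (\<lambda>r. k (\<sigma> r))"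
  using line.smooth_at_compose[OF cyl.smooth_manifold_axioms cyl.sigma_smooth UNIV_I]
  by (simp add: smooth_at_line_iff)

lemma tangent_sigma:
  assumes "w \<in> tangent_space S q" "smooth_near k (\<sigma> q)"
  shows "w (\<lambda>r. k (\<sigma> r)) = deriv k (\<sigma> q) * w \<sigma>"
  using cyl.tangent_real_compose[OF assms(1) smooth_at_sigma[OF smooth_near_id] assms(2)] .

abbreviation T where "T q \<equiv> lift (\<iota> q) (vel (\<sigma> q))"
abbreviation n where "n q \<equiv> \<phi> (\<iota> q) (T q)"

lemma vel_sigma_tangent: "vel (\<sigma> q) \<in> tangent_space B (\<pi> (\<iota> q))"
  unfolding pi_iota by (rule vel_tangent[OF sigma_in_I])

lemma T_horizontal: "T q \<in> horizontal_space A g \<xi> (\<iota> q)"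
  by (rule lift_horizontal[OF vel_sigma_tangent])

lemma T_tangent: "T q \<in> tangent_space A (\<iota> q)"
  by (rule horizontal_tangent[OF T_horizontal])

lemma n_tangent: "n q \<in> tangent_space A (\<iota> q)"
  by (rule phi_tangent[OF T_tangent])

lemma n_eq_lift: "n q = lift (\<iota> q) (J (\<gamma> (\<sigma> q)) (vel (\<sigma> q)))"
  using lift_J[OF vel_sigma_tangent] by (simp add: pi_iota)

lemma eta_T: "\<eta> (\<iota> q) (T q) = 0"
  using T_horizontal horizontal_iff by blast

lemma T_unit: "g (\<iota> q) (T q) (T q) = 1"
  using metric_lift_lift[OF vel_sigma_tangent vel_sigma_tangent] vel_unit[OF sigma_in_I] by (simp add: pi_iota)

lemma n_unit: "g (\<iota> q) (n q) (n q) = 1"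
  using metric_phi[OF T_tangent T_tangent] by (simp add: eta_T T_unit)

text \<open>Differentiate the identity \<pi> o \<iota> = \<gamma> o \<sigma>; the chain rule on the
  right produces the factor \<open>w \<sigma>\<close>.\<close>

lemma push_pi_push_iota:
  assumes "w \<in> tangent_space S q"
  shows "push B \<pi> (\<iota> q) (push A \<iota> q w) = (\<lambda>f. w \<sigma> * vel (\<sigma> q) f)"
proof
  fix f
  show "push B \<pi> (\<iota> q) (push A \<iota> q w) f = w \<sigma> * vel (\<sigma> q) f"
  proof (cases "smooth_at B (\<gamma> (\<sigma> q)) f")
    case True
    then have "smooth_at A (\<iota> q) (\<lambda>p. f (\<pi> p))" using proj.pull_smooth_at[of "\<iota> q" f] by (simp add: pi_iota)
    moreover have "w (\<lambda>r. f (\<gamma> (\<sigma> r))) = deriv (\<lambda>s. f (\<gamma> s)) (\<sigma> q) * w \<sigma>"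
      using tangent_sigma[OF assms, of "\<lambda>s. f (\<gamma> s)"] crv.pull_smooth_at[OF sigma_in_I True]
      by (simp add: smooth_at_line_iff)
    ultimately show ?thesis using True by (simp add: push_def velocity_def comp_def pi_iota)
  qed (simp add: push_def velocity_def pi_iota)
qed

text \<open>The horizontal part of the image is determined by its projection, which is
  \<open>w \<sigma>\<close> times the velocity and hence lifts to \<open>w \<sigma>\<close> times
  \<open>T q\<close>.\<close>

lemma push_iota:
  assumes "w \<in> tangent_space S q"
  shows "push A \<iota> q w = tcomb (w \<sigma>) (T q) (\<eta> (\<iota> q) (push A \<iota> q w)) (\<xi> (\<iota> q))"
proof -
  let ?p = "\<iota> q" let ?z = "push A \<iota> q w"
  have z: "?z \<in> tangent_space A ?p" by (rule imm.push_in_tangent[OF UNIV_I assms])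
  let ?h = "tcomb 1 ?z (- \<eta> ?p ?z) (\<xi> ?p)"
  have h: "?h \<in> horizontal_space A g \<xi> ?p"
    unfolding horizontal_iff using tangent_tcomb[OF z xi_tangent] eta_tcomb[OF z xi_tangent, of 1 "- \<eta> ?p ?z"]
    by (simp add: Reeb_eta)
  have h': "tcomb (w \<sigma>) (T q) 0 (T q) \<in> horizontal_space A g \<xi> ?p" by (rule horizontal_tcomb[OF T_horizontal T_horizontal])
  have "push B \<pi> ?p ?h = push B \<pi> ?p (tcomb (w \<sigma>) (T q) 0 (T q))"
    unfolding push_tcomb push_xi push_pi_push_iota[OF assms] push_lift[OF vel_sigma_tangent] by (simp add: tcomb_def)
  then have eq: "?h = tcomb (w \<sigma>) (T q) 0 (T q)" by (metis lift_unique[OF h] lift_unique[OF h'])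
  show ?thesis
  proof
    fix f
    show "?z f = tcomb (w \<sigma>) (T q) (\<eta> ?p ?z) (\<xi> ?p) f"
      using fun_cong[OF eq, of f] by (simp add: tcomb_def)
  qed
qed

lemma vel_nonzero:
  assumes "(\<lambda>f. c * vel (\<sigma> q) f) = (\<lambda>f. d * vel (\<sigma> q) f)" shows "c = d"
proof -
  note v = vel_tangent[OF sigma_in_I[of q]]
  have "gB (\<gamma> (\<sigma> q)) (\<lambda>f. c * vel (\<sigma> q) f) (vel (\<sigma> q)) = gB (\<gamma> (\<sigma> q)) (\<lambda>f. d * vel (\<sigma> q) f) (vel (\<sigma> q))"
    using assms by simp
  then show ?thesis unfolding base.metric_scale_left[OF v v] by (simp add: vel_unit[OF sigma_in_I])
qed

lemma push_iota_tcomb: "push A \<iota> q (tcomb a v b w) = tcomb a (push A \<iota> q v) b (push A \<iota> q w)"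
  by (auto simp: push_def tcomb_def)

text \<open>The axiom \<open>immersion\<close> concerns \<sigma> and \<iota> jointly. A vector
  killed by \<iota> has zero projection to the base, and since the velocity is nonzero, \<sigma>
  kills it too.\<close>

lemma push_iota_injective:
  assumes w: "w \<in> tangent_space S q" and 0: "push A \<iota> q w = tzero"
  shows "w = tzero"
proof -
  have "(\<lambda>f. w \<sigma> * vel (\<sigma> q) f) = (\<lambda>f. 0 * vel (\<sigma> q) f)"
    using push_pi_push_iota[OF w] unfolding 0 by (simp add: push_def)
  then have "w \<sigma> = 0" by (rule vel_nonzero)
  then have "push line \<sigma> q w = tzero"
    using tangent_sigma[OF w] by (auto simp: push_def comp_def smooth_at_line_iff)
  then show ?thesis using cyl.immersion[OF w _ 0] by blast
qed

text \<open>The functionals giving the coefficients of \<open>T q\<close> and \<xi> have trivial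
  joint kernel, so on a two-dimensional tangent space they take every pair of values.\<close>

lemma obtain_surface_vector:
  obtains w where "w \<in> tangent_space S q" "push A \<iota> q w = tcomb a (T q) b (\<xi> (\<iota> q))"
proof -
  let ?l = "\<lambda>k::nat. \<lambda>w. if k = 0 then w \<sigma> else \<eta> (\<iota> q) (push A \<iota> q w)"
  have lin: "?l k (tcomb a v b w) = a * ?l k v + b * ?l k w"
    if "v \<in> tangent_space S q" "w \<in> tangent_space S q" for k v w a b
    using eta_tcomb[OF imm.push_in_tangent[OF UNIV_I that(1)] imm.push_in_tangent[OF UNIV_I that(2)], of a b]
    by (simp add: push_iota_tcomb) (simp add: tcomb_def)
  have ker: "\<forall>w\<in>tangent_space S q. (\<forall>k\<in>{0,1}. ?l k w = 0) \<longrightarrow> w = tzero"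
  proof (intro ballI impI)
    fix w assume w: "w \<in> tangent_space S q" "\<forall>k\<in>{0,1}. ?l k w = 0"
    then have "push A \<iota> q w = tzero" using push_iota[OF w(1)] by (simp add: tcomb_def)
    then show "w = tzero" by (rule push_iota_injective[OF w(1)])
  qed
  have "\<forall>c. \<exists>w\<in>tangent_space S q. \<forall>k\<in>{0,1}. ?l k w = c k"
    by (subst cyl.functionals_injective_iff_surjective[symmetric]) (use lin ker in auto)
  from spec[OF this, of "\<lambda>k. if k = 0 then a else b"]
  obtain w where w: "w \<in> tangent_space S q" "w \<sigma> = a" "\<eta> (\<iota> q) (push A \<iota> q w) = b" by auto
  then show thesis using that push_iota[OF w(1)] by simp
qed

abbreviation E1 where "E1 q \<equiv> frame_t S A g \<xi> B \<pi> \<gamma> \<sigma> \<iota> q"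
abbreviation E2 where "E2 q \<equiv> frame_xi S A \<xi> \<iota> q"

lemma the_surface_vector:
  assumes "z = tcomb a (T q) b (\<xi> (\<iota> q))"
  shows "(THE w. w \<in> tangent_space S q \<and> push A \<iota> q w = z) \<in> tangent_space S q"
    and "push A \<iota> q (THE w. w \<in> tangent_space S q \<and> push A \<iota> q w = z) = z"
proof -
  obtain w where w: "w \<in> tangent_space S q" "push A \<iota> q w = z" unfolding assms by (rule obtain_surface_vector)
  have "(THE w. w \<in> tangent_space S q \<and> push A \<iota> q w = z) = w"
  proof (rule the_equality)
    fix w' assume w': "w' \<in> tangent_space S q \<and> push A \<iota> q w' = z"
    have "push A \<iota> q (tcomb 1 w' (-1) w) = tzero" unfolding push_iota_tcomb using w w' by (simp add: tcomb_def)
    then have "tcomb 1 w' (-1) w = tzero" using push_iota_injective cyl.tangent_tcomb w w' by blast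
    then show "w' = w" by (auto simp: tcomb_def fun_eq_iff)
  qed (use w in blast)
  then show "(THE w. w \<in> tangent_space S q \<and> push A \<iota> q w = z) \<in> tangent_space S q"
    "push A \<iota> q (THE w. w \<in> tangent_space S q \<and> push A \<iota> q w = z) = z" using w by auto
qed

lemma E1_tangent: "E1 q \<in> tangent_space S q" and push_E1: "push A \<iota> q (E1 q) = T q"
  using the_surface_vector[of "T q" 1 q 0] unfolding frame_t_def by (simp_all add: tcomb_def)

lemma E2_tangent: "E2 q \<in> tangent_space S q" and push_E2: "push A \<iota> q (E2 q) = \<xi> (\<iota> q)"
  using the_surface_vector[of "\<xi> (\<iota> q)" 0 q 1] unfolding frame_xi_def by (simp_all add: tcomb_def)

text \<open>Projecting \<open>push_E1\<close> to the base shows that the velocity is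
  \<open>E1 q \<sigma>\<close> times itself.\<close>

lemma E1_sigma: "E1 q \<sigma> = 1"
  by (rule vel_nonzero[of _ q])
    (use push_pi_push_iota[OF E1_tangent, of q] push_lift[OF vel_sigma_tangent, of q] in \<open>simp add: push_E1\<close>)

lemma E2_sigma: "E2 q \<sigma> = 0"
  by (rule vel_nonzero[of _ q]) (use push_pi_push_iota[OF E2_tangent, of q] in \<open>simp add: push_E2 push_xi\<close>)

lemma metric_n:
  shows "g (\<iota> q) (n q) (tcomb a (T q) b (\<xi> (\<iota> q))) = 0"
  by (simp add: metric_linear_right[OF T_tangent xi_tangent n_tangent] metric_phi_self[OF T_tangent]
      metric_xi_right[OF n_tangent] eta_phi[OF T_tangent])

text \<open>Removing the component along \<open>n q\<close> from the orthonormal expansion of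
  \<open>w\<close> leaves a combination of \<open>T q\<close> and \<xi>, which is the image of a
  surface vector.\<close>

lemma normal_part_eq:
  assumes w: "w \<in> tangent_space A (\<iota> q)"
  shows "normal_part S A g \<iota> q w = (\<lambda>h. g (\<iota> q) w (n q) * n q h)"
proof -
  let ?p = "\<iota> q" let ?m = "\<lambda>h. g ?p w (n q) * n q h"
  have im: "\<exists>a b. u = tcomb a (T q) b (\<xi> ?p)" if "u \<in> tangent_image S A \<iota> q" for u
    using that push_iota unfolding tangent_image_def by blast
  have m: "?m \<in> tangent_space A ?p" by (rule tangent_scale[OF n_tangent])
  show ?thesis
    unfolding normal_part_def
  proof (rule the_equality)
    have "?m \<in> normal_space S A g \<iota> q"
      unfolding normal_space_def
    proof (intro CollectI conjI ballI m)
      fix u assume "u \<in> tangent_image S A \<iota> q"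
      then obtain a b where u: "u = tcomb a (T q) b (\<xi> ?p)" using im by blast
      show "g ?p ?m u = 0"
        unfolding u metric_scale_left[OF n_tangent tangent_tcomb[OF T_tangent xi_tangent]] metric_n by simp
    qed
    moreover have "tcomb 1 w (-1) ?m = tcomb (g ?p w (T q)) (T q) (\<eta> ?p w) (\<xi> ?p)"
      by (subst (1) frame_expand[OF T_horizontal T_unit w]) (simp add: tcomb_def fun_eq_iff)
    then have "tcomb 1 w (-1) ?m \<in> tangent_image S A \<iota> q"
      using obtain_surface_vector unfolding tangent_image_def by (metis imageI)
    ultimately show "?m \<in> normal_space S A g \<iota> q \<and> tcomb 1 w (-1) ?m \<in> tangent_image S A \<iota> q" by blast
    fix m' assume m': "m' \<in> normal_space S A g \<iota> q \<and> tcomb 1 w (-1) m' \<in> tangent_image S A \<iota> q"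
    obtain a b where ab: "tcomb 1 w (-1) m' = tcomb a (T q) b (\<xi> ?p)" using im m' by blast
    have m'T: "m' \<in> tangent_space A ?p" using m' unfolding normal_space_def by blast
    \<comment> \<open>The difference of two candidates is both normal and tangential, hence
      orthogonal to itself.\<close>
    have "tcomb 1 m' (-1) ?m = tzero"
    proof -
      let ?d = "tcomb 1 m' (-1) ?m"
      have dT: "?d \<in> tangent_space A ?p" by (rule tangent_tcomb[OF m'T m])
      have d: "?d = tcomb (g ?p w (T q) - a) (T q) (\<eta> ?p w - b) (\<xi> ?p)"
        using ab \<open>tcomb 1 w (-1) ?m = _\<close> by (auto simp: tcomb_def fun_eq_iff algebra_simps)
      then have "?d \<in> tangent_image S A \<iota> q"
        using obtain_surface_vector unfolding tangent_image_def by (metis imageI)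
      then have "g ?p m' ?d = 0" "g ?p ?m ?d = 0"
        using m' \<open>?m \<in> normal_space S A g \<iota> q\<close> unfolding normal_space_def by blast+
      then have "g ?p ?d ?d = 0" unfolding metric_linear[OF m'T m dT] by simp
      then show ?thesis using metric_pos[OF dT] by fastforce
    qed
    then show "m' = ?m" by (auto simp: tcomb_def fun_eq_iff)
  qed
qed

section \<open>Sections along the cylinder and transfer of the curvature\<close>

abbreviation X where "X V y b \<equiv> \<lambda>p. lift p (coord_vec B V y b (\<pi> p))"

lemma X_vfield_at:
  assumes "(V, y) \<in> B" "\<gamma> (\<sigma> q) \<in> V"
  shows "vfield_at A (\<iota> q) (X V y b)"
  by (rule lift_vfield_at[OF base.vfield_at_coord_vec[OF assms(1)]]) (simp add: pi_iota assms)

lemma eventually_over: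
  assumes "(V, y) \<in> B" "\<gamma> (\<sigma> q) \<in> V"
  shows "\<forall>\<^sub>F r in nhds q. \<gamma> (\<sigma> r) \<in> V"
proof -
  have "\<forall>\<^sub>F p in nhds (\<iota> q). \<pi> p \<in> V"
    by (rule proj.eventually_pull[OF UNIV_I eventually_nhds_in_open[OF base.chart_open[OF assms(1)]]])
      (simp add: pi_iota assms)
  from imm.eventually_pull[OF UNIV_I this] show ?thesis by (simp add: pi_iota)
qed

lemma T_expand:
  assumes "(V, y) \<in> B" "\<gamma> (\<sigma> q) \<in> V"
  shows "T q = (\<lambda>h. \<Sum>b\<in>Basis. coeff y b (\<sigma> q) * X V y b (\<iota> q) h)"
  unfolding vel_expand[OF sigma_in_I assms] pi_iota
  by (rule lift_lincomb) (simp add: pi_iota base.coord_vec_tangent assms)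

text \<open>\<open>T\<close> lives only along the cylinder, but the lifted coordinate fields are
  defined near the points of the ambient manifold, and the coefficients depend on \<sigma>
  alone.\<close>

lemma T_represents:
  assumes "(V, y) \<in> B" "\<gamma> (\<sigma> q) \<in> V"
  shows "imm.represents q Basis (\<lambda>b r. coeff y b (\<sigma> r)) (X V y) (\<lambda>r. T r)"
proof -
  have "\<forall>\<^sub>F r in nhds q. T r = (\<lambda>h. \<Sum>b\<in>Basis. coeff y b (\<sigma> r) * X V y b (\<iota> r) h)"
    using eventually_over[OF assms] by eventually_elim (rule T_expand[OF assms(1)])
  then show ?thesis
    unfolding imm.represents_def using X_vfield_at[OF assms] smooth_at_sigma[OF coeff_smooth[OF sigma_in_I assms]] by simp
qed

text \<open>\<phi> preserves smoothness of the ambient lifted fields and passes through the linear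
  combination.\<close>

lemma n_section: "imm.smooth_section q (\<lambda>r. n r)"
proof -
  obtain V y where V: "(V, y) \<in> B" "\<gamma> (\<sigma> q) \<in> V" by (rule base.obtain_chart)
  have "\<forall>\<^sub>F r in nhds q. n r = (\<lambda>h. \<Sum>b\<in>Basis. coeff y b (\<sigma> r) * \<phi> (\<iota> r) (X V y b (\<iota> r)) h)"
    using eventually_over[OF V]
  proof eventually_elim
    case (elim r)
    show ?case unfolding T_expand[OF V(1) elim]
      by (rule phi_lincomb) (rule vfield_at_tangent[OF X_vfield_at[OF V(1) elim]])
  qed
  then have "imm.represents q Basis (\<lambda>b r. coeff y b (\<sigma> r)) (\<lambda>b p. \<phi> p (X V y b p)) (\<lambda>r. n r)"
    unfolding imm.represents_def
    using phi_vfield_at[OF X_vfield_at[OF V]] smooth_at_sigma[OF coeff_smooth[OF sigma_in_I V]] by simp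
  then show ?thesis by (rule imm.represents_imp_section)
qed

lemma cov_E1_T:
  assumes "(V, y) \<in> B" "\<gamma> (\<sigma> q) \<in> V"
  shows "cov_along S A D \<iota> q (E1 q) (\<lambda>r. T r) = (\<lambda>h. \<Sum>b\<in>Basis. deriv (coeff y b) (\<sigma> q) * X V y b (\<iota> q) h
    + coeff y b (\<sigma> q) * D (\<iota> q) (T q) (X V y b) h)"
  unfolding imm.cov_along_represents[OF UNIV_I E1_tangent T_represents[OF assms]] imm.rep_deriv_def push_E1
  by (simp add: tangent_sigma[OF E1_tangent coeff_smooth[OF sigma_in_I assms]] E1_sigma)

text \<open>The expansion of the acceleration is paired with \<open>J\<close> of the velocity, whose
  lift is \<open>n q\<close>. Termwise, \<open>metric_lift_lift\<close> and
  \<open>metric_conn_lift\<close> carry the pairings to the total space; only horizontal components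
  are compared, so the vertical part of the derivatives of lifts drops out.\<close>

lemma curvature_eq_metric:
  assumes "(V, y) \<in> B" "\<gamma> (\<sigma> q) \<in> V"
  shows "\<kappa> (\<sigma> q) = (\<Sum>b\<in>Basis. deriv (coeff y b) (\<sigma> q) * g (\<iota> q) (X V y b (\<iota> q)) (n q)
    + coeff y b (\<sigma> q) * g (\<iota> q) (D (\<iota> q) (T q) (X V y b)) (n q))"
proof -
  let ?b = "\<gamma> (\<sigma> q)" let ?v = "vel (\<sigma> q)"
  note v = vel_tangent[OF sigma_in_I[of q]]
  note Jv = J_in_tangent[OF v]
  have c: "coord_vec B V y b ?b \<in> tangent_space B ?b" for b by (rule base.coord_vec_tangent[OF assms])
  have cf: "vfield_at B ?b (coord_vec B V y b)" for b by (rule base.vfield_at_coord_vec[OF assms])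
  have "\<kappa> (\<sigma> q) = (\<Sum>b\<in>Basis. deriv (coeff y b) (\<sigma> q) * gB ?b (coord_vec B V y b ?b) (J ?b ?v)
    + coeff y b (\<sigma> q) * gB ?b (DB ?b ?v (coord_vec B V y b)) (J ?b ?v))"
    unfolding curvature_eq[OF sigma_in_I] acc_expand[OF sigma_in_I assms]
    by (rule base.metric_lincomb2_left[OF Jv c base.conn_tangent[OF v cf]])
  moreover have "gB ?b (coord_vec B V y b ?b) (J ?b ?v) = g (\<iota> q) (X V y b (\<iota> q)) (n q)" for b
    unfolding n_eq_lift using metric_lift_lift[of "coord_vec B V y b ?b" "\<iota> q" "J ?b ?v"] c Jv by (simp add: pi_iota)
  moreover have "gB ?b (DB ?b ?v (coord_vec B V y b)) (J ?b ?v) = g (\<iota> q) (D (\<iota> q) (T q) (X V y b)) (n q)" for b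
    unfolding n_eq_lift using metric_conn_lift[of ?v "\<iota> q" "coord_vec B V y b" "J ?b ?v"] v cf Jv by (simp add: pi_iota)
  ultimately show ?thesis by simp
qed

lemma curvature_eq_cov: "g (\<iota> q) (cov_along S A D \<iota> q (E1 q) (\<lambda>r. T r)) (n q) = \<kappa> (\<sigma> q)"
proof -
  obtain V y where V: "(V, y) \<in> B" "\<gamma> (\<sigma> q) \<in> V" by (rule base.obtain_chart)
  note XT = vfield_at_tangent[OF X_vfield_at[OF V]]
  show ?thesis unfolding curvature_eq_metric[OF V] cov_E1_T[OF V]
    by (rule metric_lincomb2_left[OF n_tangent XT conn_tangent[OF T_tangent X_vfield_at[OF V]]])
qed

lemma T_section: "imm.smooth_section q (\<lambda>r. T r)"
  by (rule base.obtain_chart[of "\<gamma> (\<sigma> q)"]) (rule imm.represents_imp_section[OF T_represents])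

lemma mean_curvature_eq:
  "hopf_mean_curvature_vector S A g D \<xi> B \<pi> \<gamma> \<sigma> \<iota> = (\<lambda>q h. \<kappa> (\<sigma> q) / 2 * n q h)"
proof
  fix q
  have "second_fundamental_form S A g D \<iota> (\<lambda>q. E1 q) (\<lambda>q. E1 q) q = (\<lambda>h. \<kappa> (\<sigma> q) * n q h)"
    unfolding second_fundamental_form_def normal_deriv_def push_E1
      normal_part_eq[OF imm.cov_along_tangent[OF UNIV_I E1_tangent T_section]] curvature_eq_cov ..
  moreover have "second_fundamental_form S A g D \<iota> (\<lambda>q. E2 q) (\<lambda>q. E2 q) q = tzero"
  proof -
    \<comment> \<open>The field \<xi> represents its own restriction with the constant coefficient
      1, so its derivative along \<open>E2 q\<close> is the derivative of \<xi> along
      itself.\<close>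
    have "cov_along S A D \<iota> q (E2 q) (\<lambda>r. \<xi> (\<iota> r)) = tzero"
      unfolding imm.cov_along_represents[OF UNIV_I E2_tangent imm.represents_vfield[OF xi_vfield_at]]
        imm.rep_deriv_def push_E2 conn_xi_xi
      by (simp add: cyl.tangent_const[OF E2_tangent])
    then show ?thesis
      unfolding second_fundamental_form_def normal_deriv_def push_E2
      by (simp add: normal_part_eq[OF tangent_zero] metric_zero_left[OF n_tangent])
  qed
  ultimately show "hopf_mean_curvature_vector S A g D \<xi> B \<pi> \<gamma> \<sigma> \<iota> q = (\<lambda>h. \<kappa> (\<sigma> q) / 2 * n q h)"
    unfolding hopf_mean_curvature_vector_def mean_curvature_vector_def by (simp add: tcomb_def)
qed

section \<open>Normal connection, smoothness of the curvature and the normal Laplacian\<close>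

lemma normal_deriv_n:
  assumes v: "v \<in> tangent_space S q" and a: "smooth_at S q a"
  shows "normal_deriv S A g D \<iota> q v (\<lambda>r h. a r * n r h) = (\<lambda>h. v a * n q h)"
proof -
  let ?c = "cov_along S A D \<iota> q v (\<lambda>r. n r)"
  have cT: "?c \<in> tangent_space A (\<iota> q)" by (rule imm.cov_along_tangent[OF UNIV_I v n_section])
  have "v (\<lambda>r. g (\<iota> r) (n r) (n r)) = 0" by (simp add: n_unit cyl.tangent_const[OF v])
  then have c0: "g (\<iota> q) ?c (n q) = 0"
    unfolding imm.metric_cov_along[OF UNIV_I v n_section n_section] using metric_sym[OF cT n_tangent] by simp
  show ?thesis
    unfolding normal_deriv_def imm.cov_along_scale[OF UNIV_I v n_section a]
      normal_part_eq[OF tangent_tcomb[OF n_tangent cT]] metric_linear[OF n_tangent cT n_tangent]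
    by (simp add: c0 n_unit)
qed

text \<open>\<open>curvature_eq_metric\<close> writes this function through inner products of
  sections along \<iota>. The one section that needs care differentiates in the direction
  \<open>T r\<close>; expanding that direction makes it a combination of the smooth ambient fields
  \<open>D p (X V y d p) (X V y b)\<close>.\<close>

lemma curvature_sigma_smooth: "smooth_at S q (\<lambda>r. \<kappa> (\<sigma> r))"
proof -
  obtain V y where V: "(V, y) \<in> B" "\<gamma> (\<sigma> q) \<in> V" by (rule base.obtain_chart)
  have DX: "imm.smooth_section q (\<lambda>r. D (\<iota> r) (T r) (X V y b))" for b
  proof -
    have "\<forall>\<^sub>F r in nhds q. D (\<iota> r) (T r) (X V y b) =
       (\<lambda>h. \<Sum>d\<in>Basis. coeff y d (\<sigma> r) * D (\<iota> r) (X V y d (\<iota> r)) (X V y b) h)"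
      using eventually_over[OF V]
    proof eventually_elim
      case (elim r)
      note X' = X_vfield_at[OF V(1) elim]
      show ?case unfolding T_expand[OF V(1) elim]
        by (rule conn_sum_direction[OF vfield_at_tangent[OF X'] X'])
    qed
    then have "imm.represents q Basis (\<lambda>b r. coeff y b (\<sigma> r)) (\<lambda>d p. D p (X V y d p) (X V y b)) (\<lambda>r. D (\<iota> r) (T r) (X V y b))"
      unfolding imm.represents_def
      using conn_smooth_at[OF X_vfield_at[OF V] X_vfield_at[OF V]] smooth_at_sigma[OF coeff_smooth[OF sigma_in_I V]] by simp
    then show ?thesis by (rule imm.represents_imp_section)
  qed
  have XS: "imm.smooth_section q (\<lambda>r. X V y b (\<iota> r))" for b
    by (rule imm.represents_imp_section[OF imm.represents_vfield[OF X_vfield_at[OF V]]])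
  have c: "smooth_near (coeff y b) (\<sigma> q)" for b by (rule coeff_smooth[OF sigma_in_I V])
  have "smooth_at S q (\<lambda>r. \<Sum>b\<in>Basis. deriv (coeff y b) (\<sigma> r) * g (\<iota> r) (X V y b (\<iota> r)) (n r)
    + coeff y b (\<sigma> r) * g (\<iota> r) (D (\<iota> r) (T r) (X V y b)) (n r))"
  proof (intro cyl.smooth_at_sum cyl.smooth_at_add cyl.smooth_at_mult)
    fix b :: "real^2"
    show "smooth_at S q (\<lambda>r. deriv (coeff y b) (\<sigma> r))" by (rule smooth_at_sigma[OF smooth_near_deriv[OF c]])
    show "smooth_at S q (\<lambda>r. coeff y b (\<sigma> r))" by (rule smooth_at_sigma[OF c])
    show "smooth_at S q (\<lambda>r. g (\<iota> r) (X V y b (\<iota> r)) (n r))" by (rule imm.smooth_at_metric_section[OF UNIV_I XS n_section])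
    show "smooth_at S q (\<lambda>r. g (\<iota> r) (D (\<iota> r) (T r) (X V y b)) (n r))" by (rule imm.smooth_at_metric_section[OF UNIV_I DX n_section])
  qed
  moreover have "\<forall>\<^sub>F r in nhds q. (\<Sum>b\<in>Basis. deriv (coeff y b) (\<sigma> r) * g (\<iota> r) (X V y b (\<iota> r)) (n r)
    + coeff y b (\<sigma> r) * g (\<iota> r) (D (\<iota> r) (T r) (X V y b)) (n r)) = \<kappa> (\<sigma> r)"
    using eventually_over[OF V] by eventually_elim (rule curvature_eq_metric[OF V(1), symmetric])
  ultimately show ?thesis by (rule cyl.smooth_at_cong)
qed

text \<open>The smoothness of \<open>J\<close> is not an assumption. Instead, \<open>\<kappa> \<circ> \<sigma>\<close> is smooth on the cylinder, and \<open>\<sigma>\<close> restricted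
  to a curve with velocity \<open>E1\<close> is a local diffeomorphism of the line.\<close>

lemma curvature_smooth:
  assumes "s \<in> I" shows "smooth_near (\<lambda>s. \<kappa> s) s"
proof -
  obtain q where q: "\<sigma> q = s" using obtain_over[OF assms] by blast
  obtain c e where c: "velocity S c 0 = E1 q" "c 0 = q" "e > 0" "smooth_map line S {-e<..<e} c"
    using E1_tangent[of q] unfolding tangent_space_def by force
  have c': "smooth_near (\<lambda>t. f (c t)) 0" if "smooth_at S q f" for f
    using cyl.smooth_at_compose[OF line.smooth_manifold_axioms c(4), of 0 f] that c(2,3) by (simp add: smooth_at_line_iff)
  let ?\<psi> = "\<lambda>t. \<sigma> (c t)"
  have \<sigma>: "smooth_at S q \<sigma>" by (rule smooth_at_sigma[OF smooth_near_id])
  have "velocity S c 0 \<sigma> = deriv ?\<psi> 0" using \<sigma> c(2) by (simp add: velocity_def)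
  then have "deriv ?\<psi> 0 \<noteq> 0" using c(1) E1_sigma by simp
  then obtain \<rho> where \<rho>: "smooth_near \<rho> (?\<psi> 0)" "\<rho> (?\<psi> 0) = 0" "\<forall>\<^sub>F s in nhds (?\<psi> 0). ?\<psi> (\<rho> s) = s"
    by (rule smooth_local_inverse[OF c'[OF \<sigma>]])
  have s: "?\<psi> 0 = s" using c(2) q by simp
  note \<rho> = \<rho>[unfolded s]
  have "smooth_near (\<lambda>t. \<kappa> (\<sigma> (c t))) 0" by (rule c'[OF curvature_sigma_smooth])
  then have "smooth_near (\<lambda>s. \<kappa> (\<sigma> (c (\<rho> s)))) s" by (intro smooth_near_compose[OF \<rho>(1)]) (simp add: \<rho>(2))
  moreover have "\<forall>\<^sub>F s in nhds s. \<kappa> (\<sigma> (c (\<rho> s))) = \<kappa> s" using \<rho>(3) by eventually_elim simp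
  ultimately show ?thesis by (rule smooth_near_cong)
qed

lemma normal_laplacian_eq:
  "hopf_normal_laplacian S A g D \<xi> B \<pi> \<gamma> \<sigma> \<iota> (hopf_mean_curvature_vector S A g D \<xi> B \<pi> \<gamma> \<sigma> \<iota>) q =
    (\<lambda>h. - (deriv (deriv (\<lambda>s. \<kappa> s / 2)) (\<sigma> q)) * n q h)"
proof -
  let ?k = "\<lambda>s. \<kappa> s / 2"
  let ?H = "hopf_mean_curvature_vector S A g D \<xi> B \<pi> \<gamma> \<sigma> \<iota>"
  have k: "smooth_near ?k (\<sigma> r)" for r
    using smooth_near_mult[OF curvature_smooth[OF sigma_in_I[of r]] smooth_near_const[of "1/2"]] by simp
  have 1: "normal_deriv S A g D \<iota> r (E1 r) ?H = (\<lambda>h. deriv ?k (\<sigma> r) * n r h)" for r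
    unfolding mean_curvature_eq normal_deriv_n[OF E1_tangent smooth_at_sigma[OF k]]
    by (simp add: tangent_sigma[OF E1_tangent k] E1_sigma)
  \<comment> \<open>The factor 0 keeps the form \<open>a r * n r h\<close>, so that
    \<open>normal_deriv_n\<close> applies again to the result.\<close>
  have 2: "normal_deriv S A g D \<iota> r (E2 r) ?H = (\<lambda>h. 0 * n r h)" for r
    unfolding mean_curvature_eq normal_deriv_n[OF E2_tangent smooth_at_sigma[OF k]]
    by (simp add: tangent_sigma[OF E2_tangent k] E2_sigma)
  have 3: "normal_deriv S A g D \<iota> q (E1 q) (\<lambda>r h. deriv ?k (\<sigma> r) * n r h) = (\<lambda>h. deriv (deriv ?k) (\<sigma> q) * n q h)"
    unfolding normal_deriv_n[OF E1_tangent smooth_at_sigma[OF smooth_near_deriv[OF k]]]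
    by (simp add: tangent_sigma[OF E1_tangent smooth_near_deriv[OF k]] E1_sigma)
  have 4: "normal_deriv S A g D \<iota> q (E2 q) (\<lambda>r h. 0 * n r h) = (\<lambda>h. 0 * n q h)"
    unfolding normal_deriv_n[OF E2_tangent cyl.smooth_at_const] cyl.tangent_const[OF E2_tangent] ..
  show ?thesis
    unfolding hopf_normal_laplacian_def normal_laplacian_def 1 2 3 4 by (simp add: tcomb_def)
qed

lemma n_scale_zero_iff: "(\<lambda>h. c * n q h) = tzero \<longleftrightarrow> c = 0"
proof
  assume "(\<lambda>h. c * n q h) = tzero"
  then have "c * g (\<iota> q) (n q) (n q) = 0"
    using metric_scale_left[OF n_tangent n_tangent, of q c] metric_zero_left[OF n_tangent, of q] by simp
  then show "c = 0" by (simp add: n_unit)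
qed simp

lemma normal_laplacian_zero_iff_clothoid:
  "(\<forall>q. hopf_normal_laplacian S A g D \<xi> B \<pi> \<gamma> \<sigma> \<iota> (hopf_mean_curvature_vector S A g D \<xi> B \<pi> \<gamma> \<sigma> \<iota>) q = tzero)
    \<longleftrightarrow> riemannian_clothoid B DB J I \<gamma>"
proof -
  let ?k = "\<lambda>s. \<kappa> s / 2"
  have k: "smooth_near ?k s" if "s \<in> I" for s
    using smooth_near_mult[OF curvature_smooth[OF that] smooth_near_const[of "1/2"]] by simp
  have "(\<forall>q. hopf_normal_laplacian S A g D \<xi> B \<pi> \<gamma> \<sigma> \<iota> (hopf_mean_curvature_vector S A g D \<xi> B \<pi> \<gamma> \<sigma> \<iota>) q = tzero)
      \<longleftrightarrow> (\<forall>s\<in>I. deriv (deriv ?k) s = 0)"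
    \<comment> \<open>\<sigma> takes values in \<open>I\<close> and attains each of them, so a
      condition at all points of the cylinder is a condition at all parameters of the curve.\<close>
    unfolding normal_laplacian_eq n_scale_zero_iff using sigma_in_I obtain_over by force
  also have "\<dots> \<longleftrightarrow> (\<exists>a b. \<forall>s\<in>I. ?k s = a * s + b)"
    by (rule second_deriv_zero_iff_affine[OF I_open I_interval k])
  also have "\<dots> \<longleftrightarrow> riemannian_clothoid B DB J I \<gamma>"
  proof -
    \<comment> \<open>The factor 2 between curvature and mean curvature is absorbed in the
      coefficients.\<close>
    have "?k s = a * s + b \<longleftrightarrow> \<kappa> s = (2 * a) * s + 2 * b" "\<kappa> s = a * s + b \<longleftrightarrow> ?k s = (a / 2) * s + b / 2" for s a b
      by (auto simp: field_simps)
    then show ?thesis unfolding riemannian_clothoid_def by metis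
  qed
  finally show ?thesis .
qed

lemma geodesic_imp_circle:
  assumes "geodesic B DB I \<gamma>" shows "riemannian_circle B DB J I \<gamma>"
proof -
  have "\<kappa> s = 0" if "s \<in> I" for s
    using curvature_eq[OF that] assms that base.metric_zero_left[OF J_in_tangent[OF vel_tangent[OF that]]]
    unfolding geodesic_def by simp
  then show ?thesis unfolding riemannian_circle_def by blast
qed

lemma circle_imp_clothoid:
  assumes "riemannian_circle B DB J I \<gamma>" shows "riemannian_clothoid B DB J I \<gamma>"
proof -
  obtain c where "\<forall>s\<in>I. \<kappa> s = 0 * s + c" using assms unfolding riemannian_circle_def by auto
  then show ?thesis unfolding riemannian_clothoid_def by blast
qed

end

theorem theorem2p2:
  fixes A :: "('m::{t2_space,second_countable_topology}, real^3) chart set"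
    and g :: "'m \<Rightarrow> 'm tvec \<Rightarrow> 'm tvec \<Rightarrow> real"
    and D :: "'m \<Rightarrow> 'm tvec \<Rightarrow> ('m \<Rightarrow> 'm tvec) \<Rightarrow> 'm tvec"
    and \<eta> :: "'m \<Rightarrow> 'm tvec \<Rightarrow> real"
    and \<xi> :: "'m \<Rightarrow> 'm tvec"
    and \<phi> :: "'m \<Rightarrow> 'm tvec \<Rightarrow> 'm tvec"
    and \<Phi> :: "real \<Rightarrow> 'm \<Rightarrow> 'm"
    and B :: "('b::{t2_space,second_countable_topology}, real^2) chart set"
    and gB :: "'b \<Rightarrow> 'b tvec \<Rightarrow> 'b tvec \<Rightarrow> real"
    and DB :: "'b \<Rightarrow> 'b tvec \<Rightarrow> ('b \<Rightarrow> 'b tvec) \<Rightarrow> 'b tvec"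
    and \<pi> :: "'m \<Rightarrow> 'b"
    and J :: "'b \<Rightarrow> 'b tvec \<Rightarrow> 'b tvec"
    and I :: "real set"
    and \<gamma> :: "real \<Rightarrow> 'b"
    and S :: "('s::{t2_space,second_countable_topology}, real^2) chart set"
    and \<sigma> :: "'s \<Rightarrow> real"
    and \<iota> :: "'s \<Rightarrow> 'm"
  assumes "boothby_wang_fibering A g D \<eta> \<xi> \<phi> \<Phi> B gB DB \<pi> J"
    and "unit_speed_curve B gB I \<gamma>"
    and "hopf_cylinder S A \<pi> I \<gamma> \<sigma> \<iota>"
  shows "(\<forall>q. hopf_normal_laplacian S A g D \<xi> B \<pi> \<gamma> \<sigma> \<iota>
              (hopf_mean_curvature_vector S A g D \<xi> B \<pi> \<gamma> \<sigma> \<iota>) q = tzero) \<longleftrightarrow>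
    geodesic B DB I \<gamma> \<or> riemannian_circle B DB J I \<gamma> \<or> riemannian_clothoid B DB J I \<gamma>"
proof -
  interpret hopf_cylinder_over_curve A g D \<eta> \<xi> \<phi> \<Phi> B gB DB \<pi> J I \<gamma> S \<sigma> \<iota>
    using assms by (intro hopf_cylinder_over_curve.intro hopf_cylinder_over_curve_axioms.intro)
  show ?thesis
    using normal_laplacian_zero_iff_clothoid geodesic_imp_circle circle_imp_clothoid by blast
qed

end
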